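(* $\mathbf{IKP}(\mathcal{E})+\Sigma^{\mathcal E}\text{-Reflection}$ is conservative over $\mathbf{IKP}(\mathcal{E})$ for $\Sigma^{\mathcal E}$-sentences.
   Context: $\mathrm{fun}(f,a,b)$ is the bounded formula expressing that $f$ is a function from $a$ to $b$. The language of $\mathbf{IKP}(\mathcal E)$ is that of set theory with, in addition, primitive exponentiation-bounded quantifiers $(\forall x\in{}^ab)$, $(\exists x\in{}^ab)$ (ranging over $x$ with $\mathrm{fun}(x,a,b)$). $\Delta_0^{\mathcal E}$-formulas are those with no unbounded quantifiers. $\mathbf{IKP}(\mathcal E)$ has intuitionistic logic and axioms: Extensionality for $\Delta_0^{\mathcal E}$ formulas, Pair, Union, Infinity, $\Delta_0^{\mathcal E}$-Separation, $\Delta_0^{\mathcal E}$-Collection, Set Induction for all formulas, and Exponentiation $\exists z(\forall x\in{}^ab)(x\in z)$. $\Sigma^{\mathcal E}$- and $\Pi^{\mathcal E}$-formulas: both contain the $\Delta_0^{\mathcal E}$-formulas and are closed under $\wedge,\vee$, $(\forall x\in t),(\exists x\in t),(\forall x\in{}^ab),(\exists x\in{}^ab)$; $\Sigma^{\mathcal E}$ is closed under $\exists x$ and contains $\neg C$, $C\to A$ whenever $A$ is $\Sigma^{\mathcal E}$ and $C$ is $\Pi^{\mathcal E}$; dually $\Pi^{\mathcal E}$ is closed under $\forall x$ and contains $\neg D$, $D\to A$ whenever $A$ is $\Pi^{\mathcal E}$ and $D$ is $\Sigma^{\mathcal E}$. $\Sigma^{\mathcal E}$-Reflection is the schema $A\to\exists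 z\,A^{z}$ for $\Sigma^{\mathcal E}$-formulas $A$, where $A^{z}$ restricts every unbounded quantifier of $A$ to $z$. *)

theory Defs
  imports Main
begin

type_synonym var = nat

text \<open>Formulas of set theory with primitive bounded quantifiers
  BAll x t A = (forall x in t) A, BEx x t A = (exists x in t) A, and primitive
  exponentiation-bounded quantifiers EAll x a b A = (forall x in ^a b) A,
  EEx x a b A = (exists x in ^a b) A.  The only terms are variables.\<close>

datatype fm =
    Mem var var
  | Eq var var
  | Bot
  | And fm fm
  | Or fm fm
  | Imp fm fm
  | All var fm
  | Ex var fm
  | BAll var var fm
  | BEx var var fm
  | EAll var var var fm
  | EEx var var var fm

definition Neg :: "fm \<Rightarrow> fm" where "Neg A = Imp A Bot"
definition Iff :: "fm \<Rightarrow> fm \<Rightarrow> fm" where "Iff A B = And (Imp A B) (Imp B A)"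

primrec FV :: "fm \<Rightarrow> var set" where
  "FV (Mem x y) = {x, y}"
| "FV (Eq x y) = {x, y}"
| "FV Bot = {}"
| "FV (And A B) = FV A \<union> FV B"
| "FV (Or A B) = FV A \<union> FV B"
| "FV (Imp A B) = FV A \<union> FV B"
| "FV (All x A) = FV A - {x}"
| "FV (Ex x A) = FV A - {x}"
| "FV (BAll x t A) = insert t (FV A - {x})"
| "FV (BEx x t A) = insert t (FV A - {x})"
| "FV (EAll x a b A) = {a, b} \<union> (FV A - {x})"
| "FV (EEx x a b A) = {a, b} \<union> (FV A - {x})"

primrec vars :: "fm \<Rightarrow> var set" where
  "vars (Mem x y) = {x, y}"
| "vars (Eq x y) = {x, y}"
| "vars Bot = {}"
| "vars (And A B) = vars A \<union> vars B"
| "vars (Or A B) = vars A \<union> vars B"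
| "vars (Imp A B) = vars A \<union> vars B"
| "vars (All x A) = insert x (vars A)"
| "vars (Ex x A) = insert x (vars A)"
| "vars (BAll x t A) = {x, t} \<union> vars A"
| "vars (BEx x t A) = {x, t} \<union> vars A"
| "vars (EAll x a b A) = {x, a, b} \<union> vars A"
| "vars (EEx x a b A) = {x, a, b} \<union> vars A"

definition rn :: "var \<Rightarrow> var \<Rightarrow> var \<Rightarrow> var" where
  "rn x y w = (if w = x then y else w)"

primrec subst :: "fm \<Rightarrow> var \<Rightarrow> var \<Rightarrow> fm" where
  "subst (Mem u v) x y = Mem (rn x y u) (rn x y v)"
| "subst (Eq u v) x y = Eq (rn x y u) (rn x y v)"
| "subst Bot x y = Bot"
| "subst (And A B) x y = And (subst A x y) (subst B x y)"
| "subst (Or A B) x y = Or (subst A x y) (subst B x y)"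
| "subst (Imp A B) x y = Imp (subst A x y) (subst B x y)"
| "subst (All z A) x y = (if z = x then All z A else All z (subst A x y))"
| "subst (Ex z A) x y = (if z = x then Ex z A else Ex z (subst A x y))"
| "subst (BAll z t A) x y = BAll z (rn x y t) (if z = x then A else subst A x y)"
| "subst (BEx z t A) x y = BEx z (rn x y t) (if z = x then A else subst A x y)"
| "subst (EAll z a b A) x y = EAll z (rn x y a) (rn x y b) (if z = x then A else subst A x y)"
| "subst (EEx z a b A) x y = EEx z (rn x y a) (rn x y b) (if z = x then A else subst A x y)"

primrec free_for :: "var \<Rightarrow> var \<Rightarrow> fm \<Rightarrow> bool" where
  "free_for y x (Mem u v) = True"
| "free_for y x (Eq u v) = True"
| "free_for y x Bot = True"
| "free_for y x (And A B) = (free_for y x A \<and> free_for y x B)"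
| "free_for y x (Or A B) = (free_for y x A \<and> free_for y x B)"
| "free_for y x (Imp A B) = (free_for y x A \<and> free_for y x B)"
| "free_for y x (All z A) = (x \<notin> FV A - {z} \<or> (z \<noteq> y \<and> free_for y x A))"
| "free_for y x (Ex z A) = (x \<notin> FV A - {z} \<or> (z \<noteq> y \<and> free_for y x A))"
| "free_for y x (BAll z t A) = (x \<notin> FV A - {z} \<or> (z \<noteq> y \<and> free_for y x A))"
| "free_for y x (BEx z t A) = (x \<notin> FV A - {z} \<or> (z \<noteq> y \<and> free_for y x A))"
| "free_for y x (EAll z a b A) = (x \<notin> FV A - {z} \<or> (z \<noteq> y \<and> free_for y x A))"
| "free_for y x (EEx z a b A) = (x \<notin> FV A - {z} \<or> (z \<noteq> y \<and> free_for y x A))"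

definition sing_fm :: "var \<Rightarrow> var \<Rightarrow> var \<Rightarrow> fm" where
  "sing_fm u x z = And (Mem x u) (BAll z u (Eq z x))"

definition upair_fm :: "var \<Rightarrow> var \<Rightarrow> var \<Rightarrow> var \<Rightarrow> fm" where
  "upair_fm v x y z = And (And (Mem x v) (Mem y v)) (BAll z v (Or (Eq z x) (Eq z y)))"

definition is_pair_fm :: "var \<Rightarrow> var \<Rightarrow> var \<Rightarrow> var \<Rightarrow> var \<Rightarrow> fm" where
  "is_pair_fm p x y u z =
     And (BEx u p (sing_fm u x z))
      (And (BEx u p (upair_fm u x y z))
           (BAll u p (Or (sing_fm u x z) (upair_fm u x y z))))"

text \<open>fun(f,a,b): f is a function from a to b, i.e. f is a subset of a x b and
  every x in a has exactly one y in b with (x,y) in f.  Bound variables are chosen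
  above max f a b, hence distinct from f, a, b.\<close>
definition fun_fm :: "var \<Rightarrow> var \<Rightarrow> var \<Rightarrow> fm" where
  "fun_fm f a b =
    (let n = Suc (max f (max a b));
         x = n; y = n + 1; y' = n + 2; p = n + 3; p' = n + 4; u = n + 5; z = n + 6
     in And (BAll p f (BEx x a (BEx y b (is_pair_fm p x y u z))))
         (And (BAll x a (BEx y b (BEx p f (is_pair_fm p x y u z))))
              (BAll x a (BAll y b (BAll y' b (BAll p f (BAll p' f
                 (Imp (And (is_pair_fm p x y u z) (is_pair_fm p' x y' u z)) (Eq y y')))))))))"

primrec Delta0E :: "fm \<Rightarrow> bool" where
  "Delta0E (Mem x y) = True"
| "Delta0E (Eq x y) = True"
| "Delta0E Bot = True"
| "Delta0E (And A B) = (Delta0E A \<and> Delta0E B)"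
| "Delta0E (Or A B) = (Delta0E A \<and> Delta0E B)"
| "Delta0E (Imp A B) = (Delta0E A \<and> Delta0E B)"
| "Delta0E (All x A) = False"
| "Delta0E (Ex x A) = False"
| "Delta0E (BAll x t A) = Delta0E A"
| "Delta0E (BEx x t A) = Delta0E A"
| "Delta0E (EAll x a b A) = Delta0E A"
| "Delta0E (EEx x a b A) = Delta0E A"

inductive SigmaE :: "fm \<Rightarrow> bool" and PiE :: "fm \<Rightarrow> bool" where
  S_d0: "Delta0E A \<Longrightarrow> SigmaE A"
| S_and: "SigmaE A \<Longrightarrow> SigmaE B \<Longrightarrow> SigmaE (And A B)"
| S_or: "SigmaE A \<Longrightarrow> SigmaE B \<Longrightarrow> SigmaE (Or A B)"
| S_ball: "SigmaE A \<Longrightarrow> SigmaE (BAll x t A)"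
| S_bex: "SigmaE A \<Longrightarrow> SigmaE (BEx x t A)"
| S_eall: "SigmaE A \<Longrightarrow> SigmaE (EAll x a b A)"
| S_eex: "SigmaE A \<Longrightarrow> SigmaE (EEx x a b A)"
| S_ex: "SigmaE A \<Longrightarrow> SigmaE (Ex x A)"
| S_neg: "PiE C \<Longrightarrow> SigmaE (Neg C)"
| S_imp: "PiE C \<Longrightarrow> SigmaE A \<Longrightarrow> SigmaE (Imp C A)"
| P_d0: "Delta0E A \<Longrightarrow> PiE A"
| P_and: "PiE A \<Longrightarrow> PiE B \<Longrightarrow> PiE (And A B)"
| P_or: "PiE A \<Longrightarrow> PiE B \<Longrightarrow> PiE (Or A B)"
| P_ball: "PiE A \<Longrightarrow> PiE (BAll x t A)"
| P_bex: "PiE A \<Longrightarrow> PiE (BEx x t A)"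
| P_eall: "PiE A \<Longrightarrow> PiE (EAll x a b A)"
| P_eex: "PiE A \<Longrightarrow> PiE (EEx x a b A)"
| P_all: "PiE A \<Longrightarrow> PiE (All x A)"
| P_neg: "SigmaE D \<Longrightarrow> PiE (Neg D)"
| P_imp: "SigmaE D \<Longrightarrow> PiE A \<Longrightarrow> PiE (Imp D A)"

text \<open>prv T A: A is derivable from the (open, implicitly universally closed)
  non-logical axioms T.  Bounded and exponentiation-bounded quantifiers are
  governed by their defining equivalences.\<close>

inductive prv :: "fm set \<Rightarrow> fm \<Rightarrow> bool" for T :: "fm set" where
  ax: "A \<in> T \<Longrightarrow> prv T A"
| ax_K: "prv T (Imp A (Imp B A))"
| ax_S: "prv T (Imp (Imp A (Imp B C)) (Imp (Imp A B) (Imp A C)))"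
| ax_conj1: "prv T (Imp (And A B) A)"
| ax_conj2: "prv T (Imp (And A B) B)"
| ax_conjI: "prv T (Imp A (Imp B (And A B)))"
| ax_disj1: "prv T (Imp A (Or A B))"
| ax_disj2: "prv T (Imp B (Or A B))"
| ax_disjE: "prv T (Imp (Imp A C) (Imp (Imp B C) (Imp (Or A B) C)))"
| ax_efq: "prv T (Imp Bot A)"
| ax_allE: "free_for y x A \<Longrightarrow> prv T (Imp (All x A) (subst A x y))"
| ax_exI: "free_for y x A \<Longrightarrow> prv T (Imp (subst A x y) (Ex x A))"
| ax_refl: "prv T (Eq x x)"
| ax_eq1: "prv T (Imp (Eq x y) (Imp (Eq x z) (Eq y z)))"
| ax_eq2: "prv T (Imp (Eq x y) (Imp (Eq z x) (Eq z y)))"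
| ax_eq3: "prv T (Imp (Eq x y) (Imp (Mem x z) (Mem y z)))"
| ax_eq4: "prv T (Imp (Eq x y) (Imp (Mem z x) (Mem z y)))"
| ax_ball: "z \<notin> FV (BAll x t A) \<Longrightarrow> free_for z x A \<Longrightarrow>
     prv T (Iff (BAll x t A) (All z (Imp (Mem z t) (subst A x z))))"
| ax_bex: "z \<notin> FV (BEx x t A) \<Longrightarrow> free_for z x A \<Longrightarrow>
     prv T (Iff (BEx x t A) (Ex z (And (Mem z t) (subst A x z))))"
| ax_eall: "z \<notin> FV (EAll x a b A) \<Longrightarrow> free_for z x A \<Longrightarrow>
     prv T (Iff (EAll x a b A) (All z (Imp (fun_fm z a b) (subst A x z))))"
| ax_eex: "z \<notin> FV (EEx x a b A) \<Longrightarrow> free_for z x A \<Longrightarrow>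
     prv T (Iff (EEx x a b A) (Ex z (And (fun_fm z a b) (subst A x z))))"
| mp: "prv T (Imp A B) \<Longrightarrow> prv T A \<Longrightarrow> prv T B"
| allI: "prv T (Imp C A) \<Longrightarrow> x \<notin> FV C \<Longrightarrow> prv T (Imp C (All x A))"
| exE: "prv T (Imp A C) \<Longrightarrow> x \<notin> FV C \<Longrightarrow> prv T (Imp (Ex x A) C)"

inductive_set IKPE :: "fm set" where
  ext: "Delta0E A \<Longrightarrow> x \<noteq> a \<Longrightarrow> x \<noteq> b \<Longrightarrow> free_for a y A \<Longrightarrow> free_for b y A \<Longrightarrow>
     Imp (And (BAll x a (Mem x b)) (And (BAll x b (Mem x a)) (subst A y a))) (subst A y b) \<in> IKPE"
| pair: "z \<noteq> x \<Longrightarrow> z \<noteq> y \<Longrightarrow> Ex z (And (Mem x z) (Mem y z)) \<in> IKPE"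
| union: "distinct [x, y, u, z] \<Longrightarrow> Ex z (BAll y x (BAll u y (Mem u z))) \<in> IKPE"
| infinity: "distinct [z, u, v, w] \<Longrightarrow>
     Ex z (And (BEx u z (BAll v u Bot)) (BAll u z (BEx w z (Mem u w)))) \<in> IKPE"
| separation: "Delta0E A \<Longrightarrow> distinct [x, a, z] \<Longrightarrow> z \<notin> FV A \<Longrightarrow>
     Ex z (And (BAll x z (And (Mem x a) A)) (BAll x a (Imp A (Mem x z)))) \<in> IKPE"
| collection: "Delta0E A \<Longrightarrow> distinct [x, y, a, z] \<Longrightarrow> z \<notin> FV A \<Longrightarrow>
     Imp (BAll x a (Ex y A)) (Ex z (BAll x a (BEx y z A))) \<in> IKPE"
| set_induction: "y \<noteq> x \<Longrightarrow> y \<notin> FV A \<Longrightarrow> free_for y x A \<Longrightarrow>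
     Imp (All x (Imp (BAll y x (subst A x y)) A)) (All x A) \<in> IKPE"
| exponentiation: "distinct [z, x, a, b] \<Longrightarrow> Ex z (EAll x a b (Mem x z)) \<in> IKPE"

primrec rel :: "var \<Rightarrow> fm \<Rightarrow> fm" where
  "rel z (Mem x y) = Mem x y"
| "rel z (Eq x y) = Eq x y"
| "rel z Bot = Bot"
| "rel z (And A B) = And (rel z A) (rel z B)"
| "rel z (Or A B) = Or (rel z A) (rel z B)"
| "rel z (Imp A B) = Imp (rel z A) (rel z B)"
| "rel z (All x A) = BAll x z (rel z A)"
| "rel z (Ex x A) = BEx x z (rel z A)"
| "rel z (BAll x t A) = BAll x t (rel z A)"
| "rel z (BEx x t A) = BEx x t (rel z A)"
| "rel z (EAll x a b A) = EAll x a b (rel z A)"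
| "rel z (EEx x a b A) = EEx x a b (rel z A)"

definition SigmaE_Refl :: "fm set" where
  "SigmaE_Refl = {Imp A (Ex z (rel z A)) | A z. SigmaE A \<and> z \<notin> vars A}"

end

theory Submission
  imports Defs "HOL-Library.Countable" "HOL-Library.Infinite_Set"
begin

text \<open>
By completeness it suffices to turn a Kripke model \<open>K\<close> of \<open>IKP(E)\<close> into a model of
\<open>IKP(E)\<close> plus reflection in which a \<open>\<Sigma>\<close>-sentence holds only where it already holds in \<open>K\<close>.
Reflection fails in \<open>IKP(E)\<close> only for implications \<open>C \<longrightarrow> A\<close> with \<open>C\<close> a \<open>\<Pi>\<close>-formula, so one forces
with conditions \<open>p\<close> that are sets of (coded) \<open>\<Pi>\<close>-statements: an atom is forced by \<open>p\<close> if, for some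
set \<open>y\<close>, it follows from the statements in \<open>p\<close> relativised to \<open>y\<close>, a \<open>\<Delta>\<^sub>0\<close>-premise.
Disjunctions and existential formulas are forced if every goal that follows from all instances
follows, where a goal is a (coded) \<open>\<Sigma>\<close>-statement; this makes all forced truth values closed under
discharging a relativised condition without using more than \<open>\<Delta>\<^sub>0\<close>-collection.
Forcing is then absolute for \<open>\<Delta>\<^sub>0\<close>-formulas, a forced \<open>\<Sigma>\<close>-formula holds relativised to some \<open>y\<close>
under the condition relativised to \<open>y\<close>, and a \<open>\<Pi>\<close>-formula is forced as soon as all its
relativisations are. Adding \<open>C\<close> to a condition therefore reflects \<open>C \<longrightarrow> A\<close>.
Codes are needed only for the finitely many formulas that occur in the axioms of one derivation.
Since forcing is definable in \<open>K\<close>, set induction is inherited.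
\<close>

section \<open>Kripke models with a nucleus\<close>

text \<open>Since \<open>K\<close> has collection for Delta_0 formulas only, what a condition yields
  should be one set \<open>y\<close> together with a Delta_0 matrix. Such bounds can be merged: as
  \<open>y\<close> grows, a relativised Sigma conclusion gets weaker and a relativised Pi premise
  gets stronger, so a larger \<open>y\<close> serves as well. Disjunctions and existential
  statements over Pi formulas break this pattern: the witness may change with \<open>y\<close>, and
  no single instance need be forced. This is why these connectives are read impredicatively, through
  the goals they imply, each goal again having the good shape. A quantifier over all such truth
  values would be second-order and would destroy definability, and with it set induction; hence
  goals are sets of \<open>K\<close>. To have one soundness proof for \<open>K\<close> and for the
  forcing model, the Kripke semantics takes an operator \<open>J\<close> as a parameter: the
  identity for \<open>K\<close>, closure under goals for the forcing.\<close>

lemma finite_vars [simp]: "finite (vars A)"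
  by (induction A) auto

lemma FV_subset_vars: "FV A \<subseteq> vars A"
  by (induction A) auto

lemma subst_notin_FV: "x \<notin> FV A \<Longrightarrow> subst A x y = A"
  by (induction A) (auto simp: rn_def)

lemma subst_same [simp]: "subst A x x = A"
  by (induction A) (auto simp: rn_def)

lemma free_for_notin_vars: "y \<notin> vars A \<Longrightarrow> free_for y x A"
  by (induction A) auto

lemma free_for_same [simp]: "free_for x x A"
  by (induction A) auto

lemma FV_subst: "FV (subst A x y) \<subseteq> insert y (FV A - {x})"
  by (induction A) (auto simp: rn_def)

text \<open>The relation \<open>le\<close> is reflexive only on genuine worlds:
  \<open>le w w\<close> doubles as the predicate of being a world, so that worlds may be drawn from
  a plain type. With \<open>J\<close> the identity this is ordinary Kripke semantics; in general
  \<open>J\<close> is a closure operator under which atoms have to be closed.\<close>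

locale kripke =
  fixes le :: "'w \<Rightarrow> 'w \<Rightarrow> bool"
    and D :: "'w \<Rightarrow> 'd set"
    and mem eq :: "'w \<Rightarrow> 'd \<Rightarrow> 'd \<Rightarrow> bool"
    and J :: "('w \<Rightarrow> bool) \<Rightarrow> 'w \<Rightarrow> bool"
  assumes le_left: "le w v \<Longrightarrow> le w w"
    and le_right: "le w v \<Longrightarrow> le v v"
    and le_trans: "le w v \<Longrightarrow> le v u \<Longrightarrow> le w u"
    and D_mono: "le w v \<Longrightarrow> d \<in> D w \<Longrightarrow> d \<in> D v"
    and mem_mono: "le w v \<Longrightarrow> mem w a b \<Longrightarrow> mem v a b"
    and eq_mono: "le w v \<Longrightarrow> eq w a b \<Longrightarrow> eq v a b"
    and eq_refl: "le w w \<Longrightarrow> a \<in> D w \<Longrightarrow> eq w a a"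
    and eq_eq1: "le w w \<Longrightarrow> eq w a b \<Longrightarrow> eq w a c \<Longrightarrow> eq w b c"
    and eq_eq2: "le w w \<Longrightarrow> eq w a b \<Longrightarrow> eq w c a \<Longrightarrow> eq w c b"
    and eq_mem1: "le w w \<Longrightarrow> eq w a b \<Longrightarrow> mem w a c \<Longrightarrow> mem w b c"
    and eq_mem2: "le w w \<Longrightarrow> eq w a b \<Longrightarrow> mem w c a \<Longrightarrow> mem w c b"
    and J_unit: "le w w \<Longrightarrow> (\<And>v. le w v \<Longrightarrow> X v) \<Longrightarrow> J X w"
    and J_bind: "le w w \<Longrightarrow> J X w \<Longrightarrow> (\<And>v. le w v \<Longrightarrow> X v \<Longrightarrow> J Y v) \<Longrightarrow> J Y w"
    and J_mono: "le w v \<Longrightarrow> J X w \<Longrightarrow> (\<And>u u'. le u u' \<Longrightarrow> X u \<Longrightarrow> X u') \<Longrightarrow> J X v"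
    and mem_closed: "le w w \<Longrightarrow> a \<in> D w \<Longrightarrow> b \<in> D w \<Longrightarrow> J (\<lambda>v. mem v a b) w \<Longrightarrow> mem w a b"
    and eq_closed: "le w w \<Longrightarrow> a \<in> D w \<Longrightarrow> b \<in> D w \<Longrightarrow> J (\<lambda>v. eq v a b) w \<Longrightarrow> eq w a b"
begin

section \<open>Interpretation of formulas\<close>

definition is_sing :: "'w \<Rightarrow> 'd \<Rightarrow> 'd \<Rightarrow> bool" where
  "is_sing w u x \<longleftrightarrow>
    mem w x u \<and> (\<forall>v. le w v \<longrightarrow> (\<forall>z\<in>D v. mem v z u \<longrightarrow> eq v z x))"

definition is_upair :: "'w \<Rightarrow> 'd \<Rightarrow> 'd \<Rightarrow> 'd \<Rightarrow> bool" where
  "is_upair w u x y \<longleftrightarrow>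
    mem w x u \<and> mem w y u \<and>
    (\<forall>v. le w v \<longrightarrow> (\<forall>z\<in>D v. mem v z u \<longrightarrow> J (\<lambda>v. eq v z x \<or> eq v z y) v))"

definition is_pair :: "'w \<Rightarrow> 'd \<Rightarrow> 'd \<Rightarrow> 'd \<Rightarrow> bool" where
  "is_pair w p x y \<longleftrightarrow>
    J (\<lambda>v. \<exists>u\<in>D v. mem v u p \<and> is_sing v u x) w \<and>
    J (\<lambda>v. \<exists>u\<in>D v. mem v u p \<and> is_upair v u x y) w \<and>
    (\<forall>v. le w v \<longrightarrow> (\<forall>u\<in>D v. mem v u p \<longrightarrow>
      J (\<lambda>v. is_sing v u x \<or> is_upair v u x y) v))"

text \<open>The meaning of \<open>fun_fm\<close> written out without variables. The recursion
  defining \<open>sat\<close> cannot call itself on \<open>fun_fm\<close>, so the clauses for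
  exponentiation-bounded quantifiers need this semantic copy.\<close>

definition is_fun :: "'w \<Rightarrow> 'd \<Rightarrow> 'd \<Rightarrow> 'd \<Rightarrow> bool" where
  "is_fun w f a b \<longleftrightarrow>
    (\<forall>v. le w v \<longrightarrow> (\<forall>p\<in>D v. mem v p f \<longrightarrow>
      J (\<lambda>v. \<exists>x\<in>D v. mem v x a \<and> J (\<lambda>v. \<exists>y\<in>D v. mem v y b \<and> is_pair v p x y) v) v)) \<and>
    (\<forall>v. le w v \<longrightarrow> (\<forall>x\<in>D v. mem v x a \<longrightarrow>
      J (\<lambda>v. \<exists>y\<in>D v. mem v y b \<and> J (\<lambda>v. \<exists>p\<in>D v. mem v p f \<and> is_pair v p x y) v) v)) \<and>
    (\<forall>v. le w v \<longrightarrow> (\<forall>x\<in>D v. mem v x a \<longrightarrow>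
    (\<forall>v'. le v v' \<longrightarrow> (\<forall>y\<in>D v'. mem v' y b \<longrightarrow>
    (\<forall>v. le v' v \<longrightarrow> (\<forall>y'\<in>D v. mem v y' b \<longrightarrow>
    (\<forall>v'. le v v' \<longrightarrow> (\<forall>p\<in>D v'. mem v' p f \<longrightarrow>
    (\<forall>v. le v' v \<longrightarrow> (\<forall>p'\<in>D v. mem v p' f \<longrightarrow>
    (\<forall>v'. le v v' \<longrightarrow> is_pair v' p x y \<and> is_pair v' p' x y' \<longrightarrow> eq v' y y')))))))))))"

primrec sat :: "fm \<Rightarrow> 'w \<Rightarrow> (var \<Rightarrow> 'd) \<Rightarrow> bool" where
  "sat (Mem x y) w \<rho> = mem w (\<rho> x) (\<rho> y)"
| "sat (Eq x y) w \<rho> = eq w (\<rho> x) (\<rho> y)"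
| "sat Bot w \<rho> = J (\<lambda>_. False) w"
| "sat (And A B) w \<rho> = (sat A w \<rho> \<and> sat B w \<rho>)"
| "sat (Or A B) w \<rho> = J (\<lambda>v. sat A v \<rho> \<or> sat B v \<rho>) w"
| "sat (Imp A B) w \<rho> = (\<forall>v. le w v \<longrightarrow> sat A v \<rho> \<longrightarrow> sat B v \<rho>)"
| "sat (All x A) w \<rho> = (\<forall>v. le w v \<longrightarrow> (\<forall>d\<in>D v. sat A v (\<rho>(x := d))))"
| "sat (Ex x A) w \<rho> = J (\<lambda>v. \<exists>d\<in>D v. sat A v (\<rho>(x := d))) w"
| "sat (BAll x t A) w \<rho> =
    (\<forall>v. le w v \<longrightarrow> (\<forall>d\<in>D v. mem v d (\<rho> t) \<longrightarrow> sat A v (\<rho>(x := d))))"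
| "sat (BEx x t A) w \<rho> =
    J (\<lambda>v. \<exists>d\<in>D v. mem v d (\<rho> t) \<and> sat A v (\<rho>(x := d))) w"
| "sat (EAll x a b A) w \<rho> =
    (\<forall>v. le w v \<longrightarrow> (\<forall>d\<in>D v. is_fun v d (\<rho> a) (\<rho> b) \<longrightarrow> sat A v (\<rho>(x := d))))"
| "sat (EEx x a b A) w \<rho> =
    J (\<lambda>v. \<exists>d\<in>D v. is_fun v d (\<rho> a) (\<rho> b) \<and> sat A v (\<rho>(x := d))) w"

definition env :: "'w \<Rightarrow> (var \<Rightarrow> 'd) \<Rightarrow> bool" where
  "env w \<rho> = (\<forall>x. \<rho> x \<in> D w)"

definition valid :: "fm \<Rightarrow> bool" where
  "valid A = (\<forall>w \<rho>. le w w \<longrightarrow> env w \<rho> \<longrightarrow> sat A w \<rho>)"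

lemma env_upd [simp]: "env w \<rho> \<Longrightarrow> d \<in> D w \<Longrightarrow> env w (\<rho>(x := d))"
  by (auto simp: env_def)

lemma env_D: "env w \<rho> \<Longrightarrow> \<rho> x \<in> D w"
  by (auto simp: env_def)

lemma env_mono: "le w v \<Longrightarrow> env w \<rho> \<Longrightarrow> env v \<rho>"
  by (auto simp: env_def intro: D_mono)

lemma J_map:
  assumes "le w w" "J X w" "\<And>v u. le w v \<Longrightarrow> le v u \<Longrightarrow> X v \<Longrightarrow> Y u"
  shows "J Y w"
  using assms by (blast intro: J_bind J_unit le_right)

lemma sat_coincidence:
  "(\<And>x. x \<in> FV A \<Longrightarrow> \<rho> x = \<sigma> x) \<Longrightarrow> sat A w \<rho> = sat A w \<sigma>"
proof (induction A arbitrary: w \<rho> \<sigma>)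
  case (Or A B)
  have "sat A v \<rho> = sat A v \<sigma>" "sat B v \<rho> = sat B v \<sigma>" for v
    by (rule Or.IH; use Or.prems in auto)+
  then show ?case by simp
next
  case (Imp A B)
  have "sat A v \<rho> = sat A v \<sigma>" "sat B v \<rho> = sat B v \<sigma>" for v
    by (rule Imp.IH; use Imp.prems in auto)+
  then show ?case by simp
next
  case (And A B)
  have "sat A v \<rho> = sat A v \<sigma>" "sat B v \<rho> = sat B v \<sigma>" for v
    by (rule And.IH; use And.prems in auto)+
  then show ?case by simp
next
  case (All x A)
  have "sat A v (\<rho>(x := d)) = sat A v (\<sigma>(x := d))" for v d
    by (rule All.IH) (use All.prems in auto)
  then show ?case by simp
next
  case (Ex x A)
  have "sat A v (\<rho>(x := d)) = sat A v (\<sigma>(x := d))" for v d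
    by (rule Ex.IH) (use Ex.prems in auto)
  then show ?case by simp
next
  case (BAll x t A)
  have "sat A v (\<rho>(x := d)) = sat A v (\<sigma>(x := d))" for v d
    by (rule BAll.IH) (use BAll.prems in auto)
  then show ?case using BAll.prems[of t] by simp
next
  case (BEx x t A)
  have "sat A v (\<rho>(x := d)) = sat A v (\<sigma>(x := d))" for v d
    by (rule BEx.IH) (use BEx.prems in auto)
  then show ?case using BEx.prems[of t] by simp
next
  case (EAll x a b A)
  have "sat A v (\<rho>(x := d)) = sat A v (\<sigma>(x := d))" for v d
    by (rule EAll.IH) (use EAll.prems in auto)
  then show ?case using EAll.prems[of a] EAll.prems[of b] by simp
next
  case (EEx x a b A)
  have "sat A v (\<rho>(x := d)) = sat A v (\<sigma>(x := d))" for v d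
    by (rule EEx.IH) (use EEx.prems in auto)
  then show ?case using EEx.prems[of a] EEx.prems[of b] by simp
qed auto

lemma is_sing_mono: "le w v \<Longrightarrow> is_sing w u x \<Longrightarrow> is_sing v u x"
  unfolding is_sing_def by (blast intro: le_trans mem_mono)

lemma is_upair_mono: "le w v \<Longrightarrow> is_upair w u x y \<Longrightarrow> is_upair v u x y"
  unfolding is_upair_def by (blast intro: le_trans mem_mono)

lemma is_pair_mono:
  assumes "le w v" "is_pair w p x y"
  shows "is_pair v p x y"
  unfolding is_pair_def
proof (intro conjI HOL.allI impI ballI)
  show "J (\<lambda>v. \<exists>u\<in>D v. mem v u p \<and> is_sing v u x) v"
    by (rule J_mono[OF assms(1)]) (use assms(2) is_pair_def D_mono mem_mono is_sing_mono in blast)+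
  show "J (\<lambda>v. \<exists>u\<in>D v. mem v u p \<and> is_upair v u x y) v"
    by (rule J_mono[OF assms(1)]) (use assms(2) is_pair_def D_mono mem_mono is_upair_mono in blast)+
qed (use assms le_trans is_pair_def in blast)

lemma is_fun_mono: "le w v \<Longrightarrow> is_fun w f a b \<Longrightarrow> is_fun v f a b"
  unfolding is_fun_def by (meson le_trans)

lemma sat_mono: "le w v \<Longrightarrow> sat A w \<rho> \<Longrightarrow> sat A v \<rho>"
proof (induction A arbitrary: w v \<rho>)
  case (Or A B)
  show ?case
    using J_mono[OF Or.prems(1) Or.prems(2)[unfolded sat.simps]] Or.IH by simp blast
next
  case (Ex x A)
  show ?case
    using J_mono[OF Ex.prems(1) Ex.prems(2)[unfolded sat.simps]] Ex.IH D_mono by simp blast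
next
  case (BEx x t A)
  show ?case
    using J_mono[OF BEx.prems(1) BEx.prems(2)[unfolded sat.simps]] BEx.IH D_mono mem_mono by simp blast
next
  case (EEx x a b A)
  show ?case
    using J_mono[OF EEx.prems(1) EEx.prems(2)[unfolded sat.simps]] EEx.IH D_mono is_fun_mono by simp blast
qed (simp_all add: mem_mono eq_mono, (blast intro: J_mono le_trans mem_mono eq_mono)+)

lemma sat_is_pair_fm:
  assumes "u \<notin> {p, x, y}" "z \<notin> {p, x, y, u}"
  shows "sat (is_pair_fm p x y u z) w \<rho> = is_pair w (\<rho> p) (\<rho> x) (\<rho> y)"
  using assms
  by (simp add: is_pair_fm_def sing_fm_def upair_fm_def is_pair_def is_sing_def is_upair_def conj_assoc)

lemma sat_fun_fm: "sat (fun_fm f a b) w \<rho> = is_fun w (\<rho> f) (\<rho> a) (\<rho> b)"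
proof -
  define n where "n = Suc (max f (max a b))"
  have n: "f \<noteq> n + i" "a \<noteq> n + i" "b \<noteq> n + i" "f \<noteq> n" "a \<noteq> n" "b \<noteq> n"
    "f \<noteq> Suc n" "a \<noteq> Suc n" "b \<noteq> Suc n"
    "f \<noteq> Suc (Suc n)" "a \<noteq> Suc (Suc n)" "b \<noteq> Suc (Suc n)" for i
    by (auto simp: n_def)
  show ?thesis
    unfolding fun_fm_def is_fun_def Let_def n_def[symmetric]
    by (simp add: sat_is_pair_fm n)
qed

text \<open>The quantifier case shared by all binders. If \<open>x\<close> is not free below the
  binder, substitution changes nothing there, even for \<open>z = y\<close>; otherwise
  \<open>free_for\<close> makes the two updates of the environment commute.\<close>

lemma sat_subst_body:
  assumes "x \<notin> FV A - {z} \<or> z \<noteq> y \<and> free_for y x A"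
    "\<And>w \<rho>. free_for y x A \<Longrightarrow> sat (subst A x y) w \<rho> = sat A w (\<rho>(x := \<rho> y))"
  shows "sat (if z = x then A else subst A x y) v (\<rho>(z := d)) = sat A v (\<rho>(x := \<rho> y, z := d))"
proof (cases "x \<in> FV A - {z}")
  case False
  then show ?thesis by (cases "z = x") (auto simp: subst_notin_FV intro!: sat_coincidence)
next
  case True
  then have "z \<noteq> x" "z \<noteq> y" "free_for y x A" using assms(1) by auto
  moreover have "(\<rho>(z := d))(x := (\<rho>(z := d)) y) = (\<rho>(x := \<rho> y))(z := d)"
    using calculation by auto
  ultimately show ?thesis using assms(2) by simp
qed

lemma sat_subst: "free_for y x A \<Longrightarrow> sat (subst A x y) w \<rho> = sat A w (\<rho>(x := \<rho> y))"
proof (induction A arbitrary: w \<rho>)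
  case (All z A)
  then show ?case
    using sat_subst_body[OF All.prems[unfolded free_for.simps] All.IH]
    by (cases "z = x") (simp_all add: rn_def fun_upd_def)
next
  case (Ex z A)
  then show ?case
    using sat_subst_body[OF Ex.prems[unfolded free_for.simps] Ex.IH]
    by (cases "z = x") (simp_all add: rn_def fun_upd_def)
next
  case (BAll z t A)
  then show ?case
    using sat_subst_body[OF BAll.prems[unfolded free_for.simps] BAll.IH]
    by (cases "z = x") (simp_all add: rn_def fun_upd_def)
next
  case (BEx z t A)
  then show ?case
    using sat_subst_body[OF BEx.prems[unfolded free_for.simps] BEx.IH]
    by (cases "z = x") (simp_all add: rn_def fun_upd_def)
next
  case (EAll z a b A)
  then show ?case
    using sat_subst_body[OF EAll.prems[unfolded free_for.simps] EAll.IH]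
    by (cases "z = x") (simp_all add: rn_def fun_upd_def)
next
  case (EEx z a b A)
  then show ?case
    using sat_subst_body[OF EEx.prems[unfolded free_for.simps] EEx.IH]
    by (cases "z = x") (simp_all add: rn_def fun_upd_def)
qed (auto simp: rn_def)

text \<open>Atoms are closed by assumption, clauses that start with \<open>J\<close> by
  \<open>J_bind\<close>, and implications and universal quantifiers inherit closure from their
  conclusions.\<close>

lemma sat_closed: "le w w \<Longrightarrow> env w \<rho> \<Longrightarrow> J (\<lambda>v. sat A v \<rho>) w \<Longrightarrow> sat A w \<rho>"
proof (induction A arbitrary: w \<rho>)
  case (Mem x y) then show ?case by (auto intro: mem_closed env_D)
next
  case (Eq x y) then show ?case by (auto intro: eq_closed env_D)
next
  case Bot then show ?case using J_bind by fastforce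
next
  case (And A B)
  have "J (\<lambda>v. sat A v \<rho>) w" "J (\<lambda>v. sat B v \<rho>) w"
    by (rule J_map[OF And.prems(1,3)]; use sat_mono in force)+
  then show ?case using And by simp
next
  case (Or A B) then show ?case using J_bind[OF _ Or.prems(3)] by simp
next
  case (Imp A B)
  show ?case
  proof (clarsimp)
    fix v assume v: "le w v" "sat A v \<rho>"
    have "J (\<lambda>v. sat B v \<rho>) v"
    proof (rule J_map[OF le_right[OF v(1)] J_mono[OF v(1) Imp.prems(3) sat_mono]])
      fix v' u assume h: "le v v'" "le v' u" "sat (Imp A B) v' \<rho>"
      have "sat A u \<rho>" using v h sat_mono by blast
      then show "sat B u \<rho>" using h by simp
    qed
    then show "sat B v \<rho>" using Imp v le_right env_mono by metis
  qed
next
  case (All x A)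
  show ?case
  proof (clarsimp)
    fix v d assume v: "le w v" "d \<in> D v"
    have "J (\<lambda>v. sat A v (\<rho>(x := d))) v"
    proof (rule J_map[OF le_right[OF v(1)] J_mono[OF v(1) All.prems(3) sat_mono]])
      fix v' u assume h: "le v v'" "le v' u" "sat (All x A) v' \<rho>"
      have "d \<in> D u" using D_mono[OF h(2) D_mono[OF h(1) v(2)]] by simp
      then show "sat A u (\<rho>(x := d))" using h by simp
    qed
    then show "sat A v (\<rho>(x := d))" using All v le_right env_mono env_upd by metis
  qed
next
  case (Ex x A) then show ?case using J_bind[OF _ Ex.prems(3)] by simp
next
  case (BAll x t A)
  show ?case
  proof (clarsimp)
    fix v d assume v: "le w v" "d \<in> D v" "mem v d (\<rho> t)"
    have "J (\<lambda>v. sat A v (\<rho>(x := d))) v"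
    proof (rule J_map[OF le_right[OF v(1)] J_mono[OF v(1) BAll.prems(3) sat_mono]])
      fix v' u assume h: "le v v'" "le v' u" "sat (BAll x t A) v' \<rho>"
      have "d \<in> D u" "mem u d (\<rho> t)" using D_mono[OF h(2) D_mono[OF h(1) v(2)]] mem_mono[OF h(2) mem_mono[OF h(1) v(3)]] by simp_all
      then show "sat A u (\<rho>(x := d))" using h by simp
    qed
    then show "sat A v (\<rho>(x := d))" using BAll v le_right env_mono env_upd by metis
  qed
next
  case (BEx x t A) then show ?case using J_bind[OF _ BEx.prems(3)] by simp
next
  case (EAll x a b A)
  show ?case
  proof (clarsimp)
    fix v d assume v: "le w v" "d \<in> D v" "is_fun v d (\<rho> a) (\<rho> b)"
    have "J (\<lambda>v. sat A v (\<rho>(x := d))) v"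
    proof (rule J_map[OF le_right[OF v(1)] J_mono[OF v(1) EAll.prems(3) sat_mono]])
      fix v' u assume h: "le v v'" "le v' u" "sat (EAll x a b A) v' \<rho>"
      have "d \<in> D u" "is_fun u d (\<rho> a) (\<rho> b)" using D_mono[OF h(2) D_mono[OF h(1) v(2)]] is_fun_mono[OF h(2) is_fun_mono[OF h(1) v(3)]] by simp_all
      then show "sat A u (\<rho>(x := d))" using h by simp
    qed
    then show "sat A v (\<rho>(x := d))" using EAll v le_right env_mono env_upd by metis
  qed
next
  case (EEx x a b A) then show ?case using J_bind[OF _ EEx.prems(3)] by simp
qed

lemma sat_efq: "le w w \<Longrightarrow> env w \<rho> \<Longrightarrow> J (\<lambda>_. False) w \<Longrightarrow> sat A w \<rho>"
  by (rule sat_closed) (auto elim: J_bind)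

text \<open>As \<open>sat A\<close> is closed under \<open>J\<close>, a statement that holds under
  \<open>J\<close> may be used as if it held outright. Elimination of disjunctions and existential
  quantifiers rests on this.\<close>

lemma sat_elim:
  assumes "J X w" "le w w" "env w \<rho>" "\<And>v. le w v \<Longrightarrow> X v \<Longrightarrow> sat A v \<rho>"
  shows "sat A w \<rho>"
proof (rule sat_closed[OF assms(2,3) J_map[OF assms(2,1)]])
  fix v u assume "le w v" "le v u" "X v"
  then show "sat A u \<rho>" using assms(4) sat_mono by blast
qed

lemma sat_Iff: "sat (Iff A B) w \<rho> \<longleftrightarrow> (\<forall>v. le w v \<longrightarrow> sat A v \<rho> = sat B v \<rho>)"
  by (auto simp: Iff_def)

lemma sat_subst_fresh:
  assumes "z \<notin> FV A - {x}" "free_for z x A"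
  shows "sat (subst A x z) w (\<rho>(z := d)) = sat A w (\<rho>(x := d))"
  using assms by (auto simp: sat_subst intro!: sat_coincidence)

section \<open>Soundness for every closure operator\<close>

theorem soundness:
  assumes "prv T A" "\<And>B. B \<in> T \<Longrightarrow> valid B"
  shows "valid A"
  using assms(1)
proof induction
  case (ax A) then show ?case using assms(2) by simp
next
  case (ax_K A B) then show ?case by (auto simp: valid_def intro: sat_mono)
next
  case (ax_S A B C) then show ?case
    by (simp add: valid_def) (meson le_trans le_right)
next
  case (ax_conjI A B) then show ?case by (auto simp: valid_def intro: sat_mono)
next
  case (ax_disj1 A B) then show ?case by (auto simp: valid_def intro!: J_unit intro: sat_mono le_right)
next
  case (ax_disj2 A B) then show ?case by (auto simp: valid_def intro!: J_unit intro: sat_mono le_right)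
next
  case (ax_disjE A C B)
  show ?case unfolding valid_def sat.simps
  proof (intro HOL.allI impI)
    fix w \<rho> v u t
    assume h: "env w \<rho>" "le w v" "\<forall>va. le v va \<longrightarrow> sat A va \<rho> \<longrightarrow> sat C va \<rho>" "le v u"
      "\<forall>v. le u v \<longrightarrow> sat B v \<rho> \<longrightarrow> sat C v \<rho>" "le u t" "J (\<lambda>v. sat A v \<rho> \<or> sat B v \<rho>) t"
    show "sat C t \<rho>"
    proof (rule sat_elim[OF h(7)])
      show "le t t" by (rule le_right) fact
      show "env t \<rho>" using env_mono[OF h(6) env_mono[OF h(4) env_mono[OF h(2,1)]]] .
      fix s assume s: "le t s" "sat A s \<rho> \<or> sat B s \<rho>"
      then have "le u s" "le v s" using h le_trans by blast+
      then show "sat C s \<rho>" using s h by blast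
    qed
  qed
next
  case (ax_efq A) then show ?case by (auto simp: valid_def intro: sat_efq le_right env_mono)
next
  case (ax_allE y x A)
  then show ?case by (auto simp: valid_def sat_subst intro: le_right env_D env_mono)
next
  case (ax_exI y x A)
  then show ?case
    by (auto simp: valid_def sat_subst intro!: J_unit intro: le_right)
      (metis env_D env_mono sat_mono)
next
  case (ax_refl x) then show ?case by (auto simp: valid_def intro: eq_refl env_D)
next
  case (ax_eq1 x y z) then show ?case by (auto simp: valid_def) (meson eq_eq1 eq_mono le_right)
next
  case (ax_eq2 x y z) then show ?case by (auto simp: valid_def) (meson eq_eq2 eq_mono le_right)
next
  case (ax_eq3 x y z) then show ?case by (auto simp: valid_def) (meson eq_mem1 eq_mono le_right)
next
  case (ax_eq4 x y z) then show ?case by (auto simp: valid_def) (meson eq_mem2 eq_mono le_right)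
next
  case (ax_ball z x t A)
  then have "z \<noteq> t" "z \<notin> FV A - {x}" by auto
  then show ?case using ax_ball
    by (simp add: valid_def sat_Iff sat_subst_fresh)
      (blast intro: le_trans le_right mem_mono D_mono)
next
  case (ax_bex z x t A)
  then have "z \<noteq> t" "z \<notin> FV A - {x}" by auto
  then show ?case using ax_bex by (simp add: valid_def sat_Iff sat_subst_fresh)
next
  case (ax_eall z x a b A)
  then have "z \<noteq> a" "z \<noteq> b" "z \<notin> FV A - {x}" by auto
  then show ?case using ax_eall
    by (simp add: valid_def sat_Iff sat_subst_fresh sat_fun_fm)
      (blast intro: le_trans le_right is_fun_mono D_mono)
next
  case (ax_eex z x a b A)
  then have "z \<noteq> a" "z \<noteq> b" "z \<notin> FV A - {x}" by auto
  then show ?case using ax_eex by (simp add: valid_def sat_Iff sat_subst_fresh sat_fun_fm)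
next
  case (mp A B) then show ?case by (auto simp: valid_def)
next
  case (allI C A x)
  show ?case unfolding valid_def sat.simps
  proof (intro HOL.allI impI ballI)
    fix w \<rho> v u d
    assume h: "le w w" "env w \<rho>" "le w v" "sat C v \<rho>" "le v u" "d \<in> D u"
    have "sat C u \<rho>" using h sat_mono by blast
    then have "sat C u (\<rho>(x := d))" using allI.hyps by (subst sat_coincidence[of _ _ \<rho>]) auto
    moreover have "env u (\<rho>(x := d))" using h by (meson env_mono env_upd le_trans)
    ultimately show "sat A u (\<rho>(x := d))"
      using allI.IH h le_right unfolding valid_def sat.simps by blast
  qed
next
  case (exE A C x)
  show ?case unfolding valid_def sat.simps
  proof (intro HOL.allI impI)
    fix w \<rho> v
    assume h: "le w w" "env w \<rho>" "le w v" "J (\<lambda>v. \<exists>d\<in>D v. sat A v (\<rho>(x := d))) v"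
    show "sat C v \<rho>"
    proof (rule sat_elim[OF h(4)])
      show "le v v" "env v \<rho>" using h le_right env_mono by auto
      fix u assume u: "le v u" "\<exists>d\<in>D u. sat A u (\<rho>(x := d))"
      then obtain d where d: "d \<in> D u" "sat A u (\<rho>(x := d))" by blast
      moreover have "env u (\<rho>(x := d))" using h u d by (meson env_mono env_upd le_trans)
      ultimately have "sat C u (\<rho>(x := d))"
        using exE.IH u le_right unfolding valid_def sat.simps by blast
      then show "sat C u \<rho>" using exE.hyps by (subst sat_coincidence[of _ _ "\<rho>(x := d)"]) auto
    qed
  qed
qed (auto simp: valid_def)

text \<open>Equality is only a congruence, not identity, in these models.\<close>

lemma eq_sym: "le w w \<Longrightarrow> a \<in> D w \<Longrightarrow> eq w a b \<Longrightarrow> eq w b a"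
  using eq_eq1 eq_refl by blast

end

section \<open>Derivations and renaming of bound variables\<close>

lemma subst_subst_inv:
  assumes "z \<notin> vars A"
  shows "subst (subst A x z) z x = A"
proof -
  have *: "z \<notin> vars B \<Longrightarrow> subst B z x = B" for B
    using subst_notin_FV FV_subset_vars by blast
  show ?thesis
    using assms by (induction A) (auto simp: rn_def *)
qed

lemma free_for_subst_inv: "z \<notin> vars A \<Longrightarrow> free_for x z (subst A x z)"
  by (induction A) (use FV_subset_vars in \<open>auto simp: free_for_notin_vars\<close>)

lemma prv_mono: "prv T A \<Longrightarrow> T \<subseteq> T' \<Longrightarrow> prv T' A"
  by (induction rule: prv.induct) (auto intro: prv.intros)

lemma prv_finite: "prv T A \<Longrightarrow> \<exists>T0\<subseteq>T. finite T0 \<and> prv T0 A"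
proof (induction rule: prv.induct)
  case (ax A)
  then show ?case by (intro exI[of _ "{A}"]) (auto intro: prv.ax)
next
  case (mp A B)
  then obtain T1 T2 where "T1 \<subseteq> T" "finite T1" "prv T1 (Imp A B)" "T2 \<subseteq> T" "finite T2" "prv T2 A"
    by blast
  then show ?case by (intro exI[of _ "T1 \<union> T2"]) (auto intro: prv.mp prv_mono)
qed (blast intro: prv.intros)+

section \<open>Derived rules of the Hilbert calculus\<close>

lemma prv_refl: "prv T (Imp A A)"
  using mp[OF mp[OF ax_S ax_K] ax_K[of T A A]] .

lemma prv_weak: "prv T A \<Longrightarrow> prv T (Imp H A)"
  by (rule mp[OF ax_K])

lemma prv_mp: "prv T (Imp H (Imp A B)) \<Longrightarrow> prv T (Imp H A) \<Longrightarrow> prv T (Imp H B)"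
  by (rule mp[OF mp[OF ax_S]])

lemma prv_trans: "prv T (Imp A B) \<Longrightarrow> prv T (Imp B C) \<Longrightarrow> prv T (Imp A C)"
  by (rule prv_mp[OF prv_weak])

lemma prv_conj: "prv T (Imp H A) \<Longrightarrow> prv T (Imp H B) \<Longrightarrow> prv T (Imp H (And A B))"
  by (rule prv_mp[OF prv_mp[OF prv_weak[OF ax_conjI]]])

lemma prv_curry: "prv T (Imp (And H A) B) \<Longrightarrow> prv T (Imp H (Imp A B))"
  by (rule prv_trans[OF ax_conjI]) (rule mp[OF ax_S prv_weak])

lemma prv_uncurry: "prv T (Imp H (Imp A B)) \<Longrightarrow> prv T (Imp (And H A) B)"
  by (rule prv_mp[OF prv_trans[OF ax_conj1] ax_conj2])

lemma prv_swap: "prv T (Imp A (Imp B C)) \<Longrightarrow> prv T (Imp B (Imp A C))"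
  by (rule prv_curry, rule prv_trans[OF prv_conj[OF ax_conj2 ax_conj1]], rule prv_uncurry)

lemma prv_disj: "prv T (Imp A C) \<Longrightarrow> prv T (Imp B C) \<Longrightarrow> prv T (Imp (Or A B) C)"
  by (rule mp[OF mp[OF ax_disjE]])

lemma prv_IffI: "prv T (Imp A B) \<Longrightarrow> prv T (Imp B A) \<Longrightarrow> prv T (Iff A B)"
  unfolding Iff_def by (rule mp[OF mp[OF ax_conjI]])

lemma prv_IffD1: "prv T (Iff A B) \<Longrightarrow> prv T (Imp A B)"
  unfolding Iff_def by (rule mp[OF ax_conj1])

lemma prv_IffD2: "prv T (Iff A B) \<Longrightarrow> prv T (Imp B A)"
  unfolding Iff_def by (rule mp[OF ax_conj2])

lemma prv_Iff_refl: "prv T (Iff A A)"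
  by (intro prv_IffI prv_refl)

lemma prv_Iff_sym: "prv T (Iff A B) \<Longrightarrow> prv T (Iff B A)"
  by (rule prv_IffI[OF prv_IffD2 prv_IffD1])

lemma prv_Iff_trans: "prv T (Iff A B) \<Longrightarrow> prv T (Iff B C) \<Longrightarrow> prv T (Iff A C)"
  by (rule prv_IffI) (rule prv_trans[OF prv_IffD1 prv_IffD1] prv_trans[OF prv_IffD2 prv_IffD2]; assumption)+

lemma prv_And_cong: "prv T (Iff A A') \<Longrightarrow> prv T (Iff B B') \<Longrightarrow> prv T (Iff (And A B) (And A' B'))"
  by (rule prv_IffI; rule prv_conj)
    (rule prv_trans[OF ax_conj1 prv_IffD1] prv_trans[OF ax_conj2 prv_IffD1]
      prv_trans[OF ax_conj1 prv_IffD2] prv_trans[OF ax_conj2 prv_IffD2]; assumption)+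

lemma prv_Or_cong: "prv T (Iff A A') \<Longrightarrow> prv T (Iff B B') \<Longrightarrow> prv T (Iff (Or A B) (Or A' B'))"
  by (rule prv_IffI; rule prv_disj)
    (rule prv_trans[OF prv_IffD1 ax_disj1] prv_trans[OF prv_IffD1 ax_disj2]
      prv_trans[OF prv_IffD2 ax_disj1] prv_trans[OF prv_IffD2 ax_disj2]; assumption)+

lemma prv_Imp_mono:
  assumes "prv T (Imp A' A)" "prv T (Imp B B')"
  shows "prv T (Imp (Imp A B) (Imp A' B'))"
proof (rule prv_curry)
  have "prv T (Imp (And (Imp A B) A') A)" by (rule prv_trans[OF ax_conj2 assms(1)])
  then show "prv T (Imp (And (Imp A B) A') B')"
    by (rule prv_trans[OF prv_mp[OF ax_conj1] assms(2)])
qed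

lemma prv_Imp_cong: "prv T (Iff A A') \<Longrightarrow> prv T (Iff B B') \<Longrightarrow> prv T (Iff (Imp A B) (Imp A' B'))"
  by (rule prv_IffI; rule prv_Imp_mono) (rule prv_IffD1 prv_IffD2; assumption)+

lemma prv_gen: assumes "prv T A" shows "prv T (All x A)"
  using mp[OF prv.allI[OF prv_weak[OF assms, of "Imp Bot Bot"]] prv_refl] by simp

lemma prv_allE: "prv T (Imp (All x A) A)"
  using ax_allE[of x x A] by simp

lemma prv_exI: "prv T (Imp A (Ex x A))"
  using ax_exI[of x x A] by simp

lemma prv_All_mono: assumes "prv T (Imp A B)" shows "prv T (Imp (All x A) (All x B))"
  by (rule prv.allI[OF prv_trans[OF prv_allE assms]]) simp

lemma prv_Ex_mono: assumes "prv T (Imp A B)" shows "prv T (Imp (Ex x A) (Ex x B))"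
  by (rule prv.exE[OF prv_trans[OF assms prv_exI]]) simp

lemma prv_All_cong: "prv T (Iff A B) \<Longrightarrow> prv T (Iff (All x A) (All x B))"
  by (rule prv_IffI; rule prv_All_mono) (rule prv_IffD1 prv_IffD2; assumption)+

lemma prv_Ex_cong: "prv T (Iff A B) \<Longrightarrow> prv T (Iff (Ex x A) (Ex x B))"
  by (rule prv_IffI; rule prv_Ex_mono) (rule prv_IffD1 prv_IffD2; assumption)+

lemma prv_subst: assumes "prv T A" "free_for y x A" shows "prv T (subst A x y)"
  using mp[OF ax_allE[OF assms(2)] prv_gen[OF assms(1)]] .

lemma prv_alpha_All:
  assumes "z \<notin> vars A"
  shows "prv T (Iff (All x A) (All z (subst A x z)))"
proof (rule prv_IffI)
  show "prv T (Imp (All x A) (All z (subst A x z)))"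
    by (rule prv.allI[OF ax_allE]) (use assms FV_subset_vars in \<open>auto simp: free_for_notin_vars\<close>)
  have "prv T (Imp (All z (subst A x z)) A)"
    using ax_allE[OF free_for_subst_inv[OF assms], of T] by (simp add: subst_subst_inv[OF assms])
  then show "prv T (Imp (All z (subst A x z)) (All x A))"
    by (rule prv.allI) (use FV_subst[of A x z] in auto)
qed

lemma prv_alpha_Ex:
  assumes "z \<notin> vars A"
  shows "prv T (Iff (Ex x A) (Ex z (subst A x z)))"
proof (rule prv_IffI)
  show "prv T (Imp (Ex z (subst A x z)) (Ex x A))"
    by (rule prv.exE[OF ax_exI]) (use assms FV_subset_vars in \<open>auto simp: free_for_notin_vars\<close>)
  have "prv T (Imp A (Ex z (subst A x z)))"
    using ax_exI[OF free_for_subst_inv[OF assms], of T] by (simp add: subst_subst_inv[OF assms])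
  then show "prv T (Imp (Ex x A) (Ex z (subst A x z)))"
    by (rule prv.exE) (use FV_subst[of A x z] in auto)
qed

section \<open>Moving bound variables away from a finite set\<close>

primrec bv :: "fm \<Rightarrow> var set" where
  "bv (Mem x y) = {}"
| "bv (Eq x y) = {}"
| "bv Bot = {}"
| "bv (And A B) = bv A \<union> bv B"
| "bv (Or A B) = bv A \<union> bv B"
| "bv (Imp A B) = bv A \<union> bv B"
| "bv (All x A) = insert x (bv A)"
| "bv (Ex x A) = insert x (bv A)"
| "bv (BAll x t A) = insert x (bv A)"
| "bv (BEx x t A) = insert x (bv A)"
| "bv (EAll x a b A) = insert x (bv A)"
| "bv (EEx x a b A) = insert x (bv A)"

lemma free_for_notin_bv: "y \<notin> bv A \<Longrightarrow> free_for y x A"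
  by (induction A) auto

lemma bv_subst [simp]: "bv (subst A x y) = bv A"
  by (induction A) auto

text \<open>The weights make the unfolding of a bounded quantifier smaller than the quantifier itself.\<close>

primrec weight :: "fm \<Rightarrow> nat" where
  "weight (Mem x y) = 1"
| "weight (Eq x y) = 1"
| "weight Bot = 1"
| "weight (And A B) = weight A + weight B + 1"
| "weight (Or A B) = weight A + weight B + 1"
| "weight (Imp A B) = weight A + weight B + 1"
| "weight (All x A) = weight A + 1"
| "weight (Ex x A) = weight A + 1"
| "weight (BAll x t A) = weight A + 10"
| "weight (BEx x t A) = weight A + 10"
| "weight (EAll x a b A) = weight A + 1000"
| "weight (EEx x a b A) = weight A + 1000"

lemma weight_subst [simp]: "weight (subst A x y) = weight A"
  by (induction A) auto

text \<open>Unfolding an exponentiation-bounded quantifier costs this weight plus 2, which stays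
  below the surcharge of 1000 for the quantifier.\<close>

lemma weight_fun_fm: "weight (fun_fm f a b) < 900"
  by (simp add: fun_fm_def is_pair_fm_def sing_fm_def upair_fm_def Let_def)

lemma fresh_var: "finite S \<Longrightarrow> \<exists>z::var. z \<notin> S"
  by (rule ex_new_if_finite) auto

lemma prv_BAll_unfold:
  "z \<noteq> t \<Longrightarrow> z \<notin> vars A \<Longrightarrow> prv T (Iff (BAll x t A) (All z (Imp (Mem z t) (subst A x z))))"
  by (rule ax_ball) (use FV_subset_vars in \<open>auto simp: free_for_notin_vars\<close>)

lemma prv_BEx_unfold:
  "z \<noteq> t \<Longrightarrow> z \<notin> vars A \<Longrightarrow> prv T (Iff (BEx x t A) (Ex z (And (Mem z t) (subst A x z))))"
  by (rule ax_bex) (use FV_subset_vars in \<open>auto simp: free_for_notin_vars\<close>)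

lemma prv_EAll_unfold:
  "z \<noteq> a \<Longrightarrow> z \<noteq> b \<Longrightarrow> z \<notin> vars A \<Longrightarrow>
    prv T (Iff (EAll x a b A) (All z (Imp (fun_fm z a b) (subst A x z))))"
  by (rule ax_eall) (use FV_subset_vars in \<open>auto simp: free_for_notin_vars\<close>)

lemma prv_EEx_unfold:
  "z \<noteq> a \<Longrightarrow> z \<noteq> b \<Longrightarrow> z \<notin> vars A \<Longrightarrow>
    prv T (Iff (EEx x a b A) (Ex z (And (fun_fm z a b) (subst A x z))))"
  by (rule ax_eex) (use FV_subset_vars in \<open>auto simp: free_for_notin_vars\<close>)

lemma prv_Iff_subst:
  assumes "prv T (Iff A B)" "z \<notin> vars A" "z \<notin> vars B"
  shows "prv T (Iff (subst A x z) (subst B x z))"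
  using prv_subst[OF assms(1), of z x] assms by (simp add: Iff_def free_for_notin_vars)

text \<open>A template for the four bounded quantifiers: unfold both sides to an unbounded
  quantifier over the same fresh variable, replace the body inside the context \<open>R\<close>, and
  fold back.\<close>

lemma prv_rename_bounded:
  assumes "prv T (Iff A B)" "z \<notin> vars A" "z \<notin> vars B"
    "prv T (Iff QA (R (subst A x z)))" "prv T (Iff QB (R (subst B x z)))"
    "\<And>C C'. prv T (Iff C C') \<Longrightarrow> prv T (Iff (R C) (R C'))"
  shows "prv T (Iff QA QB)"
  by (rule prv_Iff_trans[OF assms(4) prv_Iff_trans[OF assms(6)[OF prv_Iff_subst[OF assms(1-3)]]
        prv_Iff_sym[OF assms(5)]]])

text \<open>Substitution never renames bound variables, so instantiation with a prescribed variable
  can be blocked by capture. Preserving the weight lets an induction on \<open>weight\<close> apply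
  its hypothesis to the renamed formula.\<close>

lemma rename_bound:
  assumes "finite S"
  shows "\<exists>B. bv B \<inter> S = {} \<and> FV B \<subseteq> FV A \<and> weight B = weight A \<and> (\<forall>T. prv T (Iff A B))"
proof (induction A)
  case (Mem x y) then show ?case by (intro exI[of _ "Mem x y"]) (simp add: prv_Iff_refl)
next
  case (Eq x y) then show ?case by (intro exI[of _ "Eq x y"]) (simp add: prv_Iff_refl)
next
  case Bot then show ?case by (intro exI[of _ Bot]) (simp add: prv_Iff_refl)
next
  case (And A1 A2)
  then obtain B1 B2 where "bv B1 \<inter> S = {}" "FV B1 \<subseteq> FV A1" "weight B1 = weight A1" "\<forall>T. prv T (Iff A1 B1)"
    "bv B2 \<inter> S = {}" "FV B2 \<subseteq> FV A2" "weight B2 = weight A2" "\<forall>T. prv T (Iff A2 B2)" by blast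
  then show ?case by (intro exI[of _ "And B1 B2"]) (auto intro: prv_And_cong)
next
  case (Or A1 A2)
  then obtain B1 B2 where "bv B1 \<inter> S = {}" "FV B1 \<subseteq> FV A1" "weight B1 = weight A1" "\<forall>T. prv T (Iff A1 B1)"
    "bv B2 \<inter> S = {}" "FV B2 \<subseteq> FV A2" "weight B2 = weight A2" "\<forall>T. prv T (Iff A2 B2)" by blast
  then show ?case by (intro exI[of _ "Or B1 B2"]) (auto intro: prv_Or_cong)
next
  case (Imp A1 A2)
  then obtain B1 B2 where "bv B1 \<inter> S = {}" "FV B1 \<subseteq> FV A1" "weight B1 = weight A1" "\<forall>T. prv T (Iff A1 B1)"
    "bv B2 \<inter> S = {}" "FV B2 \<subseteq> FV A2" "weight B2 = weight A2" "\<forall>T. prv T (Iff A2 B2)" by blast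
  then show ?case by (intro exI[of _ "Imp B1 B2"]) (auto intro: prv_Imp_cong)
next
  case (All x A)
  then obtain B where B: "bv B \<inter> S = {}" "weight B = weight A" "\<And>T. prv T (Iff A B)" "FV B \<subseteq> FV A" by blast
  obtain z where z: "z \<notin> vars B \<union> S" using fresh_var[of "vars B \<union> S"] assms by auto
  have "prv T (Iff (All x A) (All z (subst B x z)))" for T
    by (rule prv_Iff_trans[OF prv_All_cong[OF B(3)] prv_alpha_All]) (use z in auto)
  then show ?case using B z FV_subst[of B x z] by (intro exI[of _ "All z (subst B x z)"]) auto
next
  case (Ex x A)
  then obtain B where B: "bv B \<inter> S = {}" "weight B = weight A" "\<And>T. prv T (Iff A B)" "FV B \<subseteq> FV A" by blast
  obtain z where z: "z \<notin> vars B \<union> S" using fresh_var[of "vars B \<union> S"] assms by auto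
  have "prv T (Iff (Ex x A) (Ex z (subst B x z)))" for T
    by (rule prv_Iff_trans[OF prv_Ex_cong[OF B(3)] prv_alpha_Ex]) (use z in auto)
  then show ?case using B z FV_subst[of B x z] by (intro exI[of _ "Ex z (subst B x z)"]) auto
next
  case (BAll x t A)
  then obtain B where B: "bv B \<inter> S = {}" "weight B = weight A" "\<And>T. prv T (Iff A B)" "FV B \<subseteq> FV A" by blast
  obtain z where z: "z \<notin> vars A \<union> vars B \<union> S \<union> {t}"
    using fresh_var[of "vars A \<union> vars B \<union> S \<union> {t}"] assms by auto
  have "prv T (Iff (BAll x t A) (BAll z t (subst B x z)))" for T
    by (rule prv_rename_bounded[where R = "\<lambda>C. All z (Imp (Mem z t) C)", OF B(3) _ _
          prv_BAll_unfold ax_ball[of z z _ "subst B x z", simplified] prv_All_cong[OF prv_Imp_cong[OF prv_Iff_refl]]]) (use z in auto)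
  then show ?case using B z FV_subst[of B x z] by (intro exI[of _ "BAll z t (subst B x z)"]) auto
next
  case (BEx x t A)
  then obtain B where B: "bv B \<inter> S = {}" "weight B = weight A" "\<And>T. prv T (Iff A B)" "FV B \<subseteq> FV A" by blast
  obtain z where z: "z \<notin> vars A \<union> vars B \<union> S \<union> {t}"
    using fresh_var[of "vars A \<union> vars B \<union> S \<union> {t}"] assms by auto
  have "prv T (Iff (BEx x t A) (BEx z t (subst B x z)))" for T
    by (rule prv_rename_bounded[where R = "\<lambda>C. Ex z (And (Mem z t) C)", OF B(3) _ _
          prv_BEx_unfold ax_bex[of z z _ "subst B x z", simplified] prv_Ex_cong[OF prv_And_cong[OF prv_Iff_refl]]]) (use z in auto)
  then show ?case using B z FV_subst[of B x z] by (intro exI[of _ "BEx z t (subst B x z)"]) auto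
next
  case (EAll x a b A)
  then obtain B where B: "bv B \<inter> S = {}" "weight B = weight A" "\<And>T. prv T (Iff A B)" "FV B \<subseteq> FV A" by blast
  obtain z where z: "z \<notin> vars A \<union> vars B \<union> S \<union> {a, b}"
    using fresh_var[of "vars A \<union> vars B \<union> S \<union> {a, b}"] assms by auto
  have "prv T (Iff (EAll x a b A) (EAll z a b (subst B x z)))" for T
    by (rule prv_rename_bounded[where R = "\<lambda>C. All z (Imp (fun_fm z a b) C)", OF B(3) _ _
          prv_EAll_unfold ax_eall[of z z _ _ "subst B x z", simplified] prv_All_cong[OF prv_Imp_cong[OF prv_Iff_refl]]]) (use z in auto)
  then show ?case using B z FV_subst[of B x z] by (intro exI[of _ "EAll z a b (subst B x z)"]) auto
next
  case (EEx x a b A)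
  then obtain B where B: "bv B \<inter> S = {}" "weight B = weight A" "\<And>T. prv T (Iff A B)" "FV B \<subseteq> FV A" by blast
  obtain z where z: "z \<notin> vars A \<union> vars B \<union> S \<union> {a, b}"
    using fresh_var[of "vars A \<union> vars B \<union> S \<union> {a, b}"] assms by auto
  have "prv T (Iff (EEx x a b A) (EEx z a b (subst B x z)))" for T
    by (rule prv_rename_bounded[where R = "\<lambda>C. Ex z (And (fun_fm z a b) C)", OF B(3) _ _
          prv_EEx_unfold ax_eex[of z z _ _ "subst B x z", simplified] prv_Ex_cong[OF prv_And_cong[OF prv_Iff_refl]]]) (use z in auto)
  then show ?case using B z FV_subst[of B x z] by (intro exI[of _ "EEx z a b (subst B x z)"]) auto
qed

section \<open>Derivability from hypotheses\<close>

primrec conjl :: "fm list \<Rightarrow> fm" where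
  "conjl [] = Imp Bot Bot"
| "conjl (A # As) = And A (conjl As)"

lemma prv_conjl_mem: "A \<in> set As \<Longrightarrow> prv T (Imp (conjl As) A)"
  by (induction As) (auto intro: ax_conj1 prv_trans[OF ax_conj2])

lemma prv_conjlI: "(\<And>A. A \<in> set As \<Longrightarrow> prv T (Imp H A)) \<Longrightarrow> prv T (Imp H (conjl As))"
  by (induction As) (auto intro: prv_conj prv_weak prv_refl)

lemma FV_conjl: "FV (conjl As) = (\<Union>A\<in>set As. FV A)"
  by (induction As) auto

text \<open>Axioms in \<open>T\<close> are implicitly universally closed, whereas free variables of
  hypotheses act as parameters. Moving the hypotheses into an antecedent prevents generalisation
  over them.\<close>

definition der :: "fm set \<Rightarrow> fm set \<Rightarrow> fm \<Rightarrow> bool" where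
  "der T \<Gamma> A = (\<exists>As. set As \<subseteq> \<Gamma> \<and> prv T (Imp (conjl As) A))"

lemma der_prv: "prv T A \<Longrightarrow> der T \<Gamma> A"
  unfolding der_def by (intro exI[of _ "[]"]) (simp add: prv_weak)

lemma der_in: "A \<in> \<Gamma> \<Longrightarrow> der T \<Gamma> A"
  unfolding der_def by (intro exI[of _ "[A]"]) (simp add: ax_conj1)

lemma der_mono: "der T \<Gamma> A \<Longrightarrow> \<Gamma> \<subseteq> \<Delta> \<Longrightarrow> der T \<Delta> A"
  unfolding der_def by blast

lemma der_mp:
  assumes "der T \<Gamma> (Imp A B)" "der T \<Gamma> A"
  shows "der T \<Gamma> B"
proof -
  obtain As Bs where a: "set As \<subseteq> \<Gamma>" "prv T (Imp (conjl As) (Imp A B))"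
    and b: "set Bs \<subseteq> \<Gamma>" "prv T (Imp (conjl Bs) A)"
    using assms unfolding der_def by blast
  have "prv T (Imp (conjl (As @ Bs)) (conjl As))" "prv T (Imp (conjl (As @ Bs)) (conjl Bs))"
    by (rule prv_conjlI, rule prv_conjl_mem, simp)+
  then have "prv T (Imp (conjl (As @ Bs)) B)"
    using a b prv_mp prv_trans by metis
  then show ?thesis using a b unfolding der_def by (intro exI[of _ "As @ Bs"]) auto
qed

lemma der_prv_mp: "prv T (Imp A B) \<Longrightarrow> der T \<Gamma> A \<Longrightarrow> der T \<Gamma> B"
  by (rule der_mp[OF der_prv])

lemma der_imp:
  assumes "der T (insert A \<Gamma>) B"
  shows "der T \<Gamma> (Imp A B)"
proof -
  obtain As where a: "set As \<subseteq> insert A \<Gamma>" "prv T (Imp (conjl As) B)"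
    using assms unfolding der_def by blast
  have "prv T (Imp (And (conjl (removeAll A As)) A) C)" if "C \<in> set As" for C
    using that by (cases "C = A") (auto intro: ax_conj2 prv_trans[OF ax_conj1 prv_conjl_mem])
  then have "prv T (Imp (And (conjl (removeAll A As)) A) B)"
    by (rule prv_trans[OF prv_conjlI a(2)])
  then show ?thesis using a(1) unfolding der_def
    by (intro exI[of _ "removeAll A As"]) (auto intro: prv_curry)
qed

lemma der_cut: "der T (insert A \<Gamma>) B \<Longrightarrow> der T \<Gamma> A \<Longrightarrow> der T \<Gamma> B"
  using der_imp der_mp by blast

lemma der_all:
  assumes "der T \<Gamma> (subst A x z)" "\<And>B. B \<in> \<Gamma> \<Longrightarrow> z \<notin> FV B" "z \<notin> vars A"
  shows "der T \<Gamma> (All x A)"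
proof -
  obtain As where a: "set As \<subseteq> \<Gamma>" "prv T (Imp (conjl As) (subst A x z))"
    using assms unfolding der_def by blast
  have "z \<notin> FV (conjl As)" using a(1) assms(2) by (auto simp: FV_conjl)
  then have "prv T (Imp (conjl As) (All z (subst A x z)))" by (rule prv.allI[OF a(2)])
  then show ?thesis
    using a(1) prv_trans[OF _ prv_IffD2[OF prv_alpha_All[OF assms(3)]]] unfolding der_def by blast
qed

lemma der_ex:
  assumes "der T (insert (subst A x z) \<Gamma>) C" "\<And>B. B \<in> \<Gamma> \<Longrightarrow> z \<notin> FV B" "z \<notin> vars A" "z \<notin> FV C"
  shows "der T (insert (Ex x A) \<Gamma>) C"
proof -
  obtain As where a: "set As \<subseteq> \<Gamma>" "prv T (Imp (conjl As) (Imp (subst A x z) C))"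
    using der_imp[OF assms(1)] unfolding der_def by blast
  have "z \<notin> FV (conjl As)" using a(1) assms(2) by (auto simp: FV_conjl)
  then have "prv T (Imp (Ex z (subst A x z)) (Imp (conjl As) C))"
    using assms(4) by (intro prv.exE[OF prv_swap[OF a(2)]]) simp
  then have "prv T (Imp (Ex x A) (Imp (conjl As) C))"
    by (rule prv_trans[OF prv_IffD1[OF prv_alpha_Ex[OF assms(3)]]])
  then have "prv T (Imp (conjl (Ex x A # As)) C)"
    by (simp add: prv_uncurry)
  then show ?thesis using a(1) unfolding der_def by (intro exI[of _ "Ex x A # As"]) auto
qed

lemma der_disj:
  assumes "der T (insert A \<Gamma>) C" "der T (insert B \<Gamma>) C" "der T \<Gamma> (Or A B)"
  shows "der T \<Gamma> C"
  using der_mp[OF der_mp[OF der_prv_mp[OF ax_disjE der_imp[OF assms(1)]] der_imp[OF assms(2)]] assms(3)] .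

section \<open>Kripke completeness\<close>

instance fm :: countable
  by countable_datatype

text \<open>Applied to the variables not yet in use: one half provides Henkin witnesses, the other
  stays free so that the resulting world can be extended again.\<close>

lemma infinite_split:
  assumes "infinite (X :: nat set)"
  shows "\<exists>Y\<subseteq>X. infinite Y \<and> infinite (X - Y)"
proof -
  define f where "f = enumerate X"
  have inj: "inj f" unfolding f_def using assms by (simp add: inj_enumerate)
  have mem: "f n \<in> X" for n unfolding f_def using assms by (simp add: enumerate_in_set)
  have e: "infinite (f ` range (\<lambda>n. 2 * n))" and o: "infinite (f ` range (\<lambda>n. 2 * n + 1))"
    using inj by (auto simp: finite_image_iff inj_on_def range_inj_infinite)
  have "f ` range (\<lambda>n. 2 * n + 1) \<subseteq> X - f ` range (\<lambda>n. 2 * n)"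
    using mem inj by (auto simp: inj_eq) presburger
  then show ?thesis
    using e o mem infinite_super by (intro exI[of _ "f ` range (\<lambda>n. 2 * n)"]) blast
qed

text \<open>Prime theories with Henkin witnesses. The variables in \<open>L\<close> play the role of
  constants, as the language has none; new constants for larger worlds must come from the complement
  of \<open>L\<close>.\<close>

definition saturated :: "fm set \<Rightarrow> var set \<Rightarrow> fm set \<Rightarrow> bool" where
  "saturated T L \<Gamma> \<longleftrightarrow>
    infinite (- L) \<and> L \<noteq> {} \<and> (\<forall>A\<in>\<Gamma>. FV A \<subseteq> L) \<and>
    (\<forall>A. FV A \<subseteq> L \<longrightarrow> der T \<Gamma> A \<longrightarrow> A \<in> \<Gamma>) \<and> Bot \<notin> \<Gamma> \<and>
    (\<forall>A B. Or A B \<in> \<Gamma> \<longrightarrow> A \<in> \<Gamma> \<or> B \<in> \<Gamma>) \<and>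
    (\<forall>x A. Ex x A \<in> \<Gamma> \<longrightarrow> (\<exists>d\<in>L. free_for d x A \<and> subst A x d \<in> \<Gamma>))"

lemma der_Union_chain:
  assumes "der T (\<Union>n::nat. G n) A" "mono G"
  shows "\<exists>n. der T (G n) A"
proof -
  obtain As where a: "set As \<subseteq> (\<Union>n. G n)" "prv T (Imp (conjl As) A)"
    using assms(1) unfolding der_def by blast
  have "\<exists>n. set As \<subseteq> G n"
    using a(1)
  proof (induction As)
    case (Cons B Bs)
    then obtain n m where "set Bs \<subseteq> G n" "B \<in> G m" by auto
    moreover have "G n \<subseteq> G (max n m)" "G m \<subseteq> G (max n m)"
      using assms(2) by (simp_all add: monoD)
    ultimately show ?case by (intro exI[of _ "max n m"]) auto
  qed simp
  then show ?thesis using a(2) unfolding der_def by blast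
qed

text \<open>The Lindenbaum construction relative to \<open>C\<close>: a formula is added, with a
  fresh witness if it is existential, unless this would make \<open>C\<close> derivable. Closure and
  primeness follow because every rejected formula over \<open>L\<close> derives \<open>C\<close>
  together with the final theory.\<close>

lemma saturated_extension:
  assumes "\<And>A. A \<in> \<Gamma>0 \<Longrightarrow> FV A \<subseteq> L0" "infinite (- L0)" "FV C \<subseteq> L0" "\<not> der T \<Gamma>0 C"
  shows "\<exists>L \<Gamma>. saturated T L \<Gamma> \<and> L0 \<subseteq> L \<and> \<Gamma>0 \<subseteq> \<Gamma> \<and> C \<notin> \<Gamma>"
proof -
  obtain N where N: "N \<subseteq> - L0" "infinite N" "infinite (- L0 - N)"
    using infinite_split[OF assms(2)] by blast
  define L where "L = L0 \<union> N"
  \<comment> \<open>The theory may be infinite, but only finitely many variables of \<open>N\<close>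
    have been spent at each stage, so a fresh witness is always left.\<close>
  define good where "good = (\<lambda>\<Gamma>. \<not> der T \<Gamma> C \<and> (\<forall>A\<in>\<Gamma>. FV A \<subseteq> L) \<and> finite (\<Union>(FV ` \<Gamma>) \<inter> N))"
  define ok where "ok = (\<lambda>\<phi> \<Gamma> \<Delta>. good \<Delta> \<and> \<Gamma> \<subseteq> \<Delta> \<and>
    (FV \<phi> \<subseteq> L \<longrightarrow> \<not> der T (insert \<phi> \<Gamma>) C \<longrightarrow> \<phi> \<in> \<Delta> \<and>
      (\<forall>x A. \<phi> = Ex x A \<longrightarrow> (\<exists>d\<in>L. free_for d x A \<and> subst A x d \<in> \<Delta>))))"
  have step: "\<exists>\<Delta>. ok \<phi> \<Gamma> \<Delta>" if g: "good \<Gamma>" for \<phi> \<Gamma>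
  proof (cases "FV \<phi> \<subseteq> L \<and> \<not> der T (insert \<phi> \<Gamma>) C")
    case False
    then show ?thesis using g unfolding ok_def by (intro exI[of _ \<Gamma>]) auto
  next
    case True
    have fin: "finite (FV \<phi> \<inter> N)" by (rule finite_subset[OF _ finite_vars[of \<phi>]]) (use FV_subset_vars in auto)
    have gi: "good (insert \<phi> \<Gamma>)"
      using g True fin unfolding good_def by (auto simp: Int_Un_distrib2)
    show ?thesis
    proof (cases "\<exists>x A. \<phi> = Ex x A")
      case False
      then show ?thesis using gi unfolding ok_def by (intro exI[of _ "insert \<phi> \<Gamma>"]) auto
    next
      case ex: True
      then obtain x A where A: "\<phi> = Ex x A" by blast
      have "infinite (N - (\<Union>(FV ` \<Gamma>) \<inter> N) - vars \<phi> - vars C)"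
        using g N(2) unfolding good_def by (simp add: Diff_infinite_finite)
      then obtain d where "d \<in> N - (\<Union>(FV ` \<Gamma>) \<inter> N) - vars \<phi> - vars C"
        using not_finite_existsD by (metis all_not_in_conv finite.emptyI)
      then have d: "d \<in> N" "\<And>B. B \<in> \<Gamma> \<Longrightarrow> d \<notin> FV B" "d \<notin> vars \<phi>" "d \<notin> FV C"
        using FV_subset_vars by auto
      have dA: "d \<notin> vars A" "d \<noteq> x" using d(3) A by auto
      have dphi: "d \<notin> FV \<phi>" using d(3) FV_subset_vars by blast
      let ?\<Delta> = "insert (subst A x d) (insert \<phi> \<Gamma>)"
      have "\<not> der T ?\<Delta> C"
      proof
        assume "der T ?\<Delta> C"
        then have "der T (insert (Ex x A) (insert \<phi> \<Gamma>)) C"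
          by (rule der_ex) (use d dA dphi in auto)
        then show False using True A by simp
      qed
      moreover have sub: "FV (subst A x d) \<subseteq> insert d (FV \<phi>)" using FV_subst[of A x d] A by auto
      moreover have "FV (subst A x d) \<subseteq> L" using sub True d(1) unfolding L_def by auto
      moreover have "finite (FV (subst A x d) \<inter> N)"
        by (rule finite_subset[of _ "insert d (FV \<phi> \<inter> N)"]) (use sub fin in auto)
      ultimately have "good ?\<Delta>" using gi unfolding good_def by (auto simp: Int_Un_distrib2)
      moreover have "free_for d x A" using dA free_for_notin_vars by blast
      ultimately show ?thesis using A d(1) unfolding ok_def L_def by (intro exI[of _ ?\<Delta>]) auto
    qed
  qed
  define nx where "nx = (\<lambda>\<phi> \<Gamma>. SOME \<Delta>. ok \<phi> \<Gamma> \<Delta>)"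
  have nx: "ok \<phi> \<Gamma> (nx \<phi> \<Gamma>)" if "good \<Gamma>" for \<phi> \<Gamma>
    unfolding nx_def using someI_ex[OF step[OF that]] .
  define G where "G = rec_nat \<Gamma>0 (\<lambda>n \<Gamma>. nx (from_nat n) \<Gamma>)"
  have G0: "G 0 = \<Gamma>0" and GS: "G (Suc n) = nx (from_nat n) (G n)" for n by (simp_all add: G_def)
  have "\<Union>(FV ` \<Gamma>0) \<inter> N = {}" using assms(1) N(1) by blast
  then have good0: "good \<Gamma>0" using assms(1,4) unfolding good_def L_def by auto
  have good: "good (G n)" for n
    by (induction n) (use good0 nx in \<open>auto simp: G0 GS ok_def\<close>)
  have okn: "ok (from_nat n) (G n) (G (Suc n))" for n using nx[OF good] by (simp add: GS)
  have inc: "mono G"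
    unfolding mono_iff_le_Suc using okn by (simp add: ok_def)
  define \<Gamma> where "\<Gamma> = (\<Union>n. G n)"
  have nC: "\<not> der T \<Gamma> C"
    using der_Union_chain[OF _ inc] good unfolding \<Gamma>_def good_def by blast
  have FVL: "\<And>A. A \<in> \<Gamma> \<Longrightarrow> FV A \<subseteq> L" using good unfolding \<Gamma>_def good_def by blast
  have G_sub: "G n \<subseteq> \<Gamma>" for n unfolding \<Gamma>_def by blast
  have stage: "\<phi> \<in> \<Gamma> \<and> (\<forall>x A. \<phi> = Ex x A \<longrightarrow> (\<exists>d\<in>L. free_for d x A \<and> subst A x d \<in> \<Gamma>))"
    if "FV \<phi> \<subseteq> L" "\<not> der T (insert \<phi> \<Gamma>) C" for \<phi>
  proof -
    \<comment> \<open>Treating each formula once is enough: what is compatible with the limit was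
      compatible at its own stage, by monotonicity of \<open>der\<close>.\<close>
    have "\<not> der T (insert \<phi> (G (to_nat \<phi>))) C"
      using that(2) der_mono[of T "insert \<phi> (G (to_nat \<phi>))" C "insert \<phi> \<Gamma>"] G_sub by blast
    then show ?thesis using okn[of "to_nat \<phi>"] that(1) G_sub unfolding ok_def by (auto; blast)
  qed
  have closed: "A \<in> \<Gamma>" if "FV A \<subseteq> L" "der T \<Gamma> A" for A
    using stage[OF that(1)] der_cut[OF _ that(2)] nC by blast
  have "saturated T L \<Gamma>"
    unfolding saturated_def
  proof (intro conjI HOL.allI ballI impI)
    show "infinite (- L)" using N(3) by (simp add: L_def Diff_eq)
    show "L \<noteq> {}" using N(2) by (auto simp: L_def)
    show "Bot \<notin> \<Gamma>" using nC der_prv_mp[OF ax_efq der_in] by blast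
    fix A B assume AB: "Or A B \<in> \<Gamma>"
    then have F: "FV A \<subseteq> L" "FV B \<subseteq> L" using FVL by fastforce+
    have "\<not> (der T (insert A \<Gamma>) C \<and> der T (insert B \<Gamma>) C)"
      using der_disj[OF _ _ der_in[OF AB]] nC by blast
    then show "A \<in> \<Gamma> \<or> B \<in> \<Gamma>" using stage F by blast
  next
    fix x A assume A: "Ex x A \<in> \<Gamma>"
    then have "\<not> der T (insert (Ex x A) \<Gamma>) C" using nC by (simp add: insert_absorb)
    then show "\<exists>d\<in>L. free_for d x A \<and> subst A x d \<in> \<Gamma>" using stage FVL[OF A] by blast
  qed (use closed FVL in auto)
  moreover have "C \<notin> \<Gamma>" using nC der_in by blast
  moreover have "\<Gamma>0 \<subseteq> \<Gamma>" using G_sub[of 0] by (simp add: G0)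
  ultimately show ?thesis unfolding L_def by blast
qed

section \<open>The canonical Kripke model\<close>

type_synonym cworld = "var set \<times> fm set"

definition cle :: "fm set \<Rightarrow> cworld \<Rightarrow> cworld \<Rightarrow> bool" where
  "cle T w v \<longleftrightarrow> saturated T (fst w) (snd w) \<and> saturated T (fst v) (snd v) \<and>
    fst w \<subseteq> fst v \<and> snd w \<subseteq> snd v"

definition cmem :: "cworld \<Rightarrow> var \<Rightarrow> var \<Rightarrow> bool" where
  "cmem w a b \<longleftrightarrow> Mem a b \<in> snd w"

definition ceq :: "cworld \<Rightarrow> var \<Rightarrow> var \<Rightarrow> bool" where
  "ceq w a b \<longleftrightarrow> Eq a b \<in> snd w"

lemma saturatedD:
  assumes "saturated T L \<Gamma>"
  shows "infinite (- L)" "L \<noteq> {}" "\<And>A. A \<in> \<Gamma> \<Longrightarrow> FV A \<subseteq> L"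
    "\<And>A. FV A \<subseteq> L \<Longrightarrow> der T \<Gamma> A \<Longrightarrow> A \<in> \<Gamma>" "Bot \<notin> \<Gamma>"
    "\<And>A B. Or A B \<in> \<Gamma> \<Longrightarrow> A \<in> \<Gamma> \<or> B \<in> \<Gamma>"
    "\<And>x A. Ex x A \<in> \<Gamma> \<Longrightarrow> \<exists>d\<in>L. free_for d x A \<and> subst A x d \<in> \<Gamma>"
  using assms unfolding saturated_def by blast+

lemma saturated_mp:
  assumes "saturated T L \<Gamma>" "prv T (Imp A B)" "A \<in> \<Gamma>" "FV B \<subseteq> L"
  shows "B \<in> \<Gamma>"
  using saturatedD(4)[OF assms(1,4) der_prv_mp[OF assms(2) der_in[OF assms(3)]]] .

lemma saturated_Iff:
  assumes "saturated T L \<Gamma>" "prv T (Iff A B)" "FV A \<subseteq> L" "FV B \<subseteq> L"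
  shows "A \<in> \<Gamma> \<longleftrightarrow> B \<in> \<Gamma>"
  using saturated_mp[OF assms(1) prv_IffD1[OF assms(2)]] saturated_mp[OF assms(1) prv_IffD2[OF assms(2)]]
    assms(3,4) by blast

lemma saturated_mp2:
  assumes "saturated T L \<Gamma>" "prv T (Imp A (Imp B C))" "A \<in> \<Gamma>" "B \<in> \<Gamma>" "FV C \<subseteq> L"
  shows "C \<in> \<Gamma>"
  using saturatedD(4)[OF assms(1,5) der_mp[OF der_prv_mp[OF assms(2) der_in[OF assms(3)]] der_in[OF assms(4)]]] .

interpretation C: kripke "cle T" fst cmem ceq "\<lambda>X. X" for T
proof
  fix w v u a b c
  show "cle T w w \<Longrightarrow> a \<in> fst w \<Longrightarrow> ceq w a a"
    unfolding cle_def ceq_def using saturatedD(4)[OF _ _ der_prv[OF ax_refl], of T "fst w" "snd w" a] by simp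
  show "cle T w w \<Longrightarrow> ceq w a b \<Longrightarrow> ceq w a c \<Longrightarrow> ceq w b c"
    unfolding cle_def ceq_def using saturated_mp2[OF _ ax_eq1, of T "fst w" "snd w" a b c] saturatedD(3) by fastforce
  show "cle T w w \<Longrightarrow> ceq w a b \<Longrightarrow> ceq w c a \<Longrightarrow> ceq w c b"
    unfolding cle_def ceq_def using saturated_mp2[OF _ ax_eq2, of T "fst w" "snd w" a b c] saturatedD(3) by fastforce
  show "cle T w w \<Longrightarrow> ceq w a b \<Longrightarrow> cmem w a c \<Longrightarrow> cmem w b c"
    unfolding cle_def ceq_def cmem_def using saturated_mp2[OF _ ax_eq3, of T "fst w" "snd w" a b c] saturatedD(3) by fastforce
  show "cle T w w \<Longrightarrow> ceq w a b \<Longrightarrow> cmem w c a \<Longrightarrow> cmem w c b"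
    unfolding cle_def ceq_def cmem_def using saturated_mp2[OF _ ax_eq4, of T "fst w" "snd w" a b c] saturatedD(3) by fastforce
qed (auto simp: cle_def cmem_def ceq_def)

text \<open>Parameters of the world denote themselves. The default for other variables only keeps
  all values inside the domain, as \<open>env\<close> demands.\<close>

definition canv :: "cworld \<Rightarrow> var \<Rightarrow> var" where
  "canv w x = (if x \<in> fst w then x else (SOME d. d \<in> fst w))"

lemma env_canv: "cle T w w \<Longrightarrow> C.env w (canv w)"
  unfolding C.env_def canv_def cle_def by (metis ex_in_conv saturatedD(2) someI_ex)

lemma sat_canv: "cle T w v \<Longrightarrow> FV A \<subseteq> fst w \<Longrightarrow> C.sat T A v (canv w) = C.sat T A v (canv v)"
  by (rule C.sat_coincidence) (auto simp: canv_def cle_def)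

lemma C_sat_Iff:
  assumes "prv {} (Iff A B)" "cle T w w" "C.env w \<rho>"
  shows "C.sat T A w \<rho> = C.sat T B w \<rho>"
  using C.soundness[OF assms(1), of T] assms(2,3) unfolding C.valid_def C.sat_Iff by blast

lemma sat_instance:
  assumes "cle T w w" "free_for d x A" "d \<in> fst w" "FV A - {x} \<subseteq> fst w"
  shows "C.sat T (subst A x d) w (canv w) = C.sat T A w ((canv w)(x := d))"
  using C.sat_subst[OF assms(2), of T w "canv w"] assms(3) by (simp add: canv_def)

text \<open>The element \<open>d\<close> may be captured by a binder of \<open>A\<close>. Renaming
  by \<open>rename_bound\<close> gives an equivalent formula of equal weight into which
  \<open>d\<close> can be substituted.\<close>

lemma instance_exists:
  assumes "cle T v v" "d \<in> fst v" "FV A - {x} \<subseteq> fst v"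
  obtains B where "weight B = weight A" "FV B \<subseteq> FV A" "FV (subst B x d) \<subseteq> fst v" "free_for d x B"
    "\<And>T. prv T (Iff A B)" "C.sat T (subst B x d) v (canv v) = C.sat T A v ((canv v)(x := d))"
proof -
  obtain B where B: "bv B \<inter> {d} = {}" "FV B \<subseteq> FV A" "weight B = weight A" "\<And>T. prv T (Iff A B)"
    using rename_bound[of "{d}" A] by auto
  have "free_for d x B" using B(1) by (intro free_for_notin_bv) auto
  moreover have "FV (subst B x d) \<subseteq> fst v" using FV_subst[of B x d] B(2) assms(2,3) by auto
  moreover have "C.sat T (subst B x d) v (canv v) = C.sat T B v ((canv v)(x := d))"
    using assms B(2) by (intro sat_instance) (auto simp: calculation)
  moreover have "C.sat T B v ((canv v)(x := d)) = C.sat T A v ((canv v)(x := d))"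
    by (rule C_sat_Iff[OF prv_Iff_sym[OF B(4)] assms(1) C.env_upd[OF env_canv[OF assms(1)] assms(2)]])
  ultimately show thesis using that B by simp
qed

lemma saturated_not_derivable:
  assumes "saturated T L \<Gamma>" "A \<notin> \<Gamma>" "FV A \<subseteq> L"
  shows "\<not> der T \<Gamma> A"
  using assms saturatedD(4) by blast

lemma cle_extend:
  assumes "cle T w w" "\<not> der T (insert A (snd w)) C" "FV A \<union> FV C \<subseteq> L" "fst w \<subseteq> L" "infinite (- L)"
  obtains v where "cle T w v" "L \<subseteq> fst v" "A \<in> snd v" "C \<notin> snd v"
proof -
  have "saturated T (fst w) (snd w)" using assms(1) by (simp add: cle_def)
  then have "\<And>B. B \<in> insert A (snd w) \<Longrightarrow> FV B \<subseteq> L" using saturatedD(3) assms(3,4) by blast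
  then obtain L' \<Gamma>' where "saturated T L' \<Gamma>'" "L \<subseteq> L'" "insert A (snd w) \<subseteq> \<Gamma>'" "C \<notin> \<Gamma>'"
    using saturated_extension[of "insert A (snd w)" L C T] assms by auto
  then show thesis using that[of "(L', \<Gamma>')"] assms(1,4) by (auto simp: cle_def)
qed

section \<open>Truth lemma and completeness\<close>

lemma truth_Imp:
  assumes w: "cle T w w" "FV A \<union> FV B \<subseteq> fst w"
    and A: "\<And>v. cle T w v \<Longrightarrow> C.sat T A v (canv v) \<longleftrightarrow> A \<in> snd v"
    and B: "\<And>v. cle T w v \<Longrightarrow> C.sat T B v (canv v) \<longleftrightarrow> B \<in> snd v"
  shows "C.sat T (Imp A B) w (canv w) \<longleftrightarrow> Imp A B \<in> snd w"
proof
  have eqA: "C.sat T A v (canv w) \<longleftrightarrow> A \<in> snd v" if "cle T w v" for v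
    using sat_canv[OF that, of A] A[OF that] w(2) by simp
  have eqB: "C.sat T B v (canv w) \<longleftrightarrow> B \<in> snd v" if "cle T w v" for v
    using sat_canv[OF that, of B] B[OF that] w(2) by simp
  have sw: "saturated T (fst w) (snd w)" using w(1) by (simp add: cle_def)
  show "Imp A B \<in> snd w" if s: "C.sat T (Imp A B) w (canv w)"
  proof (rule ccontr)
    assume "Imp A B \<notin> snd w"
    then have "\<not> der T (insert A (snd w)) B"
      using saturated_not_derivable[OF sw] w(2) der_imp by (metis FV.simps(6))
    then obtain v where "cle T w v" "A \<in> snd v" "B \<notin> snd v"
      using cle_extend[OF w(1)] w(2) saturatedD(1)[OF sw] by blast
    then show False using s eqA eqB unfolding C.sat.simps by blast
  qed
  show "C.sat T (Imp A B) w (canv w)" if "Imp A B \<in> snd w"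
    unfolding C.sat.simps
  proof (intro HOL.allI impI)
    fix v assume v: "cle T w v" "C.sat T A v (canv w)"
    then have "saturated T (fst v) (snd v)" "Imp A B \<in> snd v" "A \<in> snd v" "FV B \<subseteq> fst v"
      using that w(2) eqA by (auto simp: cle_def)
    then have "B \<in> snd v" using saturated_mp2[OF _ prv_refl] by blast
    then show "C.sat T B v (canv w)" using eqB[OF v(1)] by simp
  qed
qed

lemma truth_All:
  assumes w: "cle T w w" "FV A - {x} \<subseteq> fst w"
    and IH: "\<And>B v. weight B = weight A \<Longrightarrow> cle T v v \<Longrightarrow> FV B \<subseteq> fst v \<Longrightarrow>
      C.sat T B v (canv v) \<longleftrightarrow> B \<in> snd v"
  shows "C.sat T (All x A) w (canv w) \<longleftrightarrow> All x A \<in> snd w"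
proof
  have sw: "saturated T (fst w) (snd w)" using w(1) by (simp add: cle_def)
  have upd: "C.sat T A v ((canv w)(x := d)) = C.sat T A v ((canv v)(x := d))" if "cle T w v" for v d
    using that w(2) by (intro C.sat_coincidence) (auto simp: canv_def cle_def)
  show "All x A \<in> snd w" if s: "C.sat T (All x A) w (canv w)"
  proof (rule ccontr)
    assume n: "All x A \<notin> snd w"
    have "infinite (- fst w - vars A)" using saturatedD(1)[OF sw] by (simp add: Diff_infinite_finite)
    then obtain z where "z \<in> - fst w - vars A" using infinite_imp_nonempty by blast
    then have z: "z \<notin> fst w" "z \<notin> vars A" by auto
    have "z \<notin> FV B" if "B \<in> snd w" for B using saturatedD(3)[OF sw that] z(1) by auto
    then have nd: "\<not> der T (snd w) (subst A x z)"
      using der_all[of T "snd w" A x z] z(2) saturated_not_derivable[OF sw n] w(2) by auto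
    \<comment> \<open>The extension lemma expects a formula to be added; here only the domain has to
      grow by \<open>z\<close>, so a trivial one is supplied.\<close>
    have "\<not> der T (insert (Imp Bot Bot) (snd w)) (subst A x z)"
      using der_cut[OF _ der_prv[OF prv_refl]] nd by blast
    moreover have "infinite (- insert z (fst w))"
      using saturatedD(1)[OF sw] by (simp add: Compl_insert)
    moreover have "FV (Imp Bot Bot) \<union> FV (subst A x z) \<subseteq> insert z (fst w)"
      using FV_subst[of A x z] w(2) by auto
    ultimately obtain v where v: "cle T w v" "insert z (fst w) \<subseteq> fst v" "subst A x z \<notin> snd v"
      using cle_extend[OF w(1)] by (metis subset_insertI)
    have vv: "cle T v v" using v(1) by (simp add: cle_def)
    have "\<not> C.sat T (subst A x z) v (canv v)"
      using IH[of "subst A x z" v] v vv FV_subst[of A x z] w(2) by auto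
    then have "\<not> C.sat T A v ((canv v)(x := z))"
      using sat_instance[OF vv, of z x A] v(1,2) w(2) z(2) by (auto simp: free_for_notin_vars cle_def)
    then show False using s v(1,2) upd[OF v(1), of z] unfolding C.sat.simps by blast
  qed
  show "C.sat T (All x A) w (canv w)" if "All x A \<in> snd w"
    unfolding C.sat.simps
  proof (intro HOL.allI impI ballI)
    fix v d assume v: "cle T w v" "d \<in> fst v"
    then have vv: "cle T v v" and sv: "saturated T (fst v) (snd v)" and m: "All x A \<in> snd v"
      and F: "FV A - {x} \<subseteq> fst v"
      using that w(2) by (auto simp: cle_def)
    obtain B where B: "weight B = weight A" "FV B \<subseteq> FV A" "FV (subst B x d) \<subseteq> fst v" "free_for d x B"
      "\<And>T. prv T (Iff A B)" "C.sat T (subst B x d) v (canv v) = C.sat T A v ((canv v)(x := d))"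
      using instance_exists[OF vv v(2) F] by blast
    have "All x B \<in> snd v"
      using saturated_Iff[OF sv prv_All_cong[OF B(5)]] m F B(2) by auto
    then have "subst B x d \<in> snd v" by (rule saturated_mp[OF sv ax_allE[OF B(4)] _ B(3)])
    then have "C.sat T A v ((canv v)(x := d))" using IH[of "subst B x d" v] B vv by simp
    then show "C.sat T A v ((canv w)(x := d))" using upd[OF v(1)] by simp
  qed
qed

lemma truth_Ex:
  assumes w: "cle T w w" "FV A - {x} \<subseteq> fst w"
    and IH: "\<And>B v. weight B = weight A \<Longrightarrow> cle T v v \<Longrightarrow> FV B \<subseteq> fst v \<Longrightarrow>
      C.sat T B v (canv v) \<longleftrightarrow> B \<in> snd v"
  shows "C.sat T (Ex x A) w (canv w) \<longleftrightarrow> Ex x A \<in> snd w"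
proof
  have sw: "saturated T (fst w) (snd w)" using w(1) by (simp add: cle_def)
  show "Ex x A \<in> snd w" if "C.sat T (Ex x A) w (canv w)"
  proof -
    obtain d where d: "d \<in> fst w" "C.sat T A w ((canv w)(x := d))" using \<open>C.sat T (Ex x A) w (canv w)\<close> by auto
    obtain B where B: "weight B = weight A" "FV B \<subseteq> FV A" "FV (subst B x d) \<subseteq> fst w" "free_for d x B"
      "\<And>T. prv T (Iff A B)" "C.sat T (subst B x d) w (canv w) = C.sat T A w ((canv w)(x := d))"
      using instance_exists[OF w(1) d(1) w(2)] by blast
    have "subst B x d \<in> snd w" using IH[of "subst B x d" w] B w d by simp
    then have "Ex x B \<in> snd w"
      by (rule saturated_mp[OF sw ax_exI[OF B(4)]]) (use B(2) w(2) in auto)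
    then show ?thesis using saturated_Iff[OF sw prv_Ex_cong[OF B(5)]] w(2) B(2) by auto
  qed
  show "C.sat T (Ex x A) w (canv w)" if ex: "Ex x A \<in> snd w"
  proof -
    obtain d where d: "d \<in> fst w" "free_for d x A" "subst A x d \<in> snd w"
      using saturatedD(7)[OF sw ex] by blast
    have "C.sat T (subst A x d) w (canv w)"
      using IH[of "subst A x d" w] w d FV_subst[of A x d] by auto
    then show ?thesis using sat_instance[OF w(1) d(2,1) w(2)] d(1) by auto
  qed
qed

text \<open>Satisfaction respects provable equivalence by soundness, and membership in a saturated
  theory does so by deductive closure. Bounded quantifiers are thereby reduced to their
  unfoldings.\<close>

lemma truth_transfer:
  assumes "cle T w w" "\<And>T. prv T (Iff A B)" "FV A \<subseteq> fst w" "FV B \<subseteq> fst w"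
    "C.sat T B w (canv w) \<longleftrightarrow> B \<in> snd w"
  shows "C.sat T A w (canv w) \<longleftrightarrow> A \<in> snd w"
  using C_sat_Iff[OF assms(2,1) env_canv[OF assms(1)]] saturated_Iff[OF _ assms(2,3,4), of T "snd w"] assms(1,5)
  by (simp add: cle_def)

lemma FV_is_pair_fm: "FV (is_pair_fm p x y u z) \<subseteq> {p, x, y}"
  by (auto simp: is_pair_fm_def sing_fm_def upair_fm_def)

lemma FV_fun_fm: "FV (fun_fm f a b) \<subseteq> {f, a, b}"
  unfolding fun_fm_def Let_def FV.simps
  by (intro Un_least insert_subsetI Diff_subset_conv[THEN iffD2]; (rule subset_trans[OF FV_is_pair_fm])?; auto)

text \<open>Induction on \<open>weight\<close>, because instances, renamed formulas and unfoldings
  of bounded quantifiers are not subformulas.\<close>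

lemma truth:
  "cle T w w \<Longrightarrow> FV A \<subseteq> fst w \<Longrightarrow> C.sat T A w (canv w) \<longleftrightarrow> A \<in> snd w"
proof (induction A arbitrary: w rule: measure_induct_rule[of weight])
  case (less A)
  have w: "cle T w w" by fact
  have sw: "saturated T (fst w) (snd w)" using w by (simp add: cle_def)
  have IH: "C.sat T B v (canv v) \<longleftrightarrow> B \<in> snd v"
    if "weight B < weight A" "cle T v v" "FV B \<subseteq> fst v" for B v
    using less.IH that by blast
  have IH': "C.sat T B v (canv v) \<longleftrightarrow> B \<in> snd v"
    if "weight B < weight A" "cle T w v" "FV B \<subseteq> fst w" for B v
    using that by (intro IH) (auto simp: cle_def)
  show ?case
  proof (cases A)
    case (Mem x y)
    have "C.sat T (Mem x y) w (canv w) = cmem w (canv w x) (canv w y)" by simp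
    then show ?thesis using Mem less.prems unfolding cmem_def canv_def by simp
  next
    case (Eq x y)
    have "C.sat T (Eq x y) w (canv w) = ceq w (canv w x) (canv w y)" by simp
    then show ?thesis using Eq less.prems unfolding ceq_def canv_def by simp
  next
    case Bot then show ?thesis using saturatedD(5)[OF sw] by simp
  next
    case (And B C)
    have "B \<in> snd w \<and> C \<in> snd w \<longleftrightarrow> And B C \<in> snd w"
      using saturated_mp[OF sw ax_conj1, of B C] saturated_mp[OF sw ax_conj2, of B C]
        saturated_mp2[OF sw ax_conjI, of B C] less.prems And by auto
    then show ?thesis using IH[of B w] IH[of C w] And less.prems by simp
  next
    case (Or B C)
    have "B \<in> snd w \<or> C \<in> snd w \<longleftrightarrow> Or B C \<in> snd w"
      using saturated_mp[OF sw ax_disj1, of B C] saturated_mp[OF sw ax_disj2, of C B]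
        saturatedD(6)[OF sw, of B C] less.prems Or by auto
    then show ?thesis using IH[of B w] IH[of C w] Or less.prems by simp
  next
    case (Imp B C)
    then show ?thesis using truth_Imp[OF w, of B C] IH'[of B] IH'[of C] less.prems by auto
  next
    case (All x B)
    then show ?thesis using truth_All[OF w, of B x] IH less.prems by auto
  next
    case (Ex x B)
    then show ?thesis using truth_Ex[OF w, of B x] IH less.prems by auto
  next
    case (BAll x t B)
    obtain z where z: "z \<notin> insert t (vars B)" using fresh_var[of "insert t (vars B)"] by auto
    show ?thesis
      unfolding BAll
      by (rule truth_transfer[OF w prv_BAll_unfold _ _ IH[OF _ w]])
        (use z BAll less.prems FV_subst[of B x z] in auto)
  next
    case (BEx x t B)
    obtain z where z: "z \<notin> insert t (vars B)" using fresh_var[of "insert t (vars B)"] by auto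
    show ?thesis
      unfolding BEx
      by (rule truth_transfer[OF w prv_BEx_unfold _ _ IH[OF _ w]])
        (use z BEx less.prems FV_subst[of B x z] in auto)
  next
    case (EAll x a b B)
    obtain z where z: "z \<notin> {a, b} \<union> vars B" using fresh_var[of "{a, b} \<union> vars B"] by auto
    show ?thesis
      unfolding EAll
      by (rule truth_transfer[OF w prv_EAll_unfold _ _ IH[OF _ w]])
        (use z EAll less.prems FV_subst[of B x z] weight_fun_fm[of z a b] FV_fun_fm[of z a b] in auto)
  next
    case (EEx x a b B)
    obtain z where z: "z \<notin> {a, b} \<union> vars B" using fresh_var[of "{a, b} \<union> vars B"] by auto
    show ?thesis
      unfolding EEx
      by (rule truth_transfer[OF w prv_EEx_unfold _ _ IH[OF _ w]])
        (use z EEx less.prems FV_subst[of B x z] weight_fun_fm[of z a b] FV_fun_fm[of z a b] in auto)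
  qed
qed

text \<open>The truth lemma speaks only of the environment \<open>canv\<close>. For a closed formula
  the environment is irrelevant, and an open theorem is reduced to a closed one by generalising one
  free variable at a time.\<close>

lemma C_valid_prv: "prv T A \<Longrightarrow> C.valid T A"
proof (induction "card (FV A)" arbitrary: A rule: less_induct)
  case less
  show ?case
  proof (cases "FV A = {}")
    case True
    show ?thesis
      unfolding C.valid_def
    proof (intro HOL.allI impI)
      fix w \<rho> assume w: "cle T w w"
      then have "A \<in> snd w"
        using saturatedD(4)[of T "fst w" "snd w" A] der_prv[OF less.prems] True by (simp add: cle_def)
      then show "C.sat T A w \<rho>"
        using truth[OF w, of A] True C.sat_coincidence[of A \<rho> "canv w"] by simp
    qed
  next
    case False
    then obtain x where x: "x \<in> FV A" by blast
    have "finite (FV A)" using finite_subset[OF FV_subset_vars] by simp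
    then have "C.valid T (All x A)"
      using less x prv_gen by (metis FV.simps(7) card_Diff1_less)
    then show ?thesis
      unfolding C.valid_def C.sat.simps
      by (metis C.env_def fun_upd_triv)
  qed
qed

theorem completeness:
  assumes "\<not> prv T A" "FV A = {}"
  obtains w where "cle T w w" "\<not> C.sat T A w (canv w)"
proof -
  have "\<not> der T {} A"
    using assms(1) mp prv_refl unfolding der_def by force
  then obtain L \<Gamma> where "saturated T L \<Gamma>" "A \<notin> \<Gamma>"
    using saturated_extension[of "{}" "{}" A T] assms(2) by auto
  then show thesis using that[of "(L, \<Gamma>)"] truth[of T "(L, \<Gamma>)" A] assms(2) by (simp add: cle_def)
qed

section \<open>Set theory inside a Kripke model\<close>

lemma Delta0E_fun_fm: "Delta0E (fun_fm f a b)"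
  by (simp add: fun_fm_def is_pair_fm_def sing_fm_def upair_fm_def Let_def)

lemma Delta0E_is_pair_fm: "Delta0E (is_pair_fm p x y u z)"
  by (simp add: is_pair_fm_def sing_fm_def upair_fm_def)

text \<open>The coding formulas will occupy an initial segment of the variables; parameters have to
  be taken above it.\<close>

lemma fresh_above: "\<exists>z::nat. z \<ge> n \<and> z \<notin> vars A \<and> z \<notin> set xs"
proof -
  have "infinite ({n..} - (vars A \<union> set xs))"
    by (rule Diff_infinite_finite) (auto simp: infinite_Ici)
  then obtain z where "z \<in> {n..} - (vars A \<union> set xs)" using infinite_imp_nonempty by blast
  then show ?thesis by auto
qed

locale ikpe_model = kripke le D mem eq "\<lambda>X. X"
  for le :: "'w \<Rightarrow> 'w \<Rightarrow> bool" and D :: "'w \<Rightarrow> 'd set" and mem eq :: "'w \<Rightarrow> 'd \<Rightarrow> 'd \<Rightarrow> bool" +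
  assumes IKPE_valid: "A \<in> IKPE \<Longrightarrow> valid A"
begin

section \<open>Semantic forms of the axioms\<close>

lemma IKPE_sat: "A \<in> IKPE \<Longrightarrow> le w w \<Longrightarrow> env w \<rho> \<Longrightarrow> sat A w \<rho>"
  using IKPE_valid unfolding valid_def by blast

lemma env_const: "d \<in> D w \<Longrightarrow> env w (\<lambda>_. d)"
  by (simp add: env_def)

lemma pairing:
  assumes "le w w" "a \<in> D w" "b \<in> D w"
  shows "\<exists>c\<in>D w. mem w a c \<and> mem w b c"
proof -
  have "Ex 2 (And (Mem 0 2) (Mem 1 2)) \<in> IKPE" by (rule IKPE.pair) auto
  from IKPE_sat[OF this assms(1), of "(\<lambda>_. a)(1 := b)"] assms
  show ?thesis by (auto simp: env_const)
qed

lemma union_superset: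
  assumes "le w w" "a \<in> D w"
  shows "\<exists>c\<in>D w. \<forall>v. le w v \<longrightarrow> (\<forall>x\<in>D v. \<forall>y\<in>D v. mem v x y \<longrightarrow> mem v y a \<longrightarrow> mem v x c)"
proof -
  have "Ex 3 (BAll 1 0 (BAll 2 1 (Mem 2 3))) \<in> IKPE" by (rule IKPE.union) auto
  from IKPE_sat[OF this assms(1), of "\<lambda>_. a"] assms
  show ?thesis by (auto simp: env_const) (meson le_right)
qed

lemma separation:
  assumes "le w w" "a \<in> D w" "Delta0E A" "env w \<rho>"
  shows "\<exists>c\<in>D w. \<forall>v. le w v \<longrightarrow> (\<forall>e\<in>D v. mem v e c \<longleftrightarrow> mem v e a \<and> sat A v (\<rho>(x := e)))"
proof -
  obtain a' where a': "a' \<notin> insert x (vars A)" using fresh_var[of "insert x (vars A)"] by auto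
  obtain z where z: "z \<notin> {a', x} \<union> vars A" using fresh_var[of "{a', x} \<union> vars A"] by auto
  have "Ex z (And (BAll x z (And (Mem x a') A)) (BAll x a' (Imp A (Mem x z)))) \<in> IKPE"
    by (rule IKPE.separation) (use assms(3) a' z FV_subset_vars in auto)
  from IKPE_sat[OF this assms(1), of "\<rho>(a' := a)"]
  obtain c where c: "c \<in> D w" "sat (And (BAll x z (And (Mem x a') A)) (BAll x a' (Imp A (Mem x z)))) w (\<rho>(a' := a, z := c))"
    using assms by auto
  have "sat A v (\<rho>(a' := a, z := c, x := e)) = sat A v (\<rho>(x := e))" for v e
    using a' z FV_subset_vars by (intro sat_coincidence) auto
  then show ?thesis using c a' z le_right by (intro bexI[of _ c]) (auto simp: fun_upd_twist)
qed

lemma collection: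
  assumes "le w w" "a \<in> D w" "Delta0E A" "env w \<rho>" "x \<noteq> y"
    "\<And>v d. le w v \<Longrightarrow> d \<in> D v \<Longrightarrow> mem v d a \<Longrightarrow> \<exists>e\<in>D v. sat A v (\<rho>(x := d, y := e))"
  shows "\<exists>c\<in>D w. \<forall>v. le w v \<longrightarrow> (\<forall>d\<in>D v. mem v d a \<longrightarrow> (\<exists>e\<in>D v. mem v e c \<and> sat A v (\<rho>(x := d, y := e))))"
proof -
  obtain a' where a': "a' \<notin> {x, y} \<union> vars A" using fresh_var[of "{x, y} \<union> vars A"] by auto
  obtain z where z: "z \<notin> {a', x, y} \<union> vars A" using fresh_var[of "{a', x, y} \<union> vars A"] by auto
  have ax: "Imp (BAll x a' (Ex y A)) (Ex z (BAll x a' (BEx y z A))) \<in> IKPE"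
    by (rule IKPE.collection) (use assms(3,5) a' z FV_subset_vars in auto)
  have 1: "sat A v (\<rho>(a' := a, x := d, y := e)) = sat A v (\<rho>(x := d, y := e))" for v d e
    using a' z FV_subset_vars by (intro sat_coincidence) auto
  have 2: "sat A v (\<rho>(a' := a, z := c, x := d, y := e)) = sat A v (\<rho>(x := d, y := e))" for v c d e
    using a' z FV_subset_vars by (intro sat_coincidence) auto
  have "sat (BAll x a' (Ex y A)) w (\<rho>(a' := a))"
    using assms(6) a' by (auto simp: 1)
  then have "sat (Ex z (BAll x a' (BEx y z A))) w (\<rho>(a' := a))"
    using IKPE_sat[OF ax assms(1), of "\<rho>(a' := a)"] assms(1,2,4) by (simp del: sat.simps(7-))
  then show ?thesis using a' z assms(5) by (auto simp: 2)
qed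

lemma set_induction:
  assumes "le w w" "env w \<rho>"
    "\<And>v d. le w v \<Longrightarrow> d \<in> D v \<Longrightarrow> (\<And>u e. le v u \<Longrightarrow> e \<in> D u \<Longrightarrow> mem u e d \<Longrightarrow> sat A u (\<rho>(x := e)))
      \<Longrightarrow> sat A v (\<rho>(x := d))"
    "le w v" "d \<in> D v"
  shows "sat A v (\<rho>(x := d))"
proof -
  obtain y where y: "y \<notin> insert x (vars A)" using fresh_var[of "insert x (vars A)"] by auto
  have ff: "free_for y x A" using y by (simp add: free_for_notin_vars)
  have ax: "Imp (All x (Imp (BAll y x (subst A x y)) A)) (All x A) \<in> IKPE"
    by (rule IKPE.set_induction) (use y FV_subset_vars ff in auto)
  have sub: "sat (subst A x y) v (\<rho>(x := d, y := e)) = sat A v (\<rho>(x := e))" for v d e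
    using y FV_subset_vars[of A] by (auto simp: sat_subst[OF ff] intro!: sat_coincidence)
  have "sat (Imp (BAll y x (subst A x y)) A) v (\<rho>(x := d))" if v: "le w v" "d \<in> D v" for v d
    unfolding sat.simps
  proof (intro HOL.allI impI)
    fix u assume u: "le v u" "\<forall>va. le u va \<longrightarrow> (\<forall>e\<in>D va. mem va e ((\<rho>(x := d)) x) \<longrightarrow> sat (subst A x y) va (\<rho>(x := d, y := e)))"
    show "sat A u (\<rho>(x := d))"
    proof (rule assms(3))
      show "le w u" "d \<in> D u" using u(1) v le_trans D_mono by blast+
      show "sat A t (\<rho>(x := e))" if "le u t" "e \<in> D t" "mem t e d" for t e
        using u that sub[of t d e] by simp
    qed
  qed
  then have "sat (All x (Imp (BAll y x (subst A x y)) A)) w \<rho>" by simp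
  then have "sat (All x A) w \<rho>"
    using IKPE_sat[OF ax assms(1,2)] assms(1) unfolding sat.simps(6) by blast
  then show ?thesis using assms(4,5) by simp
qed

text \<open>Exponentiation gives a superset, from which the Delta_0 formula \<open>fun_fm\<close>
  separates the functions. Quantifiers over functions thus become quantifiers over members of a set,
  to which collection applies.\<close>

lemma function_set:
  assumes "le w w" "a \<in> D w" "b \<in> D w"
  shows "\<exists>c\<in>D w. \<forall>v. le w v \<longrightarrow> (\<forall>f\<in>D v. mem v f c \<longleftrightarrow> is_fun v f a b)"
proof -
  have ax: "Ex 3 (EAll 0 1 2 (Mem 0 3)) \<in> IKPE" by (rule IKPE.exponentiation) auto
  have "env w ((\<lambda>_. a)(2 := b))" using assms by (simp add: env_const)
  from IKPE_sat[OF ax assms(1) this] obtain c where c: "c \<in> D w"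
    "\<And>v f. le w v \<Longrightarrow> f \<in> D v \<Longrightarrow> is_fun v f a b \<Longrightarrow> mem v f c" by auto
  have "env w ((\<lambda>_. a)(2 := b))" using assms by (simp add: env_const)
  from separation[OF assms(1) c(1) Delta0E_fun_fm[of 0 1 2] this, of 0]
  show ?thesis using c by (simp add: sat_fun_fm) blast
qed

section \<open>Inclusion, elementary sets and truth values\<close>

definition sub :: "'w \<Rightarrow> 'd \<Rightarrow> 'd \<Rightarrow> bool" where
  "sub w a b \<longleftrightarrow> (\<forall>v. le w v \<longrightarrow> (\<forall>x\<in>D v. mem v x a \<longrightarrow> mem v x b))"

text \<open>Sets serve as truth values: the proposition coded by \<open>s\<close> is that
  \<open>s\<close> has an element.\<close>

definition inh :: "'w \<Rightarrow> 'd \<Rightarrow> bool" where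
  "inh w s \<longleftrightarrow> (\<exists>x\<in>D w. mem w x s)"

lemma sub_mono: "le w v \<Longrightarrow> sub w a b \<Longrightarrow> sub v a b"
  unfolding sub_def using le_trans by blast

lemma sub_refl: "sub w a a"
  by (simp add: sub_def)

lemma subD: "sub w a b \<Longrightarrow> le w v \<Longrightarrow> x \<in> D v \<Longrightarrow> mem v x a \<Longrightarrow> mem v x b"
  by (simp add: sub_def)

lemma inh_mono: "le w v \<Longrightarrow> inh w s \<Longrightarrow> inh v s"
  unfolding inh_def using D_mono mem_mono by blast

lemma eq_trans: "le w w \<Longrightarrow> eq w a b \<Longrightarrow> eq w b c \<Longrightarrow> eq w a c"
  using eq_eq2 by blast

lemma empty_set:
  assumes "le w w" "d \<in> D w"
  shows "\<exists>c\<in>D w. \<forall>v. le w v \<longrightarrow> \<not> inh v c"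
  using separation[OF assms, of Bot "\<lambda>_. d"] assms by (auto simp: env_const inh_def)

lemma upair_set:
  assumes "le w w" "a \<in> D w" "b \<in> D w"
  shows "\<exists>c\<in>D w. \<forall>v. le w v \<longrightarrow> (\<forall>e\<in>D v. mem v e c \<longleftrightarrow> eq v e a \<or> eq v e b)"
proof -
  obtain c where c: "c \<in> D w" "mem w a c" "mem w b c" using pairing[OF assms] by blast
  have "env w ((\<lambda>_. a)(2 := b))" using assms by (simp add: env_const)
  from separation[OF assms(1) c(1) _ this, of "Or (Eq 0 1) (Eq 0 2)" 0]
  obtain z where z: "z \<in> D w" "\<And>v e. le w v \<Longrightarrow> e \<in> D v \<Longrightarrow> mem v e z \<longleftrightarrow> mem v e c \<and> (eq v e a \<or> eq v e b)"
    by auto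
  have "mem v e c" if "le w v" "e \<in> D v" "eq v e a \<or> eq v e b" for v e
    using that c mem_mono eq_sym eq_mem1 D_mono assms le_right by meson
  then show ?thesis using z by blast
qed

lemma union2_set:
  assumes "le w w" "a \<in> D w" "b \<in> D w"
  shows "\<exists>c\<in>D w. \<forall>v. le w v \<longrightarrow> (\<forall>e\<in>D v. mem v e c \<longleftrightarrow> mem v e a \<or> mem v e b)"
proof -
  obtain p where p: "p \<in> D w" "mem w a p" "mem w b p" using pairing[OF assms] by blast
  obtain c where c: "c \<in> D w"
    "\<And>v x y. le w v \<Longrightarrow> x \<in> D v \<Longrightarrow> y \<in> D v \<Longrightarrow> mem v x y \<Longrightarrow> mem v y p \<Longrightarrow> mem v x c"
    using union_superset[OF assms(1) p(1)] by blast
  have "env w ((\<lambda>_. a)(2 := b))" using assms by (simp add: env_const)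
  from separation[OF assms(1) c(1) _ this, of "Or (Mem 0 1) (Mem 0 2)" 0]
  obtain z where z: "z \<in> D w" "\<And>v e. le w v \<Longrightarrow> e \<in> D v \<Longrightarrow> mem v e z \<longleftrightarrow> mem v e c \<and> (mem v e a \<or> mem v e b)"
    by auto
  have "mem v e c" if "le w v" "e \<in> D v" "mem v e a \<or> mem v e b" for v e
    using that c(2) p mem_mono D_mono assms by meson
  then show ?thesis using z by blast
qed

lemma upper_bound2:
  assumes "le w w" "a \<in> D w" "b \<in> D w"
  obtains c where "c \<in> D w" "sub w a c" "sub w b c"
  using union2_set[OF assms] unfolding sub_def by blast

lemma adjoin:
  assumes "le w w" "a \<in> D w" "b \<in> D w"
  obtains c where "c \<in> D w" "sub w a c" "mem w b c"
proof -
  obtain s where s: "s \<in> D w" "mem w b s" using pairing[OF assms(1,3,3)] by blast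
  obtain c where c: "c \<in> D w" "sub w a c" "sub w s c" using upper_bound2[OF assms(1,2) s(1)] by blast
  have "mem w b c" using subD[OF c(3) assms(1,3) s(2)] .
  then show thesis using that c by blast
qed

text \<open>Separate from an inhabited set by a formula in which the separating variable does not
  occur: an element remains exactly where \<open>A\<close> holds.\<close>

lemma truth_value_set:
  assumes "le w w" "Delta0E A" "env w \<rho>"
  shows "\<exists>s\<in>D w. \<forall>v. le w v \<longrightarrow> (inh v s \<longleftrightarrow> sat A v \<rho>)"
proof -
  obtain x where x: "x \<notin> vars A" using fresh_var[of "vars A"] by auto
  define d where "d = \<rho> 0"
  have d: "d \<in> D w" using assms(3) by (simp add: d_def env_D)
  obtain c where c: "c \<in> D w" "mem w d c" using pairing[OF assms(1) d d] by blast
  obtain s where s: "s \<in> D w" "\<And>v e. le w v \<Longrightarrow> e \<in> D v \<Longrightarrow> mem v e s \<longleftrightarrow> mem v e c \<and> sat A v (\<rho>(x := e))"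
    using separation[OF assms(1) c(1) assms(2,3)] by blast
  have "sat A v (\<rho>(x := e)) = sat A v \<rho>" for v e
    using x FV_subset_vars by (intro sat_coincidence) auto
  then show ?thesis
    using s c d D_mono mem_mono unfolding inh_def by (intro bexI[of _ s]) (blast, blast)
qed

text \<open>Codes determine their components only up to \<open>eq\<close>, so truth must not
  distinguish equal parameters. The induction is on \<open>weight\<close> because bounded
  quantifiers are unfolded.\<close>

lemma sat_cong:
  assumes "le w w" "env w \<rho>" "env w \<sigma>" "\<And>x. x \<in> FV A \<Longrightarrow> eq w (\<rho> x) (\<sigma> x)"
  shows "sat A w \<rho> \<longleftrightarrow> sat A w \<sigma>"
  using assms
proof (induction A arbitrary: w \<rho> \<sigma> rule: measure_induct_rule[of weight])
  case (less A)
  have IH: "sat B v \<rho> \<longleftrightarrow> sat B v \<sigma>"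
    if "weight B < weight A" "FV B \<subseteq> FV A" "le w v" for B v
    using that less.prems by (intro less.IH) (auto intro: env_mono eq_mono le_right)
  have IHx: "sat B v (\<rho>(x := d)) \<longleftrightarrow> sat B v (\<sigma>(x := d))"
    if "weight B < weight A" "FV B - {x} \<subseteq> FV A" "le w v" "d \<in> D v" for B v x d
  proof (rule less.IH[OF that(1) le_right[OF that(3)]])
    show "env v (\<rho>(x := d))" "env v (\<sigma>(x := d))"
      using env_upd[OF env_mono[OF that(3)] that(4)] less.prems by blast+
    show "eq v ((\<rho>(x := d)) y) ((\<sigma>(x := d)) y)" if "y \<in> FV B" for y
      using \<open>y \<in> FV B\<close> \<open>FV B - {x} \<subseteq> FV A\<close> \<open>le w v\<close> \<open>d \<in> D v\<close> less.prems(4) eq_mono eq_refl le_right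
      by auto
  qed
  have unf: "sat A w \<rho> \<longleftrightarrow> sat A w \<sigma>"
    if "prv {} (Iff A B)" "weight B < weight A" "FV B \<subseteq> FV A" for B
    using soundness[OF that(1)] less.prems(1-3) IH[OF that(2,3) less.prems(1)]
    by (simp add: valid_def sat_Iff)
  show ?case
  proof (cases A)
    case (Mem x y)
    have e: "eq w (\<rho> x) (\<sigma> x)" "eq w (\<rho> y) (\<sigma> y)" "eq w (\<sigma> x) (\<rho> x)" "eq w (\<sigma> y) (\<rho> y)"
      using less.prems Mem eq_sym env_D by simp_all
    show ?thesis using eq_mem1 eq_mem2 e less.prems(1) unfolding Mem sat.simps by blast
  next
    case (Eq x y)
    have e: "eq w (\<rho> x) (\<sigma> x)" "eq w (\<rho> y) (\<sigma> y)" "eq w (\<sigma> x) (\<rho> x)" "eq w (\<sigma> y) (\<rho> y)"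
      using less.prems Eq eq_sym env_D by simp_all
    show ?thesis using eq_trans e less.prems(1) unfolding Eq sat.simps by blast
  next
    case (And B C) then show ?thesis using IH[of B] IH[of C] less.prems(1) by simp
  next
    case (Or B C) then show ?thesis using IH[of B] IH[of C] less.prems(1) by simp
  next
    case (Imp B C) then show ?thesis using IH[of B] IH[of C] by simp
  next
    case (All x B) then show ?thesis using IHx[of B x] by simp
  next
    case (Ex x B) then show ?thesis using IHx[of B x] less.prems(1) by simp
  next
    case (BAll x t B)
    obtain z where z: "z \<notin> insert t (vars B)" using fresh_var[of "insert t (vars B)"] by auto
    show ?thesis
      by (rule unf[OF prv_BAll_unfold[of z t B _ x, folded BAll]])
        (use z BAll FV_subst[of B x z] in auto)
  next
    case (BEx x t B)
    obtain z where z: "z \<notin> insert t (vars B)" using fresh_var[of "insert t (vars B)"] by auto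
    show ?thesis
      by (rule unf[OF prv_BEx_unfold[of z t B _ x, folded BEx]])
        (use z BEx FV_subst[of B x z] in auto)
  next
    case (EAll x a b B)
    obtain z where z: "z \<notin> {a, b} \<union> vars B" using fresh_var[of "{a, b} \<union> vars B"] by auto
    show ?thesis
      by (rule unf[OF prv_EAll_unfold[of z a b B _ x, folded EAll]])
        (use z EAll FV_subst[of B x z] weight_fun_fm[of z a b] FV_fun_fm[of z a b] in auto)
  next
    case (EEx x a b B)
    obtain z where z: "z \<notin> {a, b} \<union> vars B" using fresh_var[of "{a, b} \<union> vars B"] by auto
    show ?thesis
      by (rule unf[OF prv_EEx_unfold[of z a b B _ x, folded EEx]])
        (use z EEx FV_subst[of B x z] weight_fun_fm[of z a b] FV_fun_fm[of z a b] in auto)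
  qed simp
qed

section \<open>Kuratowski pairs\<close>

lemma is_pair_iff:
  "is_pair w p x y \<longleftrightarrow>
    (\<exists>u\<in>D w. mem w u p \<and> is_sing w u x) \<and> (\<exists>u\<in>D w. mem w u p \<and> is_upair w u x y) \<and>
    (\<forall>v. le w v \<longrightarrow> (\<forall>u\<in>D v. mem v u p \<longrightarrow> is_sing v u x \<or> is_upair v u x y))"
  by (simp add: is_pair_def)

lemma is_singD: "is_sing w u x \<Longrightarrow> mem w x u"
  "is_sing w u x \<Longrightarrow> le w w \<Longrightarrow> z \<in> D w \<Longrightarrow> mem w z u \<Longrightarrow> eq w z x"
  by (auto simp: is_sing_def)

lemma is_upairD: "is_upair w u x y \<Longrightarrow> mem w x u" "is_upair w u x y \<Longrightarrow> mem w y u"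
  "is_upair w u x y \<Longrightarrow> le w w \<Longrightarrow> z \<in> D w \<Longrightarrow> mem w z u \<Longrightarrow> eq w z x \<or> eq w z y"
  by (auto simp: is_upair_def)

lemma ordered_pair:
  assumes "le w w" "x \<in> D w" "y \<in> D w"
  shows "\<exists>p\<in>D w. is_pair w p x y"
proof -
  obtain s where s: "s \<in> D w" "\<And>v e. le w v \<Longrightarrow> e \<in> D v \<Longrightarrow> mem v e s \<longleftrightarrow> eq v e x \<or> eq v e x"
    using upair_set[OF assms(1,2,2)] by blast
  obtain t where t: "t \<in> D w" "\<And>v e. le w v \<Longrightarrow> e \<in> D v \<Longrightarrow> mem v e t \<longleftrightarrow> eq v e x \<or> eq v e y"
    using upair_set[OF assms] by blast
  obtain p where p: "p \<in> D w" "\<And>v e. le w v \<Longrightarrow> e \<in> D v \<Longrightarrow> mem v e p \<longleftrightarrow> eq v e s \<or> eq v e t"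
    using upair_set[OF assms(1) s(1) t(1)] by blast
  have up: "is_sing v u x" if "le w v" "u \<in> D v" "eq v u s" for u v
    unfolding is_sing_def
  proof (intro conjI HOL.allI ballI impI)
    have v: "le v v" "s \<in> D v" "x \<in> D v" using that le_right D_mono s assms by blast+
    have "mem v x s" using s(2)[OF that(1) v(3)] eq_refl v by blast
    then show "mem v x u" using eq_mem2[OF v(1) eq_sym[OF v(1) that(2,3)]] by blast
    fix v' z assume h: "le v v'" "z \<in> D v'" "mem v' z u"
    have "mem v' z s" using eq_mem2[OF le_right[OF h(1)] eq_mono[OF h(1) that(3)] h(3)] .
    then show "eq v' z x" using s(2) h that(1) le_trans by blast
  qed
  have ut: "is_upair v u x y" if "le w v" "u \<in> D v" "eq v u t" for u v
    unfolding is_upair_def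
  proof (intro conjI HOL.allI ballI impI)
    have v: "le v v" "t \<in> D v" "x \<in> D v" "y \<in> D v" using that le_right D_mono t assms by blast+
    have "mem v x t" "mem v y t" using t(2)[OF that(1) v(3)] t(2)[OF that(1) v(4)] eq_refl v by blast+
    then show "mem v x u" "mem v y u" using eq_mem2[OF v(1) eq_sym[OF v(1) that(2,3)]] by blast+
    fix v' z assume h: "le v v'" "z \<in> D v'" "mem v' z u"
    have "mem v' z t" using eq_mem2[OF le_right[OF h(1)] eq_mono[OF h(1) that(3)] h(3)] .
    then show "eq v' z x \<or> eq v' z y" using t(2) h that(1) le_trans by blast
  qed
  have "is_pair w p x y"
    unfolding is_pair_iff
  proof (intro conjI HOL.allI ballI impI)
    show "\<exists>u\<in>D w. mem w u p \<and> is_sing w u x"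
      using s(1) p(2)[OF assms(1) s(1)] up[OF assms(1) s(1)] eq_refl[OF assms(1) s(1)] by blast
    show "\<exists>u\<in>D w. mem w u p \<and> is_upair w u x y"
      using t(1) p(2)[OF assms(1) t(1)] ut[OF assms(1) t(1)] eq_refl[OF assms(1) t(1)] by blast
    fix v u assume "le w v" "u \<in> D v" "mem v u p"
    then show "is_sing v u x \<or> is_upair v u x y" using p(2) up ut by blast
  qed
  then show ?thesis using p(1) by blast
qed

text \<open>Every element of \<open>p'\<close> contains \<open>x'\<close>, hence so does the
  singleton of \<open>x\<close>, which gives the first equation. For the second, \<open>y\<close>
  equals \<open>x'\<close> or \<open>y'\<close> and \<open>y'\<close> equals \<open>x\<close> or
  \<open>y\<close>; each combination yields the claim.\<close>

lemma is_pair_inj: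
  assumes w: "le w w" and D: "x \<in> D w" "y \<in> D w" "x' \<in> D w" "y' \<in> D w" "p \<in> D w" "p' \<in> D w"
    and p: "is_pair w p x y" and p': "is_pair w p' x' y'" and e: "eq w p p'"
  shows "eq w x x'" "eq w y y'"
proof -
  have sym: "eq w a b \<Longrightarrow> a \<in> D w \<Longrightarrow> eq w b a" for a b using eq_sym[OF w] by blast
  have tr: "eq w a b \<Longrightarrow> eq w b c \<Longrightarrow> eq w a c" for a b c using eq_trans[OF w] by blast
  have pp: "mem w u p' \<Longrightarrow> mem w u p" for u using eq_mem2[OF w sym[OF e D(5)]] by blast
  have pp': "mem w u p \<Longrightarrow> mem w u p'" for u using eq_mem2[OF w e] by blast
  have c: "is_sing w u x \<or> is_upair w u x y" if "u \<in> D w" "mem w u p" for u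
    using p that w unfolding is_pair_iff by blast
  have c': "is_sing w u x' \<or> is_upair w u x' y'" if "u \<in> D w" "mem w u p'" for u
    using p' that w unfolding is_pair_iff by blast
  obtain s where s: "s \<in> D w" "mem w s p" "is_sing w s x" using p unfolding is_pair_iff by blast
  obtain t where t: "t \<in> D w" "mem w t p" "is_upair w t x y" using p unfolding is_pair_iff by blast
  obtain t' where t': "t' \<in> D w" "mem w t' p'" "is_upair w t' x' y'" using p' unfolding is_pair_iff by blast
  have "mem w x' s" using c'[OF s(1) pp'[OF s(2)]] is_singD(1) is_upairD(1) by blast
  then have "eq w x' x" using is_singD(2)[OF s(3) w D(3)] by blast
  then show xx: "eq w x x'" using sym D by blast
  have "eq w y x' \<or> eq w y y'"
    using c'[OF t(1) pp'[OF t(2)]] is_upairD(2)[OF t(3)] is_singD(2)[OF _ w D(2)] is_upairD(3)[OF _ w D(2)] by blast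
  moreover have "eq w y' x \<or> eq w y' y"
    using c[OF t'(1) pp[OF t'(2)]] is_upairD(2)[OF t'(3)] is_singD(2)[OF _ w D(4)] is_upairD(3)[OF _ w D(4)] by blast
  ultimately show "eq w y y'"
    using xx sym tr D by metis
qed

end

section \<open>Relativised truth and coding of formulas with parameters\<close>

lemma FV_rel: "FV (rel Y A) \<subseteq> insert Y (vars A)"
  by (induction A) auto

lemma Delta0E_rel: "Delta0E (rel Y A)"
  by (induction A) auto

text \<open>Decoding quantifies over whole assignments. Restricting their values to the bound
  \<open>Y\<close> keeps the decoding formulas in Delta_0.\<close>

primrec BAlls :: "nat \<Rightarrow> var \<Rightarrow> fm \<Rightarrow> fm" where
  "BAlls 0 Y A = A"
| "BAlls (Suc n) Y A = BAll n Y (BAlls n Y A)"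

primrec BExs :: "nat \<Rightarrow> var \<Rightarrow> fm \<Rightarrow> fm" where
  "BExs 0 Y A = A"
| "BExs (Suc n) Y A = BEx n Y (BExs n Y A)"

text \<open>Right-nested tuples. For \<open>j = m\<close> the last tail sits at the variable
  \<open>2 * m\<close> and is arbitrary; the two variables after it are bound inside the pair
  formulas.\<close>

primrec tuple_fm :: "nat \<Rightarrow> nat \<Rightarrow> fm" where
  "tuple_fm m 0 = Imp Bot Bot"
| "tuple_fm m (Suc j) = And (is_pair_fm (m + j) j (m + Suc j) (2 * m + 1) (2 * m + 2)) (tuple_fm m j)"

definition inh_fm :: "var \<Rightarrow> var \<Rightarrow> fm" where
  "inh_fm u s = BEx u s (Imp Bot Bot)"

text \<open>The variables from \<open>n\<close> on are selectors: truth values telling which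
  formulas of the list are meant. A formula that is not Pi contributes a trivial conjunct, so the
  same list can serve conditions and goals.\<close>

primrec cond_fm :: "var \<Rightarrow> var \<Rightarrow> nat \<Rightarrow> fm list \<Rightarrow> fm" where
  "cond_fm Y u n [] = Imp Bot Bot"
| "cond_fm Y u n (F # Fs) =
    And (if PiE F then Imp (inh_fm u n) (rel Y F) else Imp Bot Bot) (cond_fm Y u (Suc n) Fs)"

primrec goal_fm :: "var \<Rightarrow> var \<Rightarrow> nat \<Rightarrow> fm list \<Rightarrow> fm" where
  "goal_fm Y u n [] = Bot"
| "goal_fm Y u n (F # Fs) =
    Or (if SigmaE F then And (inh_fm u n) (rel Y F) else Bot) (goal_fm Y u (Suc n) Fs)"

lemma Delta0E_BAlls [simp]: "Delta0E (BAlls n Y A) = Delta0E A"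
  by (induction n) auto

lemma Delta0E_BExs [simp]: "Delta0E (BExs n Y A) = Delta0E A"
  by (induction n) auto

lemma Delta0E_tuple_fm [simp]: "Delta0E (tuple_fm m j)"
  by (induction j) (auto simp: Delta0E_is_pair_fm)

lemma Delta0E_cond_fm [simp]: "Delta0E (cond_fm Y u n Fs)"
  by (induction Fs arbitrary: n) (auto simp: Delta0E_rel inh_fm_def)

lemma Delta0E_goal_fm [simp]: "Delta0E (goal_fm Y u n Fs)"
  by (induction Fs arbitrary: n) (auto simp: Delta0E_rel inh_fm_def)

section \<open>Satisfaction relativised to a set\<close>

context ikpe_model begin

text \<open>The meaning of \<open>rel\<close> with the bound given as an element instead of a
  variable, which spares later arguments the choice of a fresh name.\<close>

primrec rsat :: "fm \<Rightarrow> 'w \<Rightarrow> (var \<Rightarrow> 'd) \<Rightarrow> 'd \<Rightarrow> bool" where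
  "rsat (Mem x y) w \<rho> z = mem w (\<rho> x) (\<rho> y)"
| "rsat (Eq x y) w \<rho> z = eq w (\<rho> x) (\<rho> y)"
| "rsat Bot w \<rho> z = False"
| "rsat (And A B) w \<rho> z = (rsat A w \<rho> z \<and> rsat B w \<rho> z)"
| "rsat (Or A B) w \<rho> z = (rsat A w \<rho> z \<or> rsat B w \<rho> z)"
| "rsat (Imp A B) w \<rho> z = (\<forall>v. le w v \<longrightarrow> rsat A v \<rho> z \<longrightarrow> rsat B v \<rho> z)"
| "rsat (All x A) w \<rho> z = (\<forall>v. le w v \<longrightarrow> (\<forall>d\<in>D v. mem v d z \<longrightarrow> rsat A v (\<rho>(x := d)) z))"
| "rsat (Ex x A) w \<rho> z = (\<exists>d\<in>D w. mem w d z \<and> rsat A w (\<rho>(x := d)) z)"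
| "rsat (BAll x t A) w \<rho> z =
    (\<forall>v. le w v \<longrightarrow> (\<forall>d\<in>D v. mem v d (\<rho> t) \<longrightarrow> rsat A v (\<rho>(x := d)) z))"
| "rsat (BEx x t A) w \<rho> z = (\<exists>d\<in>D w. mem w d (\<rho> t) \<and> rsat A w (\<rho>(x := d)) z)"
| "rsat (EAll x a b A) w \<rho> z =
    (\<forall>v. le w v \<longrightarrow> (\<forall>d\<in>D v. is_fun v d (\<rho> a) (\<rho> b) \<longrightarrow> rsat A v (\<rho>(x := d)) z))"
| "rsat (EEx x a b A) w \<rho> z = (\<exists>d\<in>D w. is_fun w d (\<rho> a) (\<rho> b) \<and> rsat A w (\<rho>(x := d)) z)"

lemma sat_rel: "Y \<notin> vars A \<Longrightarrow> sat (rel Y A) w \<rho> = rsat A w \<rho> (\<rho> Y)"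
  by (induction A arbitrary: w \<rho>) simp_all

lemma rsat_eq_sat_rel: "Y \<notin> vars A \<Longrightarrow> rsat A w \<rho> z = sat (rel Y A) w (\<rho>(Y := z))"
proof -
  assume Y: "Y \<notin> vars A"
  have "sat (rel Y A) w (\<rho>(Y := z)) = rsat A w (\<rho>(Y := z)) z" using sat_rel[OF Y] by simp
  moreover have "rsat A w (\<rho>(Y := z)) z = rsat A w \<rho> z"
    using Y by (induction A arbitrary: w \<rho>) (simp_all add: fun_upd_twist)
  ultimately show ?thesis by simp
qed

lemma rsat_mono:
  assumes "le w v" "rsat A w \<rho> z"
  shows "rsat A v \<rho> z"
proof -
  obtain Y where "Y \<notin> vars A" using fresh_var[OF finite_vars] by blast
  then show ?thesis using assms sat_mono by (simp add: rsat_eq_sat_rel)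
qed

lemma rsat_coincidence:
  assumes "\<And>x. x \<in> vars A \<Longrightarrow> \<rho> x = \<sigma> x"
  shows "rsat A w \<rho> z = rsat A w \<sigma> z"
proof -
  obtain Y where Y: "Y \<notin> vars A" using fresh_var[OF finite_vars] by blast
  have "sat (rel Y A) w (\<rho>(Y := z)) = sat (rel Y A) w (\<sigma>(Y := z))"
    by (rule sat_coincidence) (use FV_rel[of Y A] assms in auto)
  then show ?thesis using Y by (simp add: rsat_eq_sat_rel)
qed

lemma rsat_cong:
  assumes "le w w" "env w \<rho>" "env w \<sigma>" "z \<in> D w" "\<And>x. x \<in> vars A \<Longrightarrow> eq w (\<rho> x) (\<sigma> x)"
  shows "rsat A w \<rho> z = rsat A w \<sigma> z"
proof -
  obtain Y where Y: "Y \<notin> vars A" using fresh_var[OF finite_vars] by blast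
  have "sat (rel Y A) w (\<rho>(Y := z)) = sat (rel Y A) w (\<sigma>(Y := z))"
    by (rule sat_cong) (use assms FV_rel[of Y A] eq_refl in auto)
  then show ?thesis using Y by (simp add: rsat_eq_sat_rel)
qed

lemma rsat_Delta0E: "Delta0E A \<Longrightarrow> rsat A w \<rho> z = sat A w \<rho>"
  by (induction A arbitrary: w \<rho>) simp_all

text \<open>A larger bound adds witnesses for existential quantifiers and instances of universal
  ones. In a Sigma formula unbounded existentials occur only positively and unbounded universals
  only negatively; Pi formulas are dual.\<close>

lemma rsat_sub:
  "SigmaE A \<Longrightarrow> le w w \<Longrightarrow> sub w z z' \<Longrightarrow> rsat A w \<rho> z \<Longrightarrow> rsat A w \<rho> z'"
  "PiE A \<Longrightarrow> le w w \<Longrightarrow> sub w z z' \<Longrightarrow> rsat A w \<rho> z' \<Longrightarrow> rsat A w \<rho> z"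
proof (induction A and A arbitrary: w \<rho> and w \<rho> rule: SigmaE_PiE.inducts)
  case (S_ex A x) then show ?case unfolding rsat.simps using subD by blast
next
  case (P_all A x) then show ?case unfolding rsat.simps using subD le_right sub_mono by meson
next
  case (S_imp C A) then show ?case unfolding rsat.simps using le_right sub_mono by meson
next
  case (P_imp C A) then show ?case unfolding rsat.simps using le_right sub_mono by meson
next
  case (S_neg C) then show ?case unfolding rsat.simps Neg_def using le_right sub_mono by meson
next
  case (P_neg C) then show ?case unfolding rsat.simps Neg_def using le_right sub_mono by meson
next
  case (S_ball A x t) then show ?case unfolding rsat.simps using le_right sub_mono by meson
next
  case (S_eall A x a b) then show ?case unfolding rsat.simps using le_right sub_mono by meson
next
  case (P_ball A x t) then show ?case unfolding rsat.simps using le_right sub_mono by meson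
next
  case (P_eall A x a b) then show ?case unfolding rsat.simps using le_right sub_mono by meson
qed (auto simp: rsat_Delta0E)

text \<open>The same monotonicity with the whole domain in place of the larger bound.\<close>

lemma rsat_sat:
  "SigmaE A \<Longrightarrow> rsat A w \<rho> z \<Longrightarrow> sat A w \<rho>"
  "PiE A \<Longrightarrow> sat A w \<rho> \<Longrightarrow> rsat A w \<rho> z"
proof (induction A and A arbitrary: w \<rho> and w \<rho> rule: SigmaE_PiE.inducts)
qed (auto simp: rsat_Delta0E Neg_def)

lemma sat_BAlls:
  assumes "le w w" "env w \<rho>" "n \<le> Y"
  shows "sat (BAlls n Y A) w \<rho> \<longleftrightarrow>
    (\<forall>v \<sigma>. le w v \<longrightarrow> env v \<sigma> \<longrightarrow> (\<forall>i<n. mem v (\<sigma> i) (\<rho> Y)) \<longrightarrow> (\<forall>i\<ge>n. \<sigma> i = \<rho> i) \<longrightarrow> sat A v \<sigma>)"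
  using assms
proof (induction n arbitrary: w \<rho>)
  case 0
  have "\<And>\<sigma>. (\<forall>i\<ge>0. \<sigma> i = \<rho> i) \<longleftrightarrow> \<sigma> = \<rho>" by auto
  then show ?case using 0 sat_mono env_mono by auto
next
  case (Suc n)
  have IH: "sat (BAlls n Y A) v (\<rho>(n := d)) \<longleftrightarrow>
    (\<forall>u \<sigma>. le v u \<longrightarrow> env u \<sigma> \<longrightarrow> (\<forall>i<n. mem u (\<sigma> i) (\<rho> Y)) \<longrightarrow> (\<forall>i\<ge>n. \<sigma> i = (\<rho>(n := d)) i) \<longrightarrow> sat A u \<sigma>)"
    if "le w v" "d \<in> D v" for v d
    using Suc.IH[of v "\<rho>(n := d)"] that Suc.prems le_right env_mono by fastforce
  show ?case
    unfolding BAlls.simps sat.simps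
  proof (intro iffI HOL.allI impI ballI)
    fix v \<sigma>
    assume h: "\<forall>v. le w v \<longrightarrow> (\<forall>d\<in>D v. mem v d (\<rho> Y) \<longrightarrow> sat (BAlls n Y A) v (\<rho>(n := d)))"
      "le w v" "env v \<sigma>" "\<forall>i<Suc n. mem v (\<sigma> i) (\<rho> Y)" "\<forall>i\<ge>Suc n. \<sigma> i = \<rho> i"
    have "sat (BAlls n Y A) v (\<rho>(n := \<sigma> n))" using h env_D by blast
    moreover have "\<forall>i\<ge>n. \<sigma> i = (\<rho>(n := \<sigma> n)) i" using h(5) by auto
    ultimately show "sat A v \<sigma>" using IH[OF h(2) env_D[OF h(3)]] h(3,4) le_right[OF h(2)] less_SucI by blast
  next
    fix v d
    assume h: "\<forall>v \<sigma>. le w v \<longrightarrow> env v \<sigma> \<longrightarrow> (\<forall>i<Suc n. mem v (\<sigma> i) (\<rho> Y)) \<longrightarrow>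
      (\<forall>i\<ge>Suc n. \<sigma> i = \<rho> i) \<longrightarrow> sat A v \<sigma>" "le w v" "d \<in> D v" "mem v d (\<rho> Y)"
    show "sat (BAlls n Y A) v (\<rho>(n := d))"
      unfolding IH[OF h(2,3)]
    proof (intro HOL.allI impI)
      fix u \<sigma> assume u: "le v u" "env u \<sigma>" "\<forall>i<n. mem u (\<sigma> i) (\<rho> Y)" "\<forall>i\<ge>n. \<sigma> i = (\<rho>(n := d)) i"
      have "mem u (\<sigma> n) (\<rho> Y)" using u(1,4) h(4) mem_mono by simp
      then have "\<forall>i<Suc n. mem u (\<sigma> i) (\<rho> Y)" using u(3) less_Suc_eq by blast
      moreover have "\<forall>i\<ge>Suc n. \<sigma> i = \<rho> i" using u(4) by auto
      ultimately show "sat A u \<sigma>" using h(1) le_trans[OF h(2) u(1)] u(2) by blast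
    qed
  qed
qed

lemma sat_BExs:
  assumes "env w \<rho>" "n \<le> Y"
  shows "sat (BExs n Y A) w \<rho> \<longleftrightarrow>
    (\<exists>\<sigma>. env w \<sigma> \<and> (\<forall>i<n. mem w (\<sigma> i) (\<rho> Y)) \<and> (\<forall>i\<ge>n. \<sigma> i = \<rho> i) \<and> sat A w \<sigma>)"
  using assms
proof (induction n arbitrary: \<rho>)
  case 0
  have "\<And>\<sigma>. (\<forall>i\<ge>0. \<sigma> i = \<rho> i) \<longleftrightarrow> \<sigma> = \<rho>" by auto
  then show ?case using 0 by auto
next
  case (Suc n)
  have IH: "sat (BExs n Y A) w (\<rho>(n := d)) \<longleftrightarrow>
    (\<exists>\<sigma>. env w \<sigma> \<and> (\<forall>i<n. mem w (\<sigma> i) (\<rho> Y)) \<and> (\<forall>i\<ge>n. \<sigma> i = (\<rho>(n := d)) i) \<and> sat A w \<sigma>)"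
    if "d \<in> D w" for d
    using Suc.IH[of "\<rho>(n := d)"] that Suc.prems by fastforce
  show ?case
    unfolding BExs.simps sat.simps
  proof
    assume "\<exists>d\<in>D w. mem w d (\<rho> Y) \<and> sat (BExs n Y A) w (\<rho>(n := d))"
    then obtain d \<sigma> where d: "d \<in> D w" "mem w d (\<rho> Y)" "env w \<sigma>" "\<forall>i<n. mem w (\<sigma> i) (\<rho> Y)"
      "\<forall>i\<ge>n. \<sigma> i = (\<rho>(n := d)) i" "sat A w \<sigma>" using IH by blast
    have "mem w (\<sigma> n) (\<rho> Y)" using d(2,5) by simp
    then have "\<forall>i<Suc n. mem w (\<sigma> i) (\<rho> Y)" using d(4) less_Suc_eq by blast
    moreover have "\<forall>i\<ge>Suc n. \<sigma> i = \<rho> i" using d(5) by auto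
    ultimately show "\<exists>\<sigma>. env w \<sigma> \<and> (\<forall>i<Suc n. mem w (\<sigma> i) (\<rho> Y)) \<and> (\<forall>i\<ge>Suc n. \<sigma> i = \<rho> i) \<and> sat A w \<sigma>"
      using d by blast
  next
    assume "\<exists>\<sigma>. env w \<sigma> \<and> (\<forall>i<Suc n. mem w (\<sigma> i) (\<rho> Y)) \<and> (\<forall>i\<ge>Suc n. \<sigma> i = \<rho> i) \<and> sat A w \<sigma>"
    then obtain \<sigma> where s: "env w \<sigma>" "\<forall>i<Suc n. mem w (\<sigma> i) (\<rho> Y)" "\<forall>i\<ge>Suc n. \<sigma> i = \<rho> i" "sat A w \<sigma>"
      by blast
    moreover have "\<forall>i\<ge>n. \<sigma> i = (\<rho>(n := \<sigma> n)) i" using s(3) by auto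
    ultimately have "sat (BExs n Y A) w (\<rho>(n := \<sigma> n))" using IH[OF env_D[OF s(1)]] less_SucI by blast
    then show "\<exists>d\<in>D w. mem w d (\<rho> Y) \<and> sat (BExs n Y A) w (\<rho>(n := d))" using s env_D by blast
  qed
qed

section \<open>Tuples\<close>

definition is_tuple :: "nat \<Rightarrow> 'w \<Rightarrow> (var \<Rightarrow> 'd) \<Rightarrow> bool" where
  "is_tuple m w \<sigma> \<longleftrightarrow> (\<forall>i<m. is_pair w (\<sigma> (m + i)) (\<sigma> i) (\<sigma> (m + Suc i)))"

lemma sat_tuple_fm: "j \<le> m \<Longrightarrow>
  sat (tuple_fm m j) w \<sigma> \<longleftrightarrow> (\<forall>i<j. is_pair w (\<sigma> (m + i)) (\<sigma> i) (\<sigma> (m + Suc i)))"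
  by (induction j) (auto simp: sat_is_pair_fm less_Suc_eq)

lemma tuple_exists:
  assumes "le w w" "env w \<rho>"
  shows "\<exists>\<sigma>. env w \<sigma> \<and> (\<forall>i<m. \<sigma> i = \<rho> i) \<and> is_tuple m w \<sigma>"
proof -
  have "\<exists>\<sigma>. env w \<sigma> \<and> (\<forall>i<m. \<sigma> i = \<rho> i) \<and>
      (\<forall>i. n \<le> i \<longrightarrow> i < m \<longrightarrow> is_pair w (\<sigma> (m + i)) (\<sigma> i) (\<sigma> (m + Suc i)))" if "n \<le> m" for n
    using that
  \<comment> \<open>The pairs are built downwards from the last one, since the pair at
    \<open>m + n\<close> contains the one at \<open>m + Suc n\<close>.\<close>
  proof (induction rule: inc_induct)
    case base show ?case using assms(2) by auto
  next
    case (step n)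
    then obtain \<sigma> where s: "env w \<sigma>" "\<forall>i<m. \<sigma> i = \<rho> i"
      "\<forall>i. Suc n \<le> i \<longrightarrow> i < m \<longrightarrow> is_pair w (\<sigma> (m + i)) (\<sigma> i) (\<sigma> (m + Suc i))" by blast
    obtain p where p: "p \<in> D w" "is_pair w p (\<sigma> n) (\<sigma> (m + Suc n))"
      using ordered_pair[OF assms(1) env_D[OF s(1)] env_D[OF s(1)]] by blast
    have "is_pair w ((\<sigma>(m + n := p)) (m + i)) ((\<sigma>(m + n := p)) i) ((\<sigma>(m + n := p)) (m + Suc i))"
      if "n \<le> i" "i < m" for i
      using s(3) p(2) that by (cases "i = n") auto
    moreover have "\<forall>i<m. (\<sigma>(m + n := p)) i = \<rho> i" using s(2) by simp
    ultimately show ?case using env_upd[OF s(1) p(1)] by blast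
  qed
  from this[of 0] show ?thesis by (simp add: is_tuple_def)
qed

lemma is_tuple_mono: "le w v \<Longrightarrow> is_tuple m w \<sigma> \<Longrightarrow> is_tuple m v \<sigma>"
  unfolding is_tuple_def using is_pair_mono by blast

lemma is_tuple_inj:
  assumes "le w w" "env w \<sigma>" "env w \<tau>" "is_tuple m w \<sigma>" "is_tuple m w \<tau>" "eq w (\<sigma> m) (\<tau> m)" "i < m"
  shows "eq w (\<sigma> i) (\<tau> i)"
proof -
  have *: "eq w (\<sigma> i) (\<tau> i) \<and> eq w (\<sigma> (m + Suc i)) (\<tau> (m + Suc i))"
    if "i < m" "eq w (\<sigma> (m + i)) (\<tau> (m + i))" for i
    using is_pair_inj[OF assms(1) _ _ _ _ _ _ _ _ that(2)] assms(2-5) that(1) env_D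
    unfolding is_tuple_def by meson
  have "eq w (\<sigma> (m + i)) (\<tau> (m + i))" if "i \<le> m" for i
    using that
  proof (induction i)
    case 0 then show ?case using assms(6) by simp
  next
    case (Suc i) then show ?case using * by simp
  qed
  then show ?thesis using * assms(7) by simp
qed

lemma sat_inh_fm: "u \<noteq> s \<Longrightarrow> sat (inh_fm u s) w \<rho> = inh w (\<rho> s)"
  by (simp add: inh_fm_def inh_def)

lemma sat_cond_fm:
  assumes "u \<ge> n + length Fs" "Y \<noteq> u" "\<And>F. F \<in> set Fs \<Longrightarrow> Y \<notin> vars F" "le w w"
  shows "sat (cond_fm Y u n Fs) w \<rho> \<longleftrightarrow> (\<forall>i<length Fs. PiE (Fs ! i) \<longrightarrow>
    (\<forall>v. le w v \<longrightarrow> inh v (\<rho> (n + i)) \<longrightarrow> rsat (Fs ! i) v \<rho> (\<rho> Y)))"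
  using assms
proof (induction Fs arbitrary: n)
  case (Cons F Fs)
  have "sat (cond_fm Y u (Suc n) Fs) w \<rho> \<longleftrightarrow> (\<forall>i<length Fs. PiE (Fs ! i) \<longrightarrow>
    (\<forall>v. le w v \<longrightarrow> inh v (\<rho> (Suc n + i)) \<longrightarrow> rsat (Fs ! i) v \<rho> (\<rho> Y)))"
    by (rule Cons.IH) (use Cons.prems in auto)
  moreover have "sat (rel Y F) v \<rho> = rsat F v \<rho> (\<rho> Y)" for v
    using sat_rel Cons.prems(3) by simp
  moreover have "sat (inh_fm u n) v \<rho> = inh v (\<rho> n)" for v
    using sat_inh_fm Cons.prems(1) by simp
  ultimately show ?case
    by (simp add: All_less_Suc2)
qed simp

lemma sat_goal_fm:
  assumes "u \<ge> n + length Fs" "Y \<noteq> u" "\<And>F. F \<in> set Fs \<Longrightarrow> Y \<notin> vars F"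
  shows "sat (goal_fm Y u n Fs) w \<rho> \<longleftrightarrow> (\<exists>i<length Fs. SigmaE (Fs ! i) \<and>
    inh w (\<rho> (n + i)) \<and> rsat (Fs ! i) w \<rho> (\<rho> Y))"
  using assms
proof (induction Fs arbitrary: n)
  case (Cons F Fs)
  have "sat (goal_fm Y u (Suc n) Fs) w \<rho> \<longleftrightarrow> (\<exists>i<length Fs. SigmaE (Fs ! i) \<and>
    inh w (\<rho> (Suc n + i)) \<and> rsat (Fs ! i) w \<rho> (\<rho> Y))"
    by (rule Cons.IH) (use Cons.prems in auto)
  moreover have "sat (rel Y F) v \<rho> = rsat F v \<rho> (\<rho> Y)" for v
    using sat_rel Cons.prems(3) by simp
  moreover have "sat (inh_fm u n) v \<rho> = inh v (\<rho> n)" for v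
    using sat_inh_fm Cons.prems(1) by simp
  ultimately show ?case
    by (simp add: Ex_less_Suc2)
qed simp

lemma finite_superset:
  assumes "le w w" "env w \<sigma>"
  shows "\<exists>y\<in>D w. \<forall>i<n. mem w (\<sigma> (i::nat)) y"
proof (induction n)
  case 0 then show ?case using env_D[OF assms(2)] by auto
next
  case (Suc n)
  then obtain y where y: "y \<in> D w" "\<forall>i<n. mem w (\<sigma> i) y" by blast
  obtain z where z: "z \<in> D w" "sub w y z" "mem w (\<sigma> n) z"
    using adjoin[OF assms(1) y(1) env_D[OF assms(2)]] by blast
  have "mem w (\<sigma> i) z" if "i < n" for i
    using subD[OF z(2) assms(1) env_D[OF assms(2)]] y(2) that by blast
  then show ?case using z less_Suc_eq by blast
qed

end

section \<open>Coded conditions and goals\<close>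

locale coding = ikpe_model le D mem eq
  for le :: "'w \<Rightarrow> 'w \<Rightarrow> bool" and D :: "'w \<Rightarrow> 'd set" and mem eq :: "'w \<Rightarrow> 'd \<Rightarrow> 'd \<Rightarrow> bool" +
  fixes Fs :: "fm list" and N :: nat
  assumes vars_bound: "F \<in> set Fs \<Longrightarrow> vars F \<subseteq> {..<N}"
begin

definition m :: nat where "m = N + length Fs"

text \<open>One more than the last tuple variable. The decoding formulas bind \<open>q\<close> and
  \<open>q + 1\<close> internally, and \<open>q + 2\<close> ranges over the elements of a condition;
  hence parameters start at \<open>q + 3\<close>.\<close>

definition q :: nat where "q = 2 * m + 1"

text \<open>Variables: below \<open>N\<close> the parameters of the formulas in \<open>Fs\<close>, then one selector per formula;
  \<open>m + i\<close> holds the tuple of the variables from \<open>i\<close> on, hence \<open>m\<close> the code of everything.\<close>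

definition cond :: "'w \<Rightarrow> 'd \<Rightarrow> 'd \<Rightarrow> bool" where
  "cond w p y \<longleftrightarrow> (\<forall>v. le w v \<longrightarrow> (\<forall>c\<in>D v. mem v c p \<longrightarrow>
    (\<forall>u \<sigma>. le v u \<longrightarrow> env u \<sigma> \<longrightarrow> (\<forall>i<q. mem u (\<sigma> i) y) \<longrightarrow> is_tuple m u \<sigma> \<longrightarrow> eq u (\<sigma> m) c \<longrightarrow>
      (\<forall>i<length Fs. PiE (Fs ! i) \<longrightarrow> inh u (\<sigma> (N + i)) \<longrightarrow> rsat (Fs ! i) u \<sigma> y))))"

text \<open>A condition is a set of codes, a goal a single code. Decodings are quantified
  universally in \<open>cond\<close> and existentially here, so an element that is no code is a true
  condition and a false goal. As decodings are confined to \<open>y\<close>, a code has its intended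
  meaning only for bounds above its components.\<close>

definition goal :: "'w \<Rightarrow> 'd \<Rightarrow> 'd \<Rightarrow> bool" where
  "goal w g y \<longleftrightarrow> (\<exists>\<sigma>. env w \<sigma> \<and> (\<forall>i<q. mem w (\<sigma> i) y) \<and> is_tuple m w \<sigma> \<and> eq w (\<sigma> m) g \<and>
      (\<exists>i<length Fs. SigmaE (Fs ! i) \<and> inh w (\<sigma> (N + i)) \<and> rsat (Fs ! i) w \<sigma> y))"

definition cond_def_fm :: "var \<Rightarrow> var \<Rightarrow> fm" where
  "cond_def_fm P Y = BAll (q + 2) P (BAlls q Y
    (Imp (And (tuple_fm m m) (Eq m (q + 2))) (cond_fm Y q N Fs)))"

definition goal_def_fm :: "var \<Rightarrow> var \<Rightarrow> fm" where
  "goal_def_fm P Y = BExs q Y (And (And (tuple_fm m m) (Eq m P)) (goal_fm Y q N Fs))"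

lemma Y_fresh: "Y \<ge> q + 3 \<Longrightarrow> F \<in> set Fs \<Longrightarrow> Y \<notin> vars F"
  using vars_bound[of F] by (auto simp: q_def m_def)

lemma sat_cond_def_fm:
  assumes "P \<ge> q + 3" "Y \<ge> q + 3" "le w w" "env w \<rho>"
  shows "sat (cond_def_fm P Y) w \<rho> = cond w (\<rho> P) (\<rho> Y)"
proof -
  have q: "q \<ge> N + length Fs" "m < q" by (auto simp: q_def m_def)
  have body: "sat (BAlls q Y (Imp (And (tuple_fm m m) (Eq m (q + 2))) (cond_fm Y q N Fs))) v (\<rho>(q + 2 := c)) \<longleftrightarrow>
    (\<forall>u \<sigma>. le v u \<longrightarrow> env u \<sigma> \<longrightarrow> (\<forall>i<q. mem u (\<sigma> i) (\<rho> Y)) \<longrightarrow> is_tuple m u \<sigma> \<longrightarrow> eq u (\<sigma> m) c \<longrightarrow>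
      (\<forall>i<length Fs. PiE (Fs ! i) \<longrightarrow> inh u (\<sigma> (N + i)) \<longrightarrow> rsat (Fs ! i) u \<sigma> (\<rho> Y)))" (is "?L \<longleftrightarrow> ?R")
    if v: "le w v" "c \<in> D v" for v c
  proof -
    have ev: "env v (\<rho>(q + 2 := c))" using assms v env_mono by simp
    have L: "?L \<longleftrightarrow> (\<forall>u \<sigma>. le v u \<longrightarrow> env u \<sigma> \<longrightarrow> (\<forall>i<q. mem u (\<sigma> i) (\<rho> Y)) \<longrightarrow>
        (\<forall>i\<ge>q. \<sigma> i = (\<rho>(q + 2 := c)) i) \<longrightarrow>
        sat (Imp (And (tuple_fm m m) (Eq m (q + 2))) (cond_fm Y q N Fs)) u \<sigma>)"
      using sat_BAlls[OF le_right[OF v(1)] ev, of q Y] assms(2) by simp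
    have C: "sat (cond_fm Y q N Fs) u \<sigma> \<longleftrightarrow> (\<forall>i<length Fs. PiE (Fs ! i) \<longrightarrow>
        (\<forall>v. le u v \<longrightarrow> inh v (\<sigma> (N + i)) \<longrightarrow> rsat (Fs ! i) v \<sigma> (\<sigma> Y)))" if "le u u" for u \<sigma>
      by (rule sat_cond_fm) (use q assms(2) Y_fresh that in auto)
    show ?thesis
    proof
      assume ?L
      show ?R
      proof (intro HOL.allI impI)
        fix u \<sigma> i
        assume h: "le v u" "env u \<sigma>" "\<forall>i<q. mem u (\<sigma> i) (\<rho> Y)" "is_tuple m u \<sigma>" "eq u (\<sigma> m) c"
          "i < length Fs" "PiE (Fs ! i)" "inh u (\<sigma> (N + i))"
        \<comment> \<open>The formula varies only the variables below \<open>q\<close>, whereas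
          \<open>cond\<close> admits arbitrary assignments. Tuples and coded formulas look only
          below \<open>q\<close>, so \<sigma> may be corrected from there on.\<close>
        define \<tau> where "\<tau> = (\<lambda>i. if i < q then \<sigma> i else (\<rho>(q + 2 := c)) i)"
        have \<tau>: "env u \<tau>" "\<And>i. i < q \<Longrightarrow> \<tau> i = \<sigma> i" "\<forall>i\<ge>q. \<tau> i = (\<rho>(q + 2 := c)) i"
          using h(2) env_mono[OF h(1) ev] by (auto simp: \<tau>_def env_def)
        have "sat (tuple_fm m m) u \<tau>"
          using h(4) \<tau>(2) by (auto simp: sat_tuple_fm is_tuple_def q_def)
        moreover have "eq u (\<tau> m) (\<tau> (q + 2))" using h(5) \<tau>(2,3) q by simp
        moreover have "sat (Imp (And (tuple_fm m m) (Eq m (q + 2))) (cond_fm Y q N Fs)) u \<tau>"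
          using \<open>?L\<close>[unfolded L] h(1,3) \<tau> by simp
        ultimately have "sat (cond_fm Y q N Fs) u \<tau>" using le_right[OF h(1)] unfolding sat.simps by blast
        moreover have "inh u (\<tau> (N + i))" using h(6,8) \<tau>(2) q by simp
        ultimately have "rsat (Fs ! i) u \<tau> (\<tau> Y)" using C le_right[OF h(1)] h(6,7) by blast
        moreover have "\<tau> Y = \<rho> Y" using \<tau>(3) assms(2) by simp
        moreover have "rsat (Fs ! i) u \<tau> (\<rho> Y) = rsat (Fs ! i) u \<sigma> (\<rho> Y)"
          by (rule rsat_coincidence, rule \<tau>(2)) (use vars_bound[of "Fs ! i"] h(6) q in auto)
        ultimately show "rsat (Fs ! i) u \<sigma> (\<rho> Y)" by simp
      qed
    next
      assume R: ?R
      show ?L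
        unfolding L sat.simps
      proof (intro HOL.allI impI)
        fix u \<sigma> t
        assume h: "le v u" "env u \<sigma>" "\<forall>i<q. mem u (\<sigma> i) (\<rho> Y)" "\<forall>i\<ge>q. \<sigma> i = (\<rho>(q + 2 := c)) i"
          "le u t" "sat (tuple_fm m m) t \<sigma> \<and> eq t (\<sigma> m) (\<sigma> (q + 2))"
        have Y: "\<sigma> Y = \<rho> Y" using h(4) assms(2) by simp
        show "sat (cond_fm Y q N Fs) t \<sigma>"
          unfolding C[OF le_right[OF h(5)]] Y
        proof (intro HOL.allI impI)
          fix i s assume i: "i < length Fs" "PiE (Fs ! i)" "le t s" "inh s (\<sigma> (N + i))"
          have us: "le u s" using h(5) i(3) le_trans by blast
          have "is_tuple m s \<sigma>" using h(6) is_tuple_mono[OF i(3)] by (auto simp: sat_tuple_fm is_tuple_def)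
          moreover have "eq s (\<sigma> m) c" using h(4,6) eq_mono[OF i(3)] by simp
          ultimately show "rsat (Fs ! i) s \<sigma> (\<rho> Y)"
            using R i le_trans[OF h(1) us] env_mono[OF us h(2)] mem_mono[OF us] h(3) by blast
        qed
      qed
    qed
  qed
  have "q + 2 \<noteq> P" using assms(1) by simp
  then show ?thesis unfolding cond_def_fm_def cond_def sat.simps using body by simp
qed

lemma sat_goal_def_fm:
  assumes "P \<ge> q + 3" "Y \<ge> q + 3" "env w \<rho>"
  shows "sat (goal_def_fm P Y) w \<rho> = goal w (\<rho> P) (\<rho> Y)"
proof -
  have q: "q \<ge> N + length Fs" "m < q" by (auto simp: q_def m_def)
  have L: "sat (goal_def_fm P Y) w \<rho> \<longleftrightarrow> (\<exists>\<sigma>. env w \<sigma> \<and> (\<forall>i<q. mem w (\<sigma> i) (\<rho> Y)) \<and>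
      (\<forall>i\<ge>q. \<sigma> i = \<rho> i) \<and> is_tuple m w \<sigma> \<and> eq w (\<sigma> m) (\<sigma> P) \<and> sat (goal_fm Y q N Fs) w \<sigma>)"
    unfolding goal_def_fm_def
    using sat_BExs[OF assms(3), of q Y] assms(2) by (simp add: sat_tuple_fm is_tuple_def conj_assoc)
  have C: "sat (goal_fm Y q N Fs) w \<sigma> \<longleftrightarrow> (\<exists>i<length Fs. SigmaE (Fs ! i) \<and>
        inh w (\<sigma> (N + i)) \<and> rsat (Fs ! i) w \<sigma> (\<sigma> Y))" for \<sigma>
    by (rule sat_goal_fm) (use q assms(2) Y_fresh in auto)
  show ?thesis
    unfolding L C goal_def
  proof
    assume "\<exists>\<sigma>. env w \<sigma> \<and> (\<forall>i<q. mem w (\<sigma> i) (\<rho> Y)) \<and> is_tuple m w \<sigma> \<and> eq w (\<sigma> m) (\<rho> P) \<and>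
      (\<exists>i<length Fs. SigmaE (Fs ! i) \<and> inh w (\<sigma> (N + i)) \<and> rsat (Fs ! i) w \<sigma> (\<rho> Y))"
    then obtain \<sigma> i where h: "env w \<sigma>" "\<forall>i<q. mem w (\<sigma> i) (\<rho> Y)" "is_tuple m w \<sigma>" "eq w (\<sigma> m) (\<rho> P)"
      "i < length Fs" "SigmaE (Fs ! i)" "inh w (\<sigma> (N + i))" "rsat (Fs ! i) w \<sigma> (\<rho> Y)" by blast
    define \<tau> where "\<tau> = (\<lambda>i. if i < q then \<sigma> i else \<rho> i)"
    have \<tau>: "env w \<tau>" "\<And>i. i < q \<Longrightarrow> \<tau> i = \<sigma> i" "\<forall>i\<ge>q. \<tau> i = \<rho> i"
      using h(1) assms(3) by (auto simp: \<tau>_def env_def)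
    have "is_tuple m w \<tau>" using h(3) \<tau>(2) by (auto simp: is_tuple_def q_def)
    moreover have "eq w (\<tau> m) (\<tau> P)" "inh w (\<tau> (N + i))" using h(4,5,7) \<tau>(2,3) q assms(1) by simp_all
    moreover have "rsat (Fs ! i) w \<tau> (\<rho> Y) = rsat (Fs ! i) w \<sigma> (\<rho> Y)"
      by (rule rsat_coincidence, rule \<tau>(2)) (use vars_bound[of "Fs ! i"] h(5) q in auto)
    moreover have "\<tau> Y = \<rho> Y" using \<tau>(3) assms(2) by simp
    ultimately show "\<exists>\<sigma>. env w \<sigma> \<and> (\<forall>i<q. mem w (\<sigma> i) (\<rho> Y)) \<and> (\<forall>i\<ge>q. \<sigma> i = \<rho> i) \<and> is_tuple m w \<sigma> \<and>
      eq w (\<sigma> m) (\<sigma> P) \<and> (\<exists>i<length Fs. SigmaE (Fs ! i) \<and> inh w (\<sigma> (N + i)) \<and> rsat (Fs ! i) w \<sigma> (\<sigma> Y))"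
      using \<tau> h(2,5,6,8) by (intro exI[of _ \<tau>]) auto
  next
    assume "\<exists>\<sigma>. env w \<sigma> \<and> (\<forall>i<q. mem w (\<sigma> i) (\<rho> Y)) \<and> (\<forall>i\<ge>q. \<sigma> i = \<rho> i) \<and> is_tuple m w \<sigma> \<and>
      eq w (\<sigma> m) (\<sigma> P) \<and> (\<exists>i<length Fs. SigmaE (Fs ! i) \<and> inh w (\<sigma> (N + i)) \<and> rsat (Fs ! i) w \<sigma> (\<sigma> Y))"
    then obtain \<sigma> where h: "env w \<sigma>" "\<forall>i<q. mem w (\<sigma> i) (\<rho> Y)" "\<forall>i\<ge>q. \<sigma> i = \<rho> i" "is_tuple m w \<sigma>"
      "eq w (\<sigma> m) (\<sigma> P)" "\<exists>i<length Fs. SigmaE (Fs ! i) \<and> inh w (\<sigma> (N + i)) \<and> rsat (Fs ! i) w \<sigma> (\<sigma> Y)"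
      by blast
    have "\<sigma> Y = \<rho> Y" "\<sigma> P = \<rho> P" using h(3) assms by simp_all
    then show "\<exists>\<sigma>. env w \<sigma> \<and> (\<forall>i<q. mem w (\<sigma> i) (\<rho> Y)) \<and> is_tuple m w \<sigma> \<and> eq w (\<sigma> m) (\<rho> P) \<and>
      (\<exists>i<length Fs. SigmaE (Fs ! i) \<and> inh w (\<sigma> (N + i)) \<and> rsat (Fs ! i) w \<sigma> (\<rho> Y))"
      using h by auto
  qed
qed

text \<open>A smaller bound admits fewer decodings and makes every relativised Pi statement weaker.
  Dually, \<open>goal_mono_bound\<close> gains decodings and strengthens nothing.\<close>

lemma cond_antimono:
  assumes "le w w" "sub w y y'" "cond w p y'"
  shows "cond w p y"
  unfolding cond_def
proof (intro HOL.allI ballI impI)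
  fix v c u \<sigma> i
  assume h: "le w v" "c \<in> D v" "mem v c p" "le v u" "env u \<sigma>" "\<forall>i<q. mem u (\<sigma> i) y"
    "is_tuple m u \<sigma>" "eq u (\<sigma> m) c" "i < length Fs" "PiE (Fs ! i)" "inh u (\<sigma> (N + i))"
  have s: "sub u y y'" using sub_mono[OF le_trans[OF h(1,4)] assms(2)] .
  have "\<forall>i<q. mem u (\<sigma> i) y'" using h(5,6) subD[OF s le_right[OF h(4)] env_D] by blast
  then have "rsat (Fs ! i) u \<sigma> y'" using assms(3) h unfolding cond_def by blast
  then show "rsat (Fs ! i) u \<sigma> y" by (rule rsat_sub(2)[OF h(10) le_right[OF h(4)] s])
qed

lemma goal_mono_bound:
  assumes "le w w" "sub w y y'" "goal w g y"
  shows "goal w g y'"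
proof -
  obtain \<sigma> i where h: "env w \<sigma>" "\<forall>i<q. mem w (\<sigma> i) y" "is_tuple m w \<sigma>" "eq w (\<sigma> m) g"
      "i < length Fs" "SigmaE (Fs ! i)" "inh w (\<sigma> (N + i))" "rsat (Fs ! i) w \<sigma> y"
    using assms(3) unfolding goal_def by blast
  have "\<forall>i<q. mem w (\<sigma> i) y'" using h(1,2) subD[OF assms(2,1) env_D] by blast
  then show ?thesis using h rsat_sub(1)[OF h(6) assms(1,2)] unfolding goal_def by blast
qed

lemma cond_world_mono: "le w v \<Longrightarrow> cond w p y \<Longrightarrow> cond v p y"
  unfolding cond_def using le_trans by blast

text \<open>The empty set of statements. At this condition forcing will be compared with truth in
  the ground model.\<close>

lemma cond_top:
  assumes "le w w" "d \<in> D w"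
  shows "\<exists>p\<in>D w. \<forall>v y. le w v \<longrightarrow> cond v p y"
proof -
  obtain p where p: "p \<in> D w" "\<And>v. le w v \<Longrightarrow> \<not> inh v p" using empty_set[OF assms] by blast
  have "cond v p y" if "le w v" for v y
    unfolding cond_def using p(2) le_trans[OF that] unfolding inh_def by blast
  then show ?thesis using p(1) by blast
qed

lemma cond_conj:
  assumes "le w w" "p \<in> D w" "p' \<in> D w"
  shows "\<exists>r\<in>D w. \<forall>v y. le w v \<longrightarrow> (cond v r y \<longleftrightarrow> cond v p y \<and> cond v p' y)"
proof -
  obtain r where r: "r \<in> D w" "\<And>v e. le w v \<Longrightarrow> e \<in> D v \<Longrightarrow> mem v e r \<longleftrightarrow> mem v e p \<or> mem v e p'"
    using union2_set[OF assms] by blast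
  have "cond v r y \<longleftrightarrow> cond v p y \<and> cond v p' y" if v: "le w v" for v y
    unfolding cond_def using r(2)[OF le_trans[OF v]] by blast
  then show ?thesis using r(1) by blast
qed

lemma code_exists:
  assumes "le w w" "env w \<rho>" "i < length Fs"
  shows "\<exists>\<sigma>. env w \<sigma> \<and> (\<forall>j<N. \<sigma> j = \<rho> j) \<and> is_tuple m w \<sigma> \<and> inh w (\<sigma> (N + i)) \<and>
    (\<forall>j<length Fs. j \<noteq> i \<longrightarrow> (\<forall>v. le w v \<longrightarrow> \<not> inh v (\<sigma> (N + j))))"
proof -
  obtain z where z: "z \<in> D w" "\<And>v. le w v \<Longrightarrow> \<not> inh v z"
    using empty_set[OF assms(1) env_D[OF assms(2)]] by blast
  obtain s where s: "s \<in> D w" "mem w z s" using pairing[OF assms(1) z(1,1)] by blast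
  \<comment> \<open>Parameters below \<open>N\<close>, then the selectors: the inhabited set
    \<open>s\<close> for the chosen formula and the empty set \<open>z\<close> for all
    others.\<close>
  define \<rho>' where "\<rho>' = (\<lambda>j. if j < N then \<rho> j else if j = N + i then s else z)"
  have "env w \<rho>'" using z s assms(2) by (auto simp: \<rho>'_def env_def)
  then obtain \<sigma> where "env w \<sigma>" "\<forall>i<m. \<sigma> i = \<rho>' i" "is_tuple m w \<sigma>"
    using tuple_exists[OF assms(1)] by blast
  moreover have "inh w s" using s z unfolding inh_def by blast
  ultimately show ?thesis
    using z(2) assms(3) by (intro exI[of _ \<sigma>]) (auto simp: m_def \<rho>'_def)
qed

text \<open>By injectivity of tuples, any decoding agrees with \<sigma> up to \<open>eq\<close>. It
  therefore selects the same formula and, truth being a congruence, the same instance of it.\<close>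

lemma code_unique:
  assumes \<sigma>: "env w \<sigma>" "\<forall>j<N. \<sigma> j = \<rho> j" "is_tuple m w \<sigma>"
      "\<forall>j<length Fs. j \<noteq> i \<longrightarrow> (\<forall>v. le w v \<longrightarrow> \<not> inh v (\<sigma> (N + j)))"
    and v: "le w v" "y \<in> D v"
    and \<tau>: "env v \<tau>" "is_tuple m v \<tau>" "eq v (\<tau> m) (\<sigma> m)" "j < length Fs" "inh v (\<tau> (N + j))"
  shows "j = i" "rsat (Fs ! j) v \<tau> y = rsat (Fs ! j) v \<rho> y"
proof -
  have vv: "le v v" using v le_right by blast
  have e: "eq v (\<tau> k) (\<sigma> k)" if "k < m" for k
    using is_tuple_inj[OF vv \<tau>(1) env_mono[OF v(1) \<sigma>(1)] \<tau>(2) is_tuple_mono[OF v(1) \<sigma>(3)] \<tau>(3) that] .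
  have "inh v (\<sigma> (N + j))"
    using \<tau>(4,5) eq_mem2[OF vv e[of "N + j"]] unfolding inh_def by (auto simp: m_def)
  then show "j = i" using \<sigma>(4) \<tau>(4) v(1) by blast
  have vb: "vars (Fs ! j) \<subseteq> {..<N}" using vars_bound \<tau>(4) by simp
  have "rsat (Fs ! j) v \<tau> y = rsat (Fs ! j) v \<sigma> y"
    by (rule rsat_cong[OF vv \<tau>(1) env_mono[OF v(1) \<sigma>(1)] v(2)], rule e) (use vb in \<open>auto simp: m_def\<close>)
  also have "\<dots> = rsat (Fs ! j) v \<rho> y"
    by (rule rsat_coincidence) (use vb \<sigma>(2) in auto)
  finally show "rsat (Fs ! j) v \<tau> y = rsat (Fs ! j) v \<rho> y" .
qed

text \<open>The condition is the singleton of the code. The threshold \<open>y0\<close> contains all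
  components of the code, for otherwise the decoding could not be found inside
  \<open>y\<close>.\<close>

lemma cond_code:
  assumes "F \<in> set Fs" "PiE F" "le w w" "env w \<rho>"
  shows "\<exists>p\<in>D w. \<exists>y0\<in>D w. \<forall>v y. le w v \<longrightarrow> y \<in> D v \<longrightarrow> sub v y0 y \<longrightarrow> (cond v p y \<longleftrightarrow> rsat F v \<rho> y)"
proof -
  obtain i where i: "i < length Fs" "Fs ! i = F" using assms(1) by (auto simp: in_set_conv_nth)
  obtain \<sigma> where \<sigma>: "env w \<sigma>" "\<forall>j<N. \<sigma> j = \<rho> j" "is_tuple m w \<sigma>"
      "\<forall>j<length Fs. j \<noteq> i \<longrightarrow> (\<forall>v. le w v \<longrightarrow> \<not> inh v (\<sigma> (N + j)))" "inh w (\<sigma> (N + i))"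
    using code_exists[OF assms(3,4) i(1)] by blast
  obtain p where p: "p \<in> D w" "\<And>v e. le w v \<Longrightarrow> e \<in> D v \<Longrightarrow> mem v e p \<longleftrightarrow> eq v e (\<sigma> m) \<or> eq v e (\<sigma> m)"
    using upair_set[OF assms(3) env_D[OF \<sigma>(1)] env_D[OF \<sigma>(1)]] by blast
  obtain y0 where y0: "y0 \<in> D w" "\<forall>i<q. mem w (\<sigma> i) y0" using finite_superset[OF assms(3) \<sigma>(1)] by blast
  have "cond v p y \<longleftrightarrow> rsat F v \<rho> y" if v: "le w v" "y \<in> D v" "sub v y0 y" for v y
  proof
    have vv: "le v v" using v le_right by blast
    have ev: "env v \<sigma>" using env_mono[OF v(1) \<sigma>(1)] .
    have e: "eq v (\<sigma> m) (\<sigma> m)" using eq_refl[OF vv env_D[OF ev]] .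
    have c: "mem v (\<sigma> m) p" using p(2)[OF v(1) env_D[OF ev]] e by blast
    have my: "\<forall>i<q. mem v (\<sigma> i) y" using y0(2) mem_mono[OF v(1)] subD[OF v(3) vv env_D[OF ev]] by blast
    have t: "is_tuple m v \<sigma>" using is_tuple_mono[OF v(1) \<sigma>(3)] .
    have n: "inh v (\<sigma> (N + i))" using inh_mono[OF v(1) \<sigma>(5)] .
    assume "cond v p y"
    then have "rsat (Fs ! i) v \<sigma> y"
      using env_D[OF ev] c vv ev my t e i(1) n assms(2) i(2) unfolding cond_def by blast
    then show "rsat F v \<rho> y" using code_unique(2)[OF \<sigma>(1-4) v(1,2) ev t e i(1) n] i(2) by simp
  next
    assume r: "rsat F v \<rho> y"
    show "cond v p y"
      unfolding cond_def
    proof (intro HOL.allI ballI impI)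
      fix s c u \<tau> j
      assume h: "le v s" "c \<in> D s" "mem s c p" "le s u" "env u \<tau>" "\<forall>i<q. mem u (\<tau> i) y"
        "is_tuple m u \<tau>" "eq u (\<tau> m) c" "j < length Fs" "PiE (Fs ! j)" "inh u (\<tau> (N + j))"
      have wu: "le v u" "le w u" using h(1,4) v(1) le_trans by blast+
      have "eq s c (\<sigma> m)" using p(2)[OF le_trans[OF v(1) h(1)] h(2)] h(3) by blast
      then have e: "eq u (\<tau> m) (\<sigma> m)" using eq_trans[OF le_right[OF wu(1)] h(8)] eq_mono[OF h(4)] by blast
      show "rsat (Fs ! j) u \<tau> y"
        using code_unique[OF \<sigma>(1-4) wu(2) D_mono[OF wu(1) v(2)] h(5,7) e h(9,11)] rsat_mono[OF wu(1) r] i(2)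
        by simp
    qed
  qed
  then show ?thesis using p(1) y0(1) by blast
qed

lemma goal_code:
  assumes "F \<in> set Fs" "SigmaE F" "le w w" "env w \<rho>"
  shows "\<exists>g\<in>D w. \<exists>y0\<in>D w. \<forall>v y. le w v \<longrightarrow> y \<in> D v \<longrightarrow> sub v y0 y \<longrightarrow> (goal v g y \<longleftrightarrow> rsat F v \<rho> y)"
proof -
  obtain i where i: "i < length Fs" "Fs ! i = F" using assms(1) by (auto simp: in_set_conv_nth)
  obtain \<sigma> where \<sigma>: "env w \<sigma>" "\<forall>j<N. \<sigma> j = \<rho> j" "is_tuple m w \<sigma>"
      "\<forall>j<length Fs. j \<noteq> i \<longrightarrow> (\<forall>v. le w v \<longrightarrow> \<not> inh v (\<sigma> (N + j)))" "inh w (\<sigma> (N + i))"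
    using code_exists[OF assms(3,4) i(1)] by blast
  obtain y0 where y0: "y0 \<in> D w" "\<forall>i<q. mem w (\<sigma> i) y0" using finite_superset[OF assms(3) \<sigma>(1)] by blast
  have "goal v (\<sigma> m) y \<longleftrightarrow> rsat F v \<rho> y" if v: "le w v" "y \<in> D v" "sub v y0 y" for v y
  proof
    have vv: "le v v" using v le_right by blast
    have ev: "env v \<sigma>" using env_mono[OF v(1) \<sigma>(1)] .
    have e: "eq v (\<sigma> m) (\<sigma> m)" using eq_refl[OF vv env_D[OF ev]] .
    have my: "\<forall>i<q. mem v (\<sigma> i) y" using y0(2) mem_mono[OF v(1)] subD[OF v(3) vv env_D[OF ev]] by blast
    have t: "is_tuple m v \<sigma>" using is_tuple_mono[OF v(1) \<sigma>(3)] .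
    have n: "inh v (\<sigma> (N + i))" using inh_mono[OF v(1) \<sigma>(5)] .
    assume "rsat F v \<rho> y"
    then have "rsat (Fs ! i) v \<sigma> y" using code_unique(2)[OF \<sigma>(1-4) v(1,2) ev t e i(1) n] i(2) by simp
    then show "goal v (\<sigma> m) y" using ev my t e i(1) n assms(2) i(2) unfolding goal_def by blast
  next
    assume "goal v (\<sigma> m) y"
    then obtain \<tau> j where h: "env v \<tau>" "is_tuple m v \<tau>" "eq v (\<tau> m) (\<sigma> m)" "j < length Fs"
      "inh v (\<tau> (N + j))" "rsat (Fs ! j) v \<tau> y" unfolding goal_def by blast
    then show "rsat F v \<rho> y"
      using code_unique[OF \<sigma>(1-4) v(1,2) h(1-5)] i(2) by simp
  qed
  then show ?thesis using env_D[OF \<sigma>(1)] y0(1) by blast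
qed

end

section \<open>The forcing model\<close>

primrec subfms :: "fm \<Rightarrow> fm set" where
  "subfms (Mem x y) = {Mem x y}"
| "subfms (Eq x y) = {Eq x y}"
| "subfms Bot = {Bot}"
| "subfms (And A B) = insert (And A B) (subfms A \<union> subfms B)"
| "subfms (Or A B) = insert (Or A B) (subfms A \<union> subfms B)"
| "subfms (Imp A B) = insert (Imp A B) (subfms A \<union> subfms B)"
| "subfms (All x A) = insert (All x A) (subfms A)"
| "subfms (Ex x A) = insert (Ex x A) (subfms A)"
| "subfms (BAll x t A) = insert (BAll x t A) (subfms A)"
| "subfms (BEx x t A) = insert (BEx x t A) (subfms A)"
| "subfms (EAll x a b A) = insert (EAll x a b A) (subfms A)"
| "subfms (EEx x a b A) = insert (EEx x a b A) (subfms A)"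

lemma finite_subfms [simp]: "finite (subfms A)"
  by (induction A) auto

lemma subfms_refl [simp]: "A \<in> subfms A"
  by (induction A) auto

text \<open>With \<open>inh_fm 1 0\<close> on the list every Delta_0 statement can be coded:
  separation turns it into a truth value, and the code says that this set is inhabited.\<close>

locale forcing = coding le D mem eq Fs N
  for le :: "'w \<Rightarrow> 'w \<Rightarrow> bool" and D :: "'w \<Rightarrow> 'd set" and mem eq :: "'w \<Rightarrow> 'd \<Rightarrow> 'd \<Rightarrow> bool"
    and Fs :: "fm list" and N :: nat +
  assumes inh_Fs: "inh_fm 1 0 \<in> set Fs"
begin

definition frc :: "('w \<Rightarrow> 'd \<Rightarrow> bool) \<Rightarrow> 'w \<Rightarrow> 'd \<Rightarrow> bool" where
  "frc \<phi> w p \<longleftrightarrow> (\<exists>y\<in>D w. \<forall>v. le w v \<longrightarrow> cond v p y \<longrightarrow> \<phi> v y)"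

definition mono_bound :: "'w \<Rightarrow> ('w \<Rightarrow> 'd \<Rightarrow> bool) \<Rightarrow> bool" where
  "mono_bound w \<phi> \<longleftrightarrow> (\<forall>v y y'. le w v \<longrightarrow> sub v y y' \<longrightarrow> \<phi> v y \<longrightarrow> \<phi> v y')"

text \<open>A stronger condition entails the weaker one under every bound; inclusion of sets of
  codes would be too fine. The domain requirements make \<open>fle a a\<close> single out the
  genuine pairs of a world and a condition.\<close>

fun fle :: "'w \<times> 'd \<Rightarrow> 'w \<times> 'd \<Rightarrow> bool" where
  "fle (w, p) (v, r) \<longleftrightarrow> le w v \<and> p \<in> D w \<and> r \<in> D v \<and>
    (\<forall>u y. le v u \<longrightarrow> y \<in> D u \<longrightarrow> cond u r y \<longrightarrow> cond u p y)"

definition fD :: "'w \<times> 'd \<Rightarrow> 'd set" where "fD a = D (fst a)"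

definition fmem :: "'w \<times> 'd \<Rightarrow> 'd \<Rightarrow> 'd \<Rightarrow> bool" where
  "fmem a x z \<longleftrightarrow> frc (\<lambda>v _. mem v x z) (fst a) (snd a)"

definition feq :: "'w \<times> 'd \<Rightarrow> 'd \<Rightarrow> 'd \<Rightarrow> bool" where
  "feq a x z \<longleftrightarrow> frc (\<lambda>v _. eq v x z) (fst a) (snd a)"

definition fgoal :: "'w \<times> 'd \<Rightarrow> 'd \<Rightarrow> bool" where
  "fgoal a g \<longleftrightarrow> frc (\<lambda>v y. goal v g y) (fst a) (snd a)"

text \<open>The impredicative encoding of disjunction and existence, with the quantifier over truth
  values cut down to goals.\<close>

definition fJ :: "('w \<times> 'd \<Rightarrow> bool) \<Rightarrow> 'w \<times> 'd \<Rightarrow> bool" where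
  "fJ X a \<longleftrightarrow> (\<forall>b g. fle a b \<longrightarrow> g \<in> fD b \<longrightarrow> (\<forall>c. fle b c \<longrightarrow> X c \<longrightarrow> fgoal c g) \<longrightarrow> fgoal b g)"

lemma fD_simp [simp]: "fD (w, p) = D w"
  by (simp add: fD_def)

lemma fle_left: "fle a b \<Longrightarrow> fle a a"
  by (cases a; cases b) (auto intro: le_left)

lemma fle_right: "fle a b \<Longrightarrow> fle b b"
  by (cases a; cases b) (auto intro: le_right)

lemma fle_trans: "fle a b \<Longrightarrow> fle b c \<Longrightarrow> fle a c"
proof (cases a; cases b; cases c)
  fix w p v r u s assume h: "fle a b" "fle b c" "a = (w, p)" "b = (v, r)" "c = (u, s)"
  then show "fle a c" using le_trans[of w v u] le_trans[of v u] by simp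
qed

lemma fle_refl: "le w w \<Longrightarrow> p \<in> D w \<Longrightarrow> fle (w, p) (w, p)"
  by simp

lemma fle_world: "le w v \<Longrightarrow> p \<in> D w \<Longrightarrow> fle (w, p) (v, p)"
  using D_mono by simp

lemma frc_mono:
  assumes "fle (w, p) (v, r)" "frc \<phi> w p"
  shows "frc \<phi> v r"
proof -
  obtain y where y: "y \<in> D w" "\<And>v. le w v \<Longrightarrow> cond v p y \<Longrightarrow> \<phi> v y"
    using assms(2) unfolding frc_def by blast
  have "\<phi> u y" if "le v u" "cond u r y" for u
    using y that assms(1) le_trans[of w v u] D_mono[of w u y] by simp
  then show ?thesis using y(1) D_mono[of w v y] assms(1) unfolding frc_def by auto
qed

lemma frc_true: "p \<in> D w \<Longrightarrow> (\<And>v. le w v \<Longrightarrow> \<phi> v p) \<Longrightarrow> frc \<phi> w p"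
  unfolding frc_def by blast

text \<open>Enlarging the bound strengthens the premise, by \<open>cond_antimono\<close>, and
  preserves the conclusion, by \<open>mono_bound\<close>. Any bound can thus be moved above a
  prescribed set, which is how several bounds are merged.\<close>

lemma frc_above:
  assumes "le w w" "frc \<phi> w p" "mono_bound w \<phi>" "y0 \<in> D w"
  obtains y where "y \<in> D w" "sub w y0 y" "\<And>v. le w v \<Longrightarrow> cond v p y \<Longrightarrow> \<phi> v y"
proof -
  obtain y where y: "y \<in> D w" "\<And>v. le w v \<Longrightarrow> cond v p y \<Longrightarrow> \<phi> v y"
    using assms(2) unfolding frc_def by blast
  obtain z where z: "z \<in> D w" "sub w y z" "sub w y0 z"
    using upper_bound2[OF assms(1) y(1) assms(4)] by blast
  have "\<phi> v z" if "le w v" "cond v p z" for v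
    using assms(3) y(2)[OF that(1) cond_antimono[OF le_right[OF that(1)] sub_mono[OF that(1) z(2)] that(2)]]
      sub_mono[OF that(1) z(2)] that(1) unfolding mono_bound_def by blast
  then show thesis using that z by blast
qed

lemma frc_map:
  assumes "frc \<phi> w p" "\<And>v y. le w v \<Longrightarrow> \<phi> v y \<Longrightarrow> \<chi> v y"
  shows "frc \<chi> w p"
  using assms unfolding frc_def by blast

lemma frc_map2:
  assumes "le w w" "frc \<phi> w p" "frc \<psi> w p" "mono_bound w \<phi>" "mono_bound w \<psi>"
    "\<And>v y. le w v \<Longrightarrow> \<phi> v y \<Longrightarrow> \<psi> v y \<Longrightarrow> \<chi> v y"
  shows "frc \<chi> w p"
proof -
  obtain y where y: "y \<in> D w" "\<And>v. le w v \<Longrightarrow> cond v p y \<Longrightarrow> \<phi> v y"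
    using assms(2) unfolding frc_def by blast
  obtain z where z: "z \<in> D w" "sub w y z" "\<And>v. le w v \<Longrightarrow> cond v p z \<Longrightarrow> \<psi> v z"
    using frc_above[OF assms(1,3,5) y(1)] by blast
  have "\<phi> v z" if "le w v" "cond v p z" for v
    using assms(4) y(2)[OF that(1) cond_antimono[OF le_right[OF that(1)] sub_mono[OF that(1) z(2)] that(2)]]
      sub_mono[OF that(1) z(2)] that(1) unfolding mono_bound_def by blast
  then show ?thesis using z assms(6) unfolding frc_def by blast
qed

lemma mono_bound_const [simp]: "mono_bound w (\<lambda>v _. \<phi> v)"
  by (simp add: mono_bound_def)

lemma frc_map2_const:
  assumes "le w w" "frc (\<lambda>v _. \<phi> v) w p" "frc (\<lambda>v _. \<psi> v) w p"
    "\<And>v. le v v \<Longrightarrow> \<phi> v \<Longrightarrow> \<psi> v \<Longrightarrow> \<chi> v"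
  shows "frc (\<lambda>v _. \<chi> v) w p"
  by (rule frc_map2[OF assms(1-3)]) (use assms(4) le_right in auto)

lemma mono_bound_goal [simp]: "mono_bound w (\<lambda>v y. goal v g y)"
  unfolding mono_bound_def using goal_mono_bound le_right by blast

lemma mono_bound_rsat: "SigmaE A \<Longrightarrow> mono_bound w (\<lambda>v y. rsat A v \<rho> y)"
  unfolding mono_bound_def using rsat_sub(1) le_right by blast

lemma fgoal_pair [simp]: "fgoal (w, p) g = frc (\<lambda>v y. goal v g y) w p"
  by (simp add: fgoal_def)

text \<open>Collection yields a set of bounds; its union includes each of them, and monotonicity
  makes this one set serve all elements of \<open>a\<close>.\<close>

lemma uniform_bound:
  assumes "le w w" "a \<in> D w" "Delta0E A" "env w \<rho>" "x \<noteq> Y"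
    and ex: "\<And>v d. le w v \<Longrightarrow> d \<in> D v \<Longrightarrow> mem v d a \<Longrightarrow> \<exists>y\<in>D v. sat A v (\<rho>(x := d, Y := y))"
    and mono: "\<And>v d y y'. le w v \<Longrightarrow> d \<in> D v \<Longrightarrow> y \<in> D v \<Longrightarrow> y' \<in> D v \<Longrightarrow> sub v y y' \<Longrightarrow>
      sat A v (\<rho>(x := d, Y := y)) \<Longrightarrow> sat A v (\<rho>(x := d, Y := y'))"
  shows "\<exists>y\<in>D w. \<forall>v. le w v \<longrightarrow> (\<forall>d\<in>D v. mem v d a \<longrightarrow> sat A v (\<rho>(x := d, Y := y)))"
proof -
  obtain c where c: "c \<in> D w"
    "\<And>v d. le w v \<Longrightarrow> d \<in> D v \<Longrightarrow> mem v d a \<Longrightarrow> \<exists>e\<in>D v. mem v e c \<and> sat A v (\<rho>(x := d, Y := e))"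
    using collection[OF assms(1-5) ex] by blast
  obtain z where z: "z \<in> D w"
    "\<And>v x y. le w v \<Longrightarrow> x \<in> D v \<Longrightarrow> y \<in> D v \<Longrightarrow> mem v x y \<Longrightarrow> mem v y c \<Longrightarrow> mem v x z"
    using union_superset[OF assms(1) c(1)] by blast
  have "sat A v (\<rho>(x := d, Y := z))" if v: "le w v" "d \<in> D v" "mem v d a" for v d
  proof -
    obtain e where e: "e \<in> D v" "mem v e c" "sat A v (\<rho>(x := d, Y := e))" using c(2) v by blast
    have "sub v e z"
      unfolding sub_def using z(2) le_trans[OF v(1)] e(1,2) D_mono mem_mono by blast
    then show ?thesis using mono v e z(1) D_mono by blast
  qed
  then show ?thesis using z(1) by blast
qed

text \<open>Each \<open>d\<close> comes with its own bound. The implication from the relativised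
  condition to relativised \<open>A\<close> is Delta_0 and monotone in the bound, so one bound for
  all of \<open>a\<close> can be collected.\<close>

lemma uniform_rsat:
  assumes w: "le w w" "a \<in> D w" "p \<in> D w" "env w \<rho>" and A: "SigmaE A"
    and ex: "\<And>v d. le w v \<Longrightarrow> d \<in> D v \<Longrightarrow> mem v d a \<Longrightarrow> frc (\<lambda>u y. rsat A u (\<rho>(x := d)) y) v p"
  shows "frc (\<lambda>v y. \<forall>d\<in>D v. mem v d a \<longrightarrow> rsat A v (\<rho>(x := d)) y) w p"
proof -
  obtain P where P: "P \<ge> q + 3" "P \<notin> vars A" "P \<noteq> x" using fresh_above[of "q + 3" A "[x]"] by auto
  obtain Y where Y: "Y \<ge> q + 3" "Y \<notin> vars A" "Y \<noteq> x" "Y \<noteq> P"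
    using fresh_above[of "q + 3" A "[x, P]"] by auto
  let ?A = "Imp (cond_def_fm P Y) (rel Y A)"
  have s: "sat ?A v (\<rho>(P := p, x := d, Y := y)) \<longleftrightarrow>
      (\<forall>u. le v u \<longrightarrow> cond u p y \<longrightarrow> rsat A u (\<rho>(x := d)) y)"
    if v: "le w v" "d \<in> D v" "y \<in> D v" for v d y
  proof -
    have "sat (cond_def_fm P Y) u (\<rho>(P := p, x := d, Y := y)) = cond u p y" if "le v u" for u
    proof -
      have "env v (\<rho>(P := p, x := d, Y := y))"
        using env_upd[OF env_upd[OF env_upd[OF env_mono[OF v(1) w(4)] D_mono[OF v(1) w(3)]] v(2)] v(3)] .
      then show ?thesis
        using sat_cond_def_fm[OF P(1) Y(1) le_right[OF that] env_mono[OF that]] P Y by simp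
    qed
    moreover have "sat (rel Y A) u (\<rho>(P := p, x := d, Y := y)) = rsat A u (\<rho>(x := d)) y" for u
      unfolding sat_rel[OF Y(2)] by simp (rule rsat_coincidence, use P Y in auto)
    ultimately show ?thesis by simp
  qed
  have "Delta0E ?A" by (simp add: cond_def_fm_def Delta0E_rel)
  moreover have "env w (\<rho>(P := p))" using w by simp
  ultimately have "\<exists>y\<in>D w. \<forall>v. le w v \<longrightarrow> (\<forall>d\<in>D v. mem v d a \<longrightarrow> sat ?A v (\<rho>(P := p, x := d, Y := y)))"
  proof (rule uniform_bound[OF w(1,2)])
    show "x \<noteq> Y" using Y by simp
    show "\<exists>y\<in>D v. sat ?A v (\<rho>(P := p, x := d, Y := y))" if "le w v" "d \<in> D v" "mem v d a" for v d
      using ex[OF that] s[OF that(1,2)] unfolding frc_def by blast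
    fix v d y y'
    assume h: "le w v" "d \<in> D v" "y \<in> D v" "y' \<in> D v" "sub v y y'" "sat ?A v (\<rho>(P := p, x := d, Y := y))"
    show "sat ?A v (\<rho>(P := p, x := d, Y := y'))"
      unfolding s[OF h(1,2,4)]
    proof (intro HOL.allI impI)
      fix u assume u: "le v u" "cond u p y'"
      have "cond u p y" using cond_antimono[OF le_right[OF u(1)] sub_mono[OF u(1) h(5)] u(2)] .
      then have "rsat A u (\<rho>(x := d)) y" using h(6) u(1) unfolding s[OF h(1-3)] by blast
      then show "rsat A u (\<rho>(x := d)) y'"
        using rsat_sub(1)[OF A le_right[OF u(1)] sub_mono[OF u(1) h(5)]] by blast
    qed
  qed
  then obtain y where y: "y \<in> D w" "\<And>v d. le w v \<Longrightarrow> d \<in> D v \<Longrightarrow> mem v d a \<Longrightarrow>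
      sat ?A v (\<rho>(P := p, x := d, Y := y))" by blast
  have "\<forall>d\<in>D v. mem v d a \<longrightarrow> rsat A v (\<rho>(x := d)) y" if "le w v" "cond v p y" for v
    using y(2)[OF that(1)] s[OF that(1) _ D_mono[OF that(1) y(1)]] that le_right by blast
  then show ?thesis using y(1) unfolding frc_def by blast
qed

text \<open>As \<open>uniform_rsat\<close>, with an extra Pi premise, which is antitone in the bound
  just as \<open>cond\<close> is.\<close>

lemma uniform_goal:
  assumes w: "le w w" "a \<in> D w" "p \<in> D w" "g \<in> D w" "env w \<rho>" and C: "PiE C"
    and ex: "\<And>v d. le w v \<Longrightarrow> d \<in> D v \<Longrightarrow> mem v d a \<Longrightarrow>
      frc (\<lambda>u y. rsat C u (\<rho>(x := d)) y \<longrightarrow> goal u g y) v p"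
  shows "frc (\<lambda>v y. \<forall>d\<in>D v. mem v d a \<longrightarrow> rsat C v (\<rho>(x := d)) y \<longrightarrow> goal v g y) w p"
proof -
  obtain P where P: "P \<ge> q + 3" "P \<notin> vars C" "P \<noteq> x" using fresh_above[of "q + 3" C "[x]"] by auto
  obtain G where G: "G \<ge> q + 3" "G \<notin> vars C" "G \<noteq> x" "G \<noteq> P"
    using fresh_above[of "q + 3" C "[x, P]"] by auto
  obtain Y where Y: "Y \<ge> q + 3" "Y \<notin> vars C" "Y \<noteq> x" "Y \<noteq> P" "Y \<noteq> G"
    using fresh_above[of "q + 3" C "[x, P, G]"] by auto
  let ?A = "Imp (cond_def_fm P Y) (Imp (rel Y C) (goal_def_fm G Y))"
  have s: "sat ?A v (\<rho>(P := p, G := g, x := d, Y := y)) \<longleftrightarrow>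
      (\<forall>u. le v u \<longrightarrow> cond u p y \<longrightarrow> rsat C u (\<rho>(x := d)) y \<longrightarrow> goal u g y)"
    if v: "le w v" "d \<in> D v" "y \<in> D v" for v d y
  proof -
    have e: "env u (\<rho>(P := p, G := g, x := d, Y := y))" if "le v u" for u
      using env_mono[OF that env_upd[OF env_upd[OF env_upd[OF env_upd[OF env_mono[OF v(1) w(5)]
        D_mono[OF v(1) w(3)]] D_mono[OF v(1) w(4)]] v(2)] v(3)]] .
    have "sat (cond_def_fm P Y) u (\<rho>(P := p, G := g, x := d, Y := y)) = cond u p y" if "le v u" for u
      using sat_cond_def_fm[OF P(1) Y(1) le_right[OF that] e[OF that]] P G Y by simp
    moreover have "sat (goal_def_fm G Y) u (\<rho>(P := p, G := g, x := d, Y := y)) = goal u g y" if "le v u" for u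
      using sat_goal_def_fm[OF G(1) Y(1) e[OF that]] P G Y by simp
    moreover have "sat (rel Y C) u (\<rho>(P := p, G := g, x := d, Y := y)) = rsat C u (\<rho>(x := d)) y" for u
      unfolding sat_rel[OF Y(2)] by simp (rule rsat_coincidence, use P G Y in auto)
    ultimately show ?thesis
      by simp (meson cond_world_mono le_right le_trans)
  qed
  have "Delta0E ?A" by (simp add: cond_def_fm_def goal_def_fm_def Delta0E_rel)
  moreover have "env w (\<rho>(P := p, G := g))" using w by simp
  ultimately have "\<exists>y\<in>D w. \<forall>v. le w v \<longrightarrow> (\<forall>d\<in>D v. mem v d a \<longrightarrow> sat ?A v (\<rho>(P := p, G := g, x := d, Y := y)))"
  proof (rule uniform_bound[OF w(1,2)])
    show "x \<noteq> Y" using Y by simp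
    show "\<exists>y\<in>D v. sat ?A v (\<rho>(P := p, G := g, x := d, Y := y))" if "le w v" "d \<in> D v" "mem v d a" for v d
      using ex[OF that] s[OF that(1,2)] unfolding frc_def by blast
    fix v d y y'
    assume h: "le w v" "d \<in> D v" "y \<in> D v" "y' \<in> D v" "sub v y y'"
      "sat ?A v (\<rho>(P := p, G := g, x := d, Y := y))"
    show "sat ?A v (\<rho>(P := p, G := g, x := d, Y := y'))"
      unfolding s[OF h(1,2,4)]
    proof (intro HOL.allI impI)
      fix u assume u: "le v u" "cond u p y'" "rsat C u (\<rho>(x := d)) y'"
      have su: "sub u y y'" using sub_mono[OF u(1) h(5)] .
      have "cond u p y" using cond_antimono[OF le_right[OF u(1)] su u(2)] .
      moreover have "rsat C u (\<rho>(x := d)) y" using rsat_sub(2)[OF C le_right[OF u(1)] su u(3)] .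
      ultimately have "goal u g y" using h(6) u(1) unfolding s[OF h(1-3)] by blast
      then show "goal u g y'" using goal_mono_bound[OF le_right[OF u(1)] su] by blast
    qed
  qed
  then obtain y where y: "y \<in> D w" "\<And>v d. le w v \<Longrightarrow> d \<in> D v \<Longrightarrow> mem v d a \<Longrightarrow>
      sat ?A v (\<rho>(P := p, G := g, x := d, Y := y))" by blast
  have "\<forall>d\<in>D v. mem v d a \<longrightarrow> rsat C v (\<rho>(x := d)) y \<longrightarrow> goal v g y" if "le w v" "cond v p y" for v
    using y(2)[OF that(1)] s[OF that(1) _ D_mono[OF that(1) y(1)]] that le_right by blast
  then show ?thesis using y(1) unfolding frc_def by blast
qed

text \<open>Independence of premise for the \<open>\<Delta>\<^sub>0\<close> premise \<^term>\<open>cond v p y\<close>: it is decided by a subset of a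
  singleton, over which one can collect.\<close>

lemma fgoal_local:
  assumes w: "le w w" "p \<in> D w" "g \<in> D w" "y \<in> D w"
    and h: "\<And>v. le w v \<Longrightarrow> cond v p y \<Longrightarrow> fgoal (v, p) g"
  shows "fgoal (w, p) g"
proof -
  have env: "env w ((\<lambda>_. p)(q + 4 := y))" using w env_const by simp
  have "Delta0E (cond_def_fm (q + 3) (q + 4))" by (simp add: cond_def_fm_def)
  then obtain s where s: "s \<in> D w"
    "\<And>v. le w v \<Longrightarrow> inh v s \<longleftrightarrow> sat (cond_def_fm (q + 3) (q + 4)) v ((\<lambda>_. p)(q + 4 := y))"
    using truth_value_set[OF w(1) _ env] by blast
  have c: "inh v s \<longleftrightarrow> cond v p y" if "le w v" for v
    using s(2)[OF that] sat_cond_def_fm[of "q + 3" "q + 4" v, OF _ _ le_right[OF that] env_mono[OF that env]] by simp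
  \<comment> \<open>The quantifier over elements of \<open>s\<close> expresses the premise; the slot
    for a Pi formula is filled with a trivial one.\<close>
  have "frc (\<lambda>v z. \<forall>d\<in>D v. mem v d s \<longrightarrow> rsat (Imp Bot Bot) v ((\<lambda>_. p)(0 := d)) z \<longrightarrow> goal v g z) w p"
  proof (rule uniform_goal[OF w(1) s(1) w(2,3) env_const[OF w(2)]])
    show "PiE (Imp Bot Bot)" by (rule P_d0) simp
    fix v d assume v: "le w v" "d \<in> D v" "mem v d s"
    then have "cond v p y" using c unfolding inh_def by blast
    then show "frc (\<lambda>u z. rsat (Imp Bot Bot) u ((\<lambda>_. p)(0 := d)) z \<longrightarrow> goal u g z) v p"
      using h[OF v(1)] by simp
  qed
  then have f: "frc (\<lambda>v z. inh v s \<longrightarrow> goal v g z) w p"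
    by (rule frc_map) (auto simp: inh_def)
  have "mono_bound w (\<lambda>v z. inh v s \<longrightarrow> goal v g z)"
    using mono_bound_goal[of w g] unfolding mono_bound_def by blast
  \<comment> \<open>Since \<open>z\<close> lies above \<open>y\<close>, \<open>cond v p z\<close>
    implies \<open>cond v p y\<close>, and thereby the premise \<open>inh v s\<close>.\<close>
  then obtain z where z: "z \<in> D w" "sub w y z"
    "\<And>v. le w v \<Longrightarrow> cond v p z \<Longrightarrow> inh v s \<longrightarrow> goal v g z" using frc_above[OF w(1) f _ w(4)] by blast
  have "goal v g z" if "le w v" "cond v p z" for v
    using z(3)[OF that] c[OF that(1)] cond_antimono[OF le_right[OF that(1)] sub_mono[OF that(1) z(2)] that(2)]
    by blast
  then show ?thesis using z(1) unfolding fgoal_pair frc_def by blast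
qed

text \<open>The code agrees with \<open>A\<close> only above its threshold \<open>y0\<close>. On
  both sides the bound can be moved above it, because goals and relativised Sigma formulas are
  monotone.\<close>

lemma sigma_goal:
  assumes "A \<in> set Fs" "SigmaE A" "le w w" "env w \<rho>"
  shows "\<exists>g\<in>D w. \<forall>v r. le w v \<longrightarrow> r \<in> D v \<longrightarrow> (fgoal (v, r) g \<longleftrightarrow> frc (\<lambda>u y. rsat A u \<rho> y) v r)"
proof -
  obtain g y0 where g: "g \<in> D w" "y0 \<in> D w"
    "\<And>v y. le w v \<Longrightarrow> y \<in> D v \<Longrightarrow> sub v y0 y \<Longrightarrow> goal v g y \<longleftrightarrow> rsat A v \<rho> y"
    using goal_code[OF assms] by blast
  have "fgoal (v, r) g \<longleftrightarrow> frc (\<lambda>u y. rsat A u \<rho> y) v r" if v: "le w v" "r \<in> D v" for v r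
  proof -
    have 1: "frc \<psi> v r" if "frc \<phi> v r" "mono_bound v \<phi>"
      "\<And>u y. le v u \<Longrightarrow> y \<in> D u \<Longrightarrow> sub u y0 y \<Longrightarrow> \<phi> u y \<Longrightarrow> \<psi> u y" for \<phi> \<psi>
    proof -
      note m0 = that(1,2) and m = that(3)
      obtain y where y: "y \<in> D v" "sub v y0 y" "\<And>u. le v u \<Longrightarrow> cond u r y \<Longrightarrow> \<phi> u y"
        using frc_above[OF le_right[OF v(1)] m0 D_mono[OF v(1) g(2)]] by blast
      have "\<psi> u y" if u: "le v u" "cond u r y" for u
        by (rule m[OF u(1) D_mono[OF u(1) y(1)] sub_mono[OF u(1) y(2)] y(3)[OF u]])
      then show ?thesis using y(1) unfolding frc_def by blast
    qed
    have 2: "goal u g y \<longleftrightarrow> rsat A u \<rho> y" if "le v u" "y \<in> D u" "sub u y0 y" for u y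
      using g(3)[OF le_trans[OF v(1) that(1)] that(2,3)] .
    show ?thesis
      unfolding fgoal_pair
    proof
      assume "frc (\<lambda>u y. goal u g y) v r"
      then show "frc (\<lambda>u y. rsat A u \<rho> y) v r" by (rule 1[OF _ mono_bound_goal]) (simp add: 2)
    next
      assume "frc (\<lambda>u y. rsat A u \<rho> y) v r"
      then show "frc (\<lambda>u y. goal u g y) v r" by (rule 1[OF _ mono_bound_rsat[OF assms(2)]]) (simp add: 2)
    qed
  qed
  then show ?thesis using g(1) by blast
qed

lemma rsat_inh_fm [simp]: "u \<noteq> s \<Longrightarrow> rsat (inh_fm u s) v \<rho> y = inh v (\<rho> s)"
  by (simp add: inh_fm_def inh_def)

lemma Delta0E_inh_fm: "Delta0E (inh_fm u s)"
  by (simp add: inh_fm_def)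

text \<open>The statement is replaced by its truth value, of which \<open>inh_fm 1 0\<close> is a
  coded assertion; \<open>delta_cond\<close> does the same on the side of conditions.\<close>

lemma delta_goal:
  assumes "Delta0E A" "le w w" "env w \<rho>"
  shows "\<exists>g\<in>D w. \<forall>v r. le w v \<longrightarrow> r \<in> D v \<longrightarrow> (fgoal (v, r) g \<longleftrightarrow> frc (\<lambda>u _. sat A u \<rho>) v r)"
proof -
  obtain s where s: "s \<in> D w" "\<And>v. le w v \<Longrightarrow> inh v s \<longleftrightarrow> sat A v \<rho>"
    using truth_value_set[OF assms(2,1,3)] by blast
  obtain g where g: "g \<in> D w" "\<And>v r. le w v \<Longrightarrow> r \<in> D v \<Longrightarrow>
      fgoal (v, r) g \<longleftrightarrow> frc (\<lambda>u y. rsat (inh_fm 1 0) u (\<lambda>_. s) y) v r"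
    using sigma_goal[OF inh_Fs S_d0[OF Delta0E_inh_fm] assms(2) env_const[OF s(1)]] by blast
  have "frc (\<lambda>u y. rsat (inh_fm 1 0) u (\<lambda>_. s) y) v r \<longleftrightarrow> frc (\<lambda>u _. sat A u \<rho>) v r" if "le w v" for v r
    unfolding frc_def using s(2) le_trans[OF that] by simp
  then show ?thesis using g by blast
qed

lemma delta_cond:
  assumes "Delta0E A" "le w w" "env w \<rho>"
  shows "\<exists>p\<in>D w. \<exists>y0\<in>D w. \<forall>v y. le w v \<longrightarrow> y \<in> D v \<longrightarrow> sub v y0 y \<longrightarrow> (cond v p y \<longleftrightarrow> sat A v \<rho>)"
proof -
  obtain s where s: "s \<in> D w" "\<And>v. le w v \<Longrightarrow> inh v s \<longleftrightarrow> sat A v \<rho>"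
    using truth_value_set[OF assms(2,1,3)] by blast
  then show ?thesis
    using cond_code[OF inh_Fs P_d0[OF Delta0E_inh_fm] assms(2) env_const[OF s(1)]] by simp
qed

section \<open>Elimination and introduction of the closure operator\<close>

lemma fJ_elim:
  assumes "fJ X a" "fle a b" "g \<in> fD b" "\<And>c. fle b c \<Longrightarrow> X c \<Longrightarrow> fgoal c g"
  shows "fgoal b g"
  using assms unfolding fJ_def by blast

text \<open>A forced relativised Sigma formula is equivalent to a goal, so the definition of
  \<open>fJ\<close> can be instantiated with it.\<close>

lemma fJ_sigma:
  assumes "A \<in> set Fs" "SigmaE A" "le w w" "env w \<rho>" "p \<in> D w" "fJ X (w, p)"
    "\<And>v r. fle (w, p) (v, r) \<Longrightarrow> X (v, r) \<Longrightarrow> frc (\<lambda>u y. rsat A u \<rho> y) v r"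
  shows "frc (\<lambda>u y. rsat A u \<rho> y) w p"
proof -
  obtain g where g: "g \<in> D w" "\<And>v r. le w v \<Longrightarrow> r \<in> D v \<Longrightarrow>
      fgoal (v, r) g \<longleftrightarrow> frc (\<lambda>u y. rsat A u \<rho> y) v r"
    using sigma_goal[OF assms(1-4)] by blast
  have "fgoal (w, p) g"
  proof (rule fJ_elim[OF assms(6) fle_refl[OF assms(3,5)]])
    show "g \<in> fD (w, p)" using g(1) by simp
    show "fgoal c g" if "fle (w, p) c" "X c" for c
      using that assms(7) g(2) by (cases c) auto
  qed
  then show ?thesis using g(2) assms(3,5) by blast
qed

lemma fJ_delta:
  assumes "Delta0E A" "le w w" "env w \<rho>" "p \<in> D w" "fJ X (w, p)"
    "\<And>v r. fle (w, p) (v, r) \<Longrightarrow> X (v, r) \<Longrightarrow> frc (\<lambda>u _. sat A u \<rho>) v r"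
  shows "frc (\<lambda>u _. sat A u \<rho>) w p"
proof -
  obtain g where g: "g \<in> D w" "\<And>v r. le w v \<Longrightarrow> r \<in> D v \<Longrightarrow>
      fgoal (v, r) g \<longleftrightarrow> frc (\<lambda>u _. sat A u \<rho>) v r"
    using delta_goal[OF assms(1-3)] by blast
  have "fgoal (w, p) g"
  proof (rule fJ_elim[OF assms(5) fle_refl[OF assms(2,4)]])
    show "g \<in> fD (w, p)" using g(1) by simp
    show "fgoal c g" if "fle (w, p) c" "X c" for c
      using that assms(6) g(2) by (cases c) auto
  qed
  then show ?thesis using g(2) assms(2,4) by blast
qed

text \<open>By \<open>fgoal_local\<close> a goal may be proved under the premise
  \<open>cond\<close>. Hence it is enough to have \<open>X\<close> at the later worlds where the
  premise holds, even if no witness is available at \<open>w\<close> itself.\<close>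

lemma fJ_local:
  assumes "le w w" "p \<in> D w" "y \<in> D w" "\<And>v. le w v \<Longrightarrow> cond v p y \<Longrightarrow> X (v, p)"
    "\<And>a b. fle a b \<Longrightarrow> X a \<Longrightarrow> X b"
  shows "fJ X (w, p)"
  unfolding fJ_def
proof (intro HOL.allI impI)
  fix b g assume b: "fle (w, p) b" "g \<in> fD b" "\<forall>c. fle b c \<longrightarrow> X c \<longrightarrow> fgoal c g"
  obtain v r where v: "b = (v, r)" by fastforce
  have wv: "le w v" "r \<in> D v" using b(1) v by simp_all
  show "fgoal b g"
    unfolding v
  proof (rule fgoal_local[OF le_right[OF wv(1)] wv(2)])
    show "g \<in> D v" "y \<in> D v" using b(2) v D_mono[OF wv(1) assms(3)] by simp_all
    fix u assume u: "le v u" "cond u r y"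
    have wu: "le w u" using le_trans[OF wv(1) u(1)] .
    have "cond u p y" using b(1) u D_mono[OF wu assms(3)] unfolding v by simp
    then have "X (u, p)" by (rule assms(4)[OF wu])
    moreover have "fle (u, p) (u, r)"
      using b(1) v u(1) wu D_mono[OF wu assms(2)] D_mono[OF u(1) wv(2)] le_right[OF u(1)] le_trans[OF u(1)]
      by simp
    ultimately have "X (u, r)" using assms(5) by blast
    then show "fgoal (u, r) g" using b(3) fle_world[OF u(1) wv(2)] v by blast
  qed
qed

text \<open>Atoms are closed under \<open>fJ\<close> because, being Delta_0, they are equivalent to
  goals; the closure laws of \<open>fJ\<close> come from its impredicative form.\<close>

sublocale F: kripke fle fD fmem feq fJ
proof
  show "fle w v \<Longrightarrow> fle w w" for w v by (rule fle_left)
  show "fle w v \<Longrightarrow> fle v v" for w v by (rule fle_right)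
  show "fle w v \<Longrightarrow> fle v u \<Longrightarrow> fle w u" for w v u by (rule fle_trans)
  show "fle w v \<Longrightarrow> d \<in> fD w \<Longrightarrow> d \<in> fD v" for w v d by (cases w; cases v) (auto intro: D_mono)
  show "fle w v \<Longrightarrow> fmem w a b \<Longrightarrow> fmem v a b" for w v a b
    unfolding fmem_def by (cases w; cases v) (simp del: fle.simps add: frc_mono)
  show "fle w v \<Longrightarrow> feq w a b \<Longrightarrow> feq v a b" for w v a b
    unfolding feq_def by (cases w; cases v) (simp del: fle.simps add: frc_mono)
  show "fle w w \<Longrightarrow> a \<in> fD w \<Longrightarrow> feq w a a" for w a
    unfolding feq_def by (cases w) (auto intro!: frc_true eq_refl intro: D_mono le_right)
  show "fle w w \<Longrightarrow> feq w a b \<Longrightarrow> feq w a c \<Longrightarrow> feq w b c" for w a b c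
    unfolding feq_def fmem_def
    by (cases w, simp, elim conjE, rule frc_map2_const, assumption+, rule eq_eq1)
  show "fle w w \<Longrightarrow> feq w a b \<Longrightarrow> feq w c a \<Longrightarrow> feq w c b" for w a b c
    unfolding feq_def fmem_def
    by (cases w, simp, elim conjE, rule frc_map2_const, assumption+, rule eq_eq2)
  show "fle w w \<Longrightarrow> feq w a b \<Longrightarrow> fmem w a c \<Longrightarrow> fmem w b c" for w a b c
    unfolding feq_def fmem_def
    by (cases w, simp, elim conjE, rule frc_map2_const, assumption+, rule eq_mem1)
  show "fle w w \<Longrightarrow> feq w a b \<Longrightarrow> fmem w c a \<Longrightarrow> fmem w c b" for w a b c
    unfolding feq_def fmem_def
    by (cases w, simp, elim conjE, rule frc_map2_const, assumption+, rule eq_mem2)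
  show "fJ X w" if "fle w w" "\<And>v. fle w v \<Longrightarrow> X v" for X w
    unfolding fJ_def using that fle_right by blast
  show "fJ Y w" if "fle w w" "fJ X w" "\<And>v. fle w v \<Longrightarrow> X v \<Longrightarrow> fJ Y v" for X Y w
    unfolding fJ_def
  proof (intro HOL.allI impI)
    fix b g assume b: "fle w b" "g \<in> fD b" "\<forall>c. fle b c \<longrightarrow> Y c \<longrightarrow> fgoal c g"
    show "fgoal b g"
    proof (rule fJ_elim[OF that(2) b(1,2)])
      fix c assume c: "fle b c" "X c"
      have "fJ Y c" using that(3) c b(1) fle_trans by blast
      moreover have "g \<in> fD c" using b(2) c(1) by (cases b; cases c) (auto intro: D_mono)
      ultimately show "fgoal c g" using fJ_elim[of Y c c g] fle_right c(1) fle_trans b(3) by blast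
    qed
  qed
  show "fJ X v" if "fle w v" "fJ X w" for X w v
    using that fle_trans unfolding fJ_def by blast
  show "fmem w a b" if "fle w w" "a \<in> fD w" "b \<in> fD w" "fJ (\<lambda>v. fmem v a b) w" for w a b
  proof -
    obtain v p where v: "w = (v, p)" by fastforce
    have "env v ((\<lambda>_. a)(1 := b))" using that v env_const by simp
    from fJ_delta[of "Mem 0 1", OF _ _ this, of p "\<lambda>v. fmem v a b"] show ?thesis
      using that v by (simp add: fmem_def del: fun_upd_apply) (simp add: fmem_def)
  qed
  show "feq w a b" if "fle w w" "a \<in> fD w" "b \<in> fD w" "fJ (\<lambda>v. feq v a b) w" for w a b
  proof -
    obtain v p where v: "w = (v, p)" by fastforce
    have "env v ((\<lambda>_. a)(1 := b))" using that v env_const by simp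
    from fJ_delta[of "Eq 0 1", OF _ _ this, of p "\<lambda>v. feq v a b"] show ?thesis
      using that v by (simp add: feq_def del: fun_upd_apply) (simp add: feq_def)
  qed
qed

section \<open>Absoluteness of Delta_0 formulas\<close>

declare fle.simps [simp del]

lemma fleI: "le w v \<Longrightarrow> p \<in> D w \<Longrightarrow> r \<in> D v \<Longrightarrow>
    (\<And>u y. le v u \<Longrightarrow> y \<in> D u \<Longrightarrow> cond u r y \<Longrightarrow> cond u p y) \<Longrightarrow> fle (w, p) (v, r)"
  by (simp add: fle.simps)

lemma fleD: "fle (w, p) (v, r) \<Longrightarrow> le w v" "fle (w, p) (v, r) \<Longrightarrow> p \<in> D w"
    "fle (w, p) (v, r) \<Longrightarrow> r \<in> D v" "fle (w, p) (v, r) \<Longrightarrow> le w w" "fle (w, p) (v, r) \<Longrightarrow> le v v"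
    "fle (w, p) (v, r) \<Longrightarrow> le v u \<Longrightarrow> y \<in> D u \<Longrightarrow> cond u r y \<Longrightarrow> cond u p y"
  by (auto simp: fle.simps intro: le_left le_right)

lemma fle_shift: "fle (w, p) (v, r) \<Longrightarrow> le v u \<Longrightarrow> fle (u, p) (u, r)"
  using fleD(6)[of w p v r] le_trans[of v u]
  by (intro fleI) (auto intro: D_mono[OF le_trans] dest: fleD(1-3) le_right D_mono)

lemma F_env [simp]: "F.env (w, p) \<rho> = env w \<rho>"
  by (simp add: F.env_def env_def)

text \<open>All forced truth values are closed under \<open>fJ\<close>, so \<open>fJ_local\<close>
  extends to arbitrary formulas.\<close>

lemma F_sat_local:
  assumes "le w w" "p \<in> D w" "env w \<rho>" "y \<in> D w" "\<And>v. le w v \<Longrightarrow> cond v p y \<Longrightarrow> F.sat A (v, p) \<rho>"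
  shows "F.sat A (w, p) \<rho>"
  by (rule F.sat_closed[OF fle_refl[OF assms(1,2)] _ fJ_local[OF assms(1,2,4)]])
    (use assms(3,5) F.sat_mono in auto)

lemma frc_up: "frc \<phi> w p \<Longrightarrow> frc (\<lambda>v y. \<forall>u. le v u \<longrightarrow> \<phi> u y) w p"
  unfolding frc_def using le_trans cond_world_mono by blast

lemma fmem_now: "le v v \<Longrightarrow> p \<in> D v \<Longrightarrow> mem v d a \<Longrightarrow> fmem (v, p) d a"
  unfolding fmem_def fst_conv snd_conv by (rule frc_true) (auto intro: mem_mono)

text \<open>Instantiating at the actual elements of \<open>a\<close> suffices, since their guard
  \<open>G\<close> is forced by every condition; \<open>uniform_rsat\<close> then merges the bounds.
  For quantifiers over functions \<open>a\<close> is the set given by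
  \<open>function_set\<close>.\<close>

lemma forall_step:
  assumes w: "le w w" "p \<in> D w" "env w \<rho>" "a \<in> D w" and A: "SigmaE A"
    and G: "\<And>v d. le w v \<Longrightarrow> d \<in> D v \<Longrightarrow> mem v d a \<Longrightarrow> G (v, p) d"
    and s: "\<And>b d. fle (w, p) b \<Longrightarrow> d \<in> fD b \<Longrightarrow> G b d \<Longrightarrow> F.sat A b (\<rho>(x := d))"
    and IH: "\<And>v d. le w v \<Longrightarrow> d \<in> D v \<Longrightarrow> F.sat A (v, p) (\<rho>(x := d)) \<Longrightarrow>
      frc (\<lambda>u y. rsat A u (\<rho>(x := d)) y) v p"
  shows "frc (\<lambda>v y. \<forall>u. le v u \<longrightarrow> (\<forall>d\<in>D u. mem u d a \<longrightarrow> rsat A u (\<rho>(x := d)) y)) w p"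
proof (rule frc_up, rule uniform_rsat[OF w(1,4,2,3) A])
  fix v d assume v: "le w v" "d \<in> D v" "mem v d a"
  have "F.sat A (v, p) (\<rho>(x := d))"
    by (rule s[OF fle_world[OF v(1) w(2)]]) (use v G in auto)
  then show "frc (\<lambda>u y. rsat A u (\<rho>(x := d)) y) v p" by (rule IH[OF v(1,2)])
qed

text \<open>One argument for \<open>BAll\<close> and \<open>EAll\<close>: \<open>gd\<close> is the
  guard in the ground model, \<open>G\<close> its forced version, and \<open>e\<close> a set of
  exactly the guarded elements. Collection over \<open>e\<close> enters only from left to
  right.\<close>

lemma delta_forall:
  assumes w: "le w w" "p \<in> D w" "env w \<rho>" "e \<in> D w" and B: "Delta0E B"
    and e: "\<And>v d. le w v \<Longrightarrow> d \<in> D v \<Longrightarrow> mem v d e \<longleftrightarrow> gd v d"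
    and gd: "\<And>u v d. le u v \<Longrightarrow> gd u d \<Longrightarrow> gd v d"
    and G: "\<And>v r d. le w v \<Longrightarrow> r \<in> D v \<Longrightarrow> d \<in> D v \<Longrightarrow> G (v, r) d \<longleftrightarrow> frc (\<lambda>u _. gd u d) v r"
    and IH: "\<And>v r d. le w v \<Longrightarrow> r \<in> D v \<Longrightarrow> d \<in> D v \<Longrightarrow>
      F.sat B (v, r) (\<rho>(x := d)) \<longleftrightarrow> frc (\<lambda>u _. sat B u (\<rho>(x := d))) v r"
  shows "(\<forall>b. fle (w, p) b \<longrightarrow> (\<forall>d\<in>fD b. G b d \<longrightarrow> F.sat B b (\<rho>(x := d)))) \<longleftrightarrow>
    frc (\<lambda>v _. \<forall>u. le v u \<longrightarrow> (\<forall>d\<in>D u. gd u d \<longrightarrow> sat B u (\<rho>(x := d)))) w p" (is "?L \<longleftrightarrow> ?R")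
proof
  assume L: ?L
  have "frc (\<lambda>v y. \<forall>u. le v u \<longrightarrow> (\<forall>d\<in>D u. mem u d e \<longrightarrow> rsat B u (\<rho>(x := d)) y)) w p"
  proof (rule forall_step[where G = G, OF w S_d0[OF B]])
    fix v d assume v: "le w v" "d \<in> D v"
    note pv = D_mono[OF v(1) w(2)]
    show "G (v, p) d" if "mem v d e"
      unfolding G[OF v(1) pv v(2)] by (rule frc_true[OF pv], rule gd) (use that e[OF v] in auto)
    show "frc (\<lambda>u y. rsat B u (\<rho>(x := d)) y) v p" if "F.sat B (v, p) (\<rho>(x := d))"
      using IH[OF v(1) pv v(2)] that by (simp add: rsat_Delta0E[OF B])
  qed (use L in blast)
  then show ?R
  proof (rule frc_map)
    fix v y assume h: "le w v" "\<forall>u. le v u \<longrightarrow> (\<forall>d\<in>D u. mem u d e \<longrightarrow> rsat B u (\<rho>(x := d)) y)"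
    show "\<forall>u. le v u \<longrightarrow> (\<forall>d\<in>D u. gd u d \<longrightarrow> sat B u (\<rho>(x := d)))"
      using h(2) e[OF le_trans[OF h(1)]] rsat_Delta0E[OF B] by blast
  qed
next
  assume R: ?R
  show ?L
  proof (intro HOL.allI impI ballI)
    fix b d assume b: "fle (w, p) b" "d \<in> fD b" "G b d"
    obtain v r where v: "b = (v, r)" by fastforce
    note f = fleD[OF b(1)[unfolded v]]
    have d: "d \<in> D v" using b(2) v by simp
    have "frc (\<lambda>v _. \<forall>u. le v u \<longrightarrow> (\<forall>d\<in>D u. gd u d \<longrightarrow> sat B u (\<rho>(x := d)))) v r"
      using frc_mono[OF b(1)[unfolded v] R] .
    then have 1: "frc (\<lambda>u _. gd u d \<longrightarrow> sat B u (\<rho>(x := d))) v r"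
      by (rule frc_map) (use le_right D_mono d in blast)
    have "frc (\<lambda>u _. gd u d) v r" using G[OF f(1,3) d] b(3) v by simp
    then have "frc (\<lambda>u _. sat B u (\<rho>(x := d))) v r"
      by (rule frc_map2_const[OF f(5) _ 1]) simp
    then show "F.sat B b (\<rho>(x := d))" using IH[OF f(1,3) d] v by simp
  qed
qed

text \<open>From left to right, the Delta_0 formula \<open>E\<close> acts as a goal. Conversely a
  witness exists only where the relativised condition holds, and \<open>fJ_local\<close> permits
  working there.\<close>

lemma delta_exists:
  assumes E: "Delta0E E" "\<And>v. sat E v \<rho> \<longleftrightarrow> (\<exists>d\<in>D v. gd v d \<and> sat B v (\<rho>(x := d)))"
    and w: "le w w" "p \<in> D w" "env w \<rho>"
    and gd: "\<And>u v d. le u v \<Longrightarrow> gd u d \<Longrightarrow> gd v d"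
    and G: "\<And>v r d. le w v \<Longrightarrow> r \<in> D v \<Longrightarrow> d \<in> D v \<Longrightarrow> G (v, r) d \<longleftrightarrow> frc (\<lambda>u _. gd u d) v r"
    and G_mono: "\<And>b c d. fle b c \<Longrightarrow> G b d \<Longrightarrow> G c d"
    and IH: "\<And>v r d. le w v \<Longrightarrow> r \<in> D v \<Longrightarrow> d \<in> D v \<Longrightarrow>
      F.sat B (v, r) (\<rho>(x := d)) \<longleftrightarrow> frc (\<lambda>u _. sat B u (\<rho>(x := d))) v r"
  shows "fJ (\<lambda>b. \<exists>d\<in>fD b. G b d \<and> F.sat B b (\<rho>(x := d))) (w, p) \<longleftrightarrow> frc (\<lambda>v _. sat E v \<rho>) w p"
proof
  assume J: "fJ (\<lambda>b. \<exists>d\<in>fD b. G b d \<and> F.sat B b (\<rho>(x := d))) (w, p)"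
  show "frc (\<lambda>v _. sat E v \<rho>) w p"
  proof (rule fJ_delta[OF E(1) w(1,3,2) J])
    fix v r assume v: "fle (w, p) (v, r)" "\<exists>d\<in>fD (v, r). G (v, r) d \<and> F.sat B (v, r) (\<rho>(x := d))"
    note f = fleD[OF v(1)]
    obtain d where d: "d \<in> D v" "G (v, r) d" "F.sat B (v, r) (\<rho>(x := d))" using v(2) by auto
    have 1: "frc (\<lambda>u _. gd u d) v r" and 2: "frc (\<lambda>u _. sat B u (\<rho>(x := d))) v r"
      using G[OF f(1,3) d(1)] IH[OF f(1,3) d(1)] d by simp_all
    have "frc (\<lambda>u _. d \<in> D u \<and> sat B u (\<rho>(x := d))) v r"
      by (rule frc_map[OF 2]) (use D_mono d(1) in auto)
    then show "frc (\<lambda>u _. sat E u \<rho>) v r"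
      by (rule frc_map2_const[OF f(5) 1]) (use E(2) in blast)
  qed
next
  assume "frc (\<lambda>v _. sat E v \<rho>) w p"
  then obtain y where y: "y \<in> D w" "\<And>v. le w v \<Longrightarrow> cond v p y \<Longrightarrow> sat E v \<rho>" unfolding frc_def by blast
  show "fJ (\<lambda>b. \<exists>d\<in>fD b. G b d \<and> F.sat B b (\<rho>(x := d))) (w, p)"
  proof (rule fJ_local[OF w(1,2) y(1)])
    fix v assume v: "le w v" "cond v p y"
    obtain d where d: "d \<in> D v" "gd v d" "sat B v (\<rho>(x := d))" using y(2)[OF v] E(2) by blast
    note pv = D_mono[OF v(1) w(2)]
    have "G (v, p) d" unfolding G[OF v(1) pv d(1)] by (rule frc_true[OF pv]) (rule gd[OF _ d(2)])
    moreover have "F.sat B (v, p) (\<rho>(x := d))"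
      unfolding IH[OF v(1) pv d(1)] by (rule frc_true[OF pv]) (rule sat_mono[OF _ d(3)])
    ultimately show "\<exists>d\<in>fD (v, p). G (v, p) d \<and> F.sat B (v, p) (\<rho>(x := d))" using d(1) by auto
  next
    fix b c assume "fle b c" "\<exists>d\<in>fD b. G b d \<and> F.sat B b (\<rho>(x := d))"
    then obtain d where "d \<in> fD b" "G b d" "F.sat B b (\<rho>(x := d))" by blast
    then show "\<exists>d\<in>fD c. G c d \<and> F.sat B c (\<rho>(x := d))"
      using F.D_mono[OF \<open>fle b c\<close>] F.sat_mono[OF \<open>fle b c\<close>] G_mono[OF \<open>fle b c\<close>] by blast
  qed
qed

text \<open>The induction is on \<open>weight\<close> so that its hypothesis also covers
  \<open>fun_fm\<close>, the guard of the exponentiation-bounded quantifiers.\<close>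

lemma sat_delta:
  "Delta0E A \<Longrightarrow> le w w \<Longrightarrow> p \<in> D w \<Longrightarrow> env w \<rho> \<Longrightarrow>
    F.sat A (w, p) \<rho> \<longleftrightarrow> frc (\<lambda>v _. sat A v \<rho>) w p"
proof (induction A arbitrary: w p \<rho> rule: measure_induct_rule[of weight])
  case (less A)
  note w = less.prems(2-4)
  have IH: "F.sat B (v, r) \<sigma> \<longleftrightarrow> frc (\<lambda>v _. sat B v \<sigma>) v r"
    if "weight B < weight A" "Delta0E B" "le v v" "r \<in> D v" "env v \<sigma>" for B v r \<sigma>
    using less.IH that by blast
  have IH_upd: "F.sat B (v, r) (\<rho>(x := d)) \<longleftrightarrow> frc (\<lambda>u _. sat B u (\<rho>(x := d))) v r"
    if "weight B < weight A" "Delta0E B" "le w v" "r \<in> D v" "d \<in> D v" for B v r x d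
    by (rule IH[OF that(1,2) le_right[OF that(3)] that(4) env_upd[OF env_mono[OF that(3) w(3)] that(5)]])
  have isf: "F.is_fun (v, r) d (\<rho> a) (\<rho> b) \<longleftrightarrow> frc (\<lambda>u _. is_fun u d (\<rho> a) (\<rho> b)) v r"
    if "weight (fun_fm 0 1 2) < weight A" "le w v" "r \<in> D v" "d \<in> D v" for v r d a b
    using IH[OF that(1) Delta0E_fun_fm le_right[OF that(2)] that(3), of "(\<lambda>_. d)(1 := \<rho> a, 2 := \<rho> b)"]
      that(4) env_D[OF env_mono[OF that(2) w(3)]]
    by (simp add: F.sat_fun_fm sat_fun_fm env_const)
  show ?case
  proof (cases A)
    case (Mem x y) show ?thesis unfolding Mem F.sat.simps by (simp add: fmem_def)
  next
    case (Eq x y) show ?thesis unfolding Eq F.sat.simps by (simp add: feq_def)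
  next
    case Bot
    show ?thesis
    proof
      assume "F.sat A (w, p) \<rho>"
      then show "frc (\<lambda>v _. sat A v \<rho>) w p"
        unfolding Bot by (intro fJ_delta[OF _ w(1,3,2), of Bot "\<lambda>_. False"]) auto
    next
      assume "frc (\<lambda>v _. sat A v \<rho>) w p"
      then obtain y where "y \<in> D w" "\<And>v. le w v \<Longrightarrow> \<not> cond v p y" unfolding frc_def Bot by auto
      then show "F.sat A (w, p) \<rho>" unfolding Bot using F_sat_local[OF w] by blast
    qed
  next
    case (And B C)
    then have "F.sat A (w, p) \<rho> \<longleftrightarrow> frc (\<lambda>v _. sat B v \<rho>) w p \<and> frc (\<lambda>v _. sat C v \<rho>) w p"
      using IH[of B w p \<rho>] IH[of C w p \<rho>] less.prems by simp
    also have "\<dots> \<longleftrightarrow> frc (\<lambda>v _. sat A v \<rho>) w p"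
    proof (intro iffI conjI)
      show "frc (\<lambda>v _. sat A v \<rho>) w p" if "frc (\<lambda>v _. sat B v \<rho>) w p \<and> frc (\<lambda>v _. sat C v \<rho>) w p"
        by (rule frc_map2_const[OF w(1) conjunct1[OF that] conjunct2[OF that]]) (simp add: And)
      show "frc (\<lambda>v _. sat B v \<rho>) w p" "frc (\<lambda>v _. sat C v \<rho>) w p" if "frc (\<lambda>v _. sat A v \<rho>) w p"
        by (rule frc_map[OF that], simp add: And)+
    qed
    finally show ?thesis .
  next
    case (Or B C)
    have IHs: "F.sat B (v, r) \<rho> \<longleftrightarrow> frc (\<lambda>v _. sat B v \<rho>) v r" "F.sat C (v, r) \<rho> \<longleftrightarrow> frc (\<lambda>v _. sat C v \<rho>) v r"
      if "le w v" "r \<in> D v" for v r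
      using IH[of B v r \<rho>] IH[of C v r \<rho>] Or less.prems(1) le_right[OF that(1)] that(2) env_mono[OF that(1) w(3)]
      by auto
    have "fJ (\<lambda>b. F.sat B b \<rho> \<or> F.sat C b \<rho>) (w, p) \<longleftrightarrow> frc (\<lambda>v _. sat A v \<rho>) w p"
    proof
      assume J: "fJ (\<lambda>b. F.sat B b \<rho> \<or> F.sat C b \<rho>) (w, p)"
      show "frc (\<lambda>v _. sat A v \<rho>) w p"
      proof (rule fJ_delta[OF less.prems(1) w(1,3,2) J])
        fix v r assume v: "fle (w, p) (v, r)" "F.sat B (v, r) \<rho> \<or> F.sat C (v, r) \<rho>"
        then show "frc (\<lambda>v _. sat A v \<rho>) v r"
          using IHs[OF fleD(1,3)[OF v(1)]] frc_map by (auto simp: Or)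
      qed
    next
      assume "frc (\<lambda>v _. sat A v \<rho>) w p"
      then obtain y where y: "y \<in> D w" "\<And>v. le w v \<Longrightarrow> cond v p y \<Longrightarrow> sat A v \<rho>" unfolding frc_def by blast
      show "fJ (\<lambda>b. F.sat B b \<rho> \<or> F.sat C b \<rho>) (w, p)"
      proof (rule fJ_local[OF w(1,2) y(1)])
        fix v assume v: "le w v" "cond v p y"
        note pv = D_mono[OF v(1) w(2)]
        show "F.sat B (v, p) \<rho> \<or> F.sat C (v, p) \<rho>"
          using y(2)[OF v] frc_true[OF pv, of "\<lambda>u _. sat B u \<rho>"] frc_true[OF pv, of "\<lambda>u _. sat C u \<rho>"]
            sat_mono[of v _ B] sat_mono[of v _ C] unfolding IHs[OF v(1) pv] Or by auto
      qed (use F.sat_mono in blast)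
    qed
    then show ?thesis by (simp add: Or)
  next
    case (Imp B C)
    have wt: "weight B < weight A" "weight C < weight A" "Delta0E B" "Delta0E C" using Imp less.prems(1) by auto
    show ?thesis
    proof
      assume s: "F.sat A (w, p) \<rho>"
      \<comment> \<open>\<open>B\<close> itself is coded as a condition and joined to
        \<open>p\<close>. The result forces \<open>B\<close>, hence \<open>C\<close>; moving
        \<open>B\<close> back out of the premise gives the implication.\<close>
      obtain p1 y1 where p1: "p1 \<in> D w" "y1 \<in> D w"
        "\<And>v y. le w v \<Longrightarrow> y \<in> D v \<Longrightarrow> sub v y1 y \<Longrightarrow> cond v p1 y \<longleftrightarrow> sat B v \<rho>"
        using delta_cond[OF wt(3) w(1,3)] by blast
      obtain r where r: "r \<in> D w" "\<And>v y. le w v \<Longrightarrow> cond v r y \<longleftrightarrow> cond v p y \<and> cond v p1 y"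
        using cond_conj[OF w(1,2) p1(1)] by blast
      have pr: "fle (w, p) (w, r)" using w r by (intro fleI) auto
      have "sat B v \<rho>" if "le w v" "cond v r y1" for v
        using p1(3)[OF that(1) D_mono[OF that(1) p1(2)] sub_refl] r(2) that by blast
      then have "frc (\<lambda>v _. sat B v \<rho>) w r" using p1(2) unfolding frc_def by blast
      then have "F.sat B (w, r) \<rho>" using IH[OF wt(1,3) w(1) r(1) w(3)] by simp
      then have "F.sat C (w, r) \<rho>" using s pr unfolding Imp F.sat.simps by blast
      then have f: "frc (\<lambda>v _. sat C v \<rho>) w r" using IH[OF wt(2,4) w(1) r(1) w(3)] by simp
      obtain y where y: "y \<in> D w" "sub w y1 y" "\<And>v. le w v \<Longrightarrow> cond v r y \<Longrightarrow> sat C v \<rho>"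
        using frc_above[OF w(1) f _ p1(2)] by auto
      have "sat A v \<rho>" if v: "le w v" "cond v p y" for v
        unfolding Imp sat.simps
      proof (intro HOL.allI impI)
        fix u assume u: "le v u" "sat B u \<rho>"
        have wu: "le w u" using le_trans v u by blast
        have "cond u p1 y" using p1(3)[OF wu D_mono[OF wu y(1)] sub_mono[OF wu y(2)]] u(2) by blast
        then show "sat C u \<rho>" using y(3)[OF wu] r(2)[OF wu] cond_world_mono[OF u(1) v(2)] by blast
      qed
      then show "frc (\<lambda>v _. sat A v \<rho>) w p" using y(1) unfolding frc_def by blast
    next
      assume s: "frc (\<lambda>v _. sat A v \<rho>) w p"
      show "F.sat A (w, p) \<rho>"
        unfolding Imp F.sat.simps
      proof (intro HOL.allI impI)
        fix b assume b: "fle (w, p) b" "F.sat B b \<rho>"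
        obtain v r where v: "b = (v, r)" by fastforce
        note f = fleD[OF b(1)[unfolded v]] and ev = env_mono[OF fleD(1)[OF b(1)[unfolded v]] w(3)]
        have "frc (\<lambda>v _. sat B v \<rho>) v r" using IH[OF wt(1,3) f(5,3) ev] b(2) v by simp
        then have "frc (\<lambda>v _. sat C v \<rho>) v r"
          by (rule frc_map2_const[OF f(5) _ frc_mono[OF b(1)[unfolded v] s]]) (simp add: Imp)
        then show "F.sat C b \<rho>" using IH[OF wt(2,4) f(5,3) ev] v by simp
      qed
    qed
  next
    case (BAll x t B)
    have wt: "weight B < weight A" "Delta0E B" using BAll less.prems(1) by auto
    show ?thesis
      unfolding BAll F.sat.simps sat.simps
      by (rule delta_forall[OF w env_D[OF w(3)] wt(2)]) (use IH_upd[OF wt] mem_mono in \<open>auto simp: fmem_def\<close>)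
  next
    case (BEx x t B)
    have wt: "weight B < weight A" "Delta0E B" using BEx less.prems(1) by auto
    show ?thesis
      unfolding BEx F.sat.simps
      by (rule delta_exists[where gd = "\<lambda>v d. mem v d (\<rho> t)" and B = B, OF less.prems(1)[unfolded BEx] _ w])
        (use IH_upd[OF wt] mem_mono F.mem_mono in \<open>auto simp: fmem_def\<close>)
  next
    case (EAll x a b B)
    have wt: "weight B < weight A" "Delta0E B" using EAll less.prems(1) by auto
    have wf: "weight (fun_fm 0 1 2) < weight A" using weight_fun_fm[of 0 1 2] EAll by simp
    obtain e where e: "e \<in> D w" "\<And>v f. le w v \<Longrightarrow> f \<in> D v \<Longrightarrow> mem v f e \<longleftrightarrow> is_fun v f (\<rho> a) (\<rho> b)"
      using function_set[OF w(1) env_D[OF w(3)] env_D[OF w(3)]] by blast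
    show ?thesis
      unfolding EAll F.sat.simps sat.simps
      by (rule delta_forall[OF w e(1) wt(2) e(2) is_fun_mono isf[OF wf] IH_upd[OF wt]])
  next
    case (EEx x a b B)
    have wt: "weight B < weight A" "Delta0E B" using EEx less.prems(1) by auto
    have wf: "weight (fun_fm 0 1 2) < weight A" using weight_fun_fm[of 0 1 2] EEx by simp
    show ?thesis
      unfolding EEx F.sat.simps
      by (rule delta_exists[OF less.prems(1)[unfolded EEx] sat.simps(12) w is_fun_mono isf[OF wf]
            F.is_fun_mono IH_upd[OF wt]])
  qed (use less.prems(1) in auto)
qed

section \<open>Reflection in the forcing model\<close>

lemma fJI:
  "(\<And>b g. fle a b \<Longrightarrow> g \<in> fD b \<Longrightarrow> \<forall>c. fle b c \<longrightarrow> X c \<longrightarrow> fgoal c g \<Longrightarrow> fgoal b g) \<Longrightarrow> fJ X a"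
  by (simp add: fJ_def)

lemma F_is_fun:
  assumes "le w w" "p \<in> D w" "f \<in> D w" "a \<in> D w" "b \<in> D w"
  shows "F.is_fun (w, p) f a b \<longleftrightarrow> frc (\<lambda>v _. is_fun v f a b) w p"
proof -
  have "env w ((\<lambda>_. f)(1 := a, 2 := b))" using assms by (simp add: env_const)
  from sat_delta[OF Delta0E_fun_fm assms(1,2) this, of 0 1 2]
  show ?thesis by (simp add: F.sat_fun_fm sat_fun_fm)
qed

lemma F_is_fun_now:
  assumes "le w w" "p \<in> D w" "f \<in> D w" "a \<in> D w" "b \<in> D w" "is_fun w f a b"
  shows "F.is_fun (w, p) f a b"
  unfolding F_is_fun[OF assms(1-5)] by (rule frc_true[OF assms(2)]) (rule is_fun_mono[OF _ assms(6)])

lemma F_Bot: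
  assumes "le w w" "p \<in> D w" "env w \<rho>"
  shows "F.sat Bot (w, p) \<rho> \<longleftrightarrow> frc (\<lambda>v _. False) w p"
  using sat_delta[of Bot, OF _ assms] by simp

text \<open>The bound \<open>y\<close> of the relativisation is given first; \<open>frc\<close> may
  afterwards choose a different, larger bound for the condition.\<close>

definition pre :: "fm \<Rightarrow> 'w \<Rightarrow> 'd \<Rightarrow> (var \<Rightarrow> 'd) \<Rightarrow> bool" where
  "pre C w p \<rho> \<longleftrightarrow> (\<forall>v y. le w v \<longrightarrow> y \<in> D v \<longrightarrow> frc (\<lambda>u _. rsat C u \<rho> y) v p)"

lemma preD: "pre C w p \<rho> \<Longrightarrow> le w v \<Longrightarrow> y \<in> D v \<Longrightarrow> frc (\<lambda>u _. rsat C u \<rho> y) v p"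
  by (simp add: pre_def)

lemma pre_mono: "fle (w, p) (v, r) \<Longrightarrow> pre C w p \<rho> \<Longrightarrow> pre C v r \<rho>"
  unfolding pre_def using frc_mono[OF fle_shift] le_trans[OF fleD(1)] by blast

text \<open>The code of \<open>C\<close> is joined to \<open>r\<close>. For a given \<open>y\<close>
  take a bound \<open>z\<close> above \<open>y\<close> and above the components of the code: the new
  condition contains \<open>C\<close> relativised to \<open>z\<close>, and Pi formulas pass down to
  \<open>y\<close>.\<close>

lemma add_cond:
  assumes C: "C \<in> set Fs" "PiE C" and v: "le v v" "r \<in> D v" "env v \<rho>"
  obtains r' y1 where "r' \<in> D v" "y1 \<in> D v" "fle (v, r) (v, r')" "pre C v r' \<rho>"
    "\<And>u y. le v u \<Longrightarrow> y \<in> D u \<Longrightarrow> sub u y1 y \<Longrightarrow> cond u r' y \<longleftrightarrow> cond u r y \<and> rsat C u \<rho> y"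
proof -
  obtain p1 y1 where p1: "p1 \<in> D v" "y1 \<in> D v"
    "\<And>u y. le v u \<Longrightarrow> y \<in> D u \<Longrightarrow> sub u y1 y \<Longrightarrow> cond u p1 y \<longleftrightarrow> rsat C u \<rho> y"
    using cond_code[OF C v(1,3)] by blast
  obtain r' where r': "r' \<in> D v" "\<And>u y. le v u \<Longrightarrow> cond u r' y \<longleftrightarrow> cond u r y \<and> cond u p1 y"
    using cond_conj[OF v(1,2) p1(1)] by blast
  have "fle (v, r) (v, r')" using v r' by (intro fleI) auto
  moreover have "pre C v r' \<rho>"
    unfolding pre_def
  proof (intro HOL.allI impI)
    fix u y assume u: "le v u" "y \<in> D u"
    obtain z where z: "z \<in> D u" "sub u y z" "sub u y1 z"
      using upper_bound2[OF le_right[OF u(1)] u(2) D_mono[OF u(1) p1(2)]] by blast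
    have "rsat C t \<rho> y" if t: "le u t" "cond t r' z" for t
    proof -
      have vt: "le v t" using le_trans u t by blast
      have "rsat C t \<rho> z"
        using p1(3)[OF vt D_mono[OF t(1) z(1)] sub_mono[OF t(1) z(3)]] r'(2)[OF vt] t(2) by blast
      then show ?thesis using rsat_sub(2)[OF C(2) le_right[OF t(1)] sub_mono[OF t(1) z(2)]] by blast
    qed
    then show "frc (\<lambda>u _. rsat C u \<rho> y) u r'" using z(1) unfolding frc_def by blast
  qed
  moreover have "cond u r' y \<longleftrightarrow> cond u r y \<and> rsat C u \<rho> y" if "le v u" "y \<in> D u" "sub u y1 y" for u y
    using r'(2)[OF that(1)] p1(3)[OF that] by blast
  ultimately show thesis using that r'(1) p1(2) by blast
qed

text \<open>Above \<open>y1\<close> the enlarged condition is literally a conjunction, so its second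
  half can be moved from the premise into the conclusion.\<close>

lemma discharge_cond:
  assumes v: "le v v" "y1 \<in> D v"
    and eqv: "\<And>u y. le v u \<Longrightarrow> y \<in> D u \<Longrightarrow> sub u y1 y \<Longrightarrow> cond u r' y \<longleftrightarrow> cond u r y \<and> rsat C u \<rho> y"
    and f: "frc \<phi> v r'" "mono_bound v \<phi>"
  shows "frc (\<lambda>u y. \<forall>t. le u t \<longrightarrow> rsat C t \<rho> y \<longrightarrow> \<phi> t y) v r"
proof (rule frc_up)
  obtain y where y: "y \<in> D v" "sub v y1 y" "\<And>u. le v u \<Longrightarrow> cond u r' y \<Longrightarrow> \<phi> u y"
    using frc_above[OF v(1) f v(2)] by blast
  have "rsat C u \<rho> y \<longrightarrow> \<phi> u y" if "le v u" "cond u r y" for u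
    using y(3)[OF that(1)] eqv[OF that(1) D_mono[OF that(1) y(1)] sub_mono[OF that(1) y(2)]] that(2) by blast
  then show "frc (\<lambda>u y. rsat C u \<rho> y \<longrightarrow> \<phi> u y) v r" using y(1) unfolding frc_def by blast
qed

lemma sigma_imp_step:
  assumes C: "C \<in> set Fs" "PiE C" and A: "SigmaE A" and w: "le w w" "p \<in> D w" "env w \<rho>"
    and s: "F.sat (Imp C A) (w, p) \<rho>"
    and IHC: "\<And>r. r \<in> D w \<Longrightarrow> pre C w r \<rho> \<Longrightarrow> F.sat C (w, r) \<rho>"
    and IHA: "\<And>r. r \<in> D w \<Longrightarrow> F.sat A (w, r) \<rho> \<Longrightarrow> frc (\<lambda>v y. rsat A v \<rho> y) w r"
  shows "frc (\<lambda>v y. rsat (Imp C A) v \<rho> y) w p"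
proof -
  obtain r y1 where r: "r \<in> D w" "y1 \<in> D w" "fle (w, p) (w, r)" "pre C w r \<rho>"
    "\<And>u y. le w u \<Longrightarrow> y \<in> D u \<Longrightarrow> sub u y1 y \<Longrightarrow> cond u r y \<longleftrightarrow> cond u p y \<and> rsat C u \<rho> y"
    using add_cond[OF C w] by blast
  have "F.sat A (w, r) \<rho>" using s IHC[OF r(1,4)] r(3) unfolding F.sat.simps by blast
  from discharge_cond[OF w(1) r(2) r(5) IHA[OF r(1) this] mono_bound_rsat[OF A]]
  show ?thesis by simp
qed

text \<open>Forced \<open>A\<close> holds relativised to some \<open>y1\<close>. For a target bound
  \<open>y\<close> the implication is used at a bound above both: \<open>A\<close> passes up from
  \<open>y1\<close> to it, and \<open>C\<close> passes down from it to \<open>y\<close>.\<close>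

lemma pi_imp_step:
  assumes A: "SigmaE A" and C: "PiE C" and w: "le w w" "p \<in> D w" "env w \<rho>"
    and h: "pre (Imp A C) w p \<rho>"
    and IHA: "\<And>v r. le w v \<Longrightarrow> r \<in> D v \<Longrightarrow> F.sat A (v, r) \<rho> \<Longrightarrow> frc (\<lambda>v y. rsat A v \<rho> y) v r"
    and IHC: "\<And>v r. le w v \<Longrightarrow> r \<in> D v \<Longrightarrow> pre C v r \<rho> \<Longrightarrow> F.sat C (v, r) \<rho>"
  shows "F.sat (Imp A C) (w, p) \<rho>"
  unfolding F.sat.simps
proof (intro HOL.allI impI)
  fix b assume b: "fle (w, p) b" "F.sat A b \<rho>"
  obtain v r where v: "b = (v, r)" by fastforce
  note d = fleD[OF b(1)[unfolded v]]
  obtain y1 where y1: "y1 \<in> D v" "\<And>u. le v u \<Longrightarrow> cond u r y1 \<Longrightarrow> rsat A u \<rho> y1"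
    using IHA[OF d(1,3)] b(2) v unfolding frc_def by blast
  have pr: "pre (Imp A C) v r \<rho>" using pre_mono[OF b(1)[unfolded v] h] .
  have "pre C v r \<rho>"
    unfolding pre_def
  proof (intro HOL.allI impI)
    fix u y assume u: "le v u" "y \<in> D u"
    note uu = le_right[OF u(1)]
    obtain z where z: "z \<in> D u" "sub u y z" "sub u y1 z"
      using upper_bound2[OF uu u(2) D_mono[OF u(1) y1(1)]] by blast
    obtain z' where z': "z' \<in> D u" "sub u y1 z'" "\<And>t. le u t \<Longrightarrow> cond t r z' \<Longrightarrow> rsat (Imp A C) t \<rho> z"
      using frc_above[OF uu preD[OF pr u(1) z(1)] _ D_mono[OF u(1) y1(1)]] by auto
    have "rsat C t \<rho> y" if t: "le u t" "cond t r z'" for t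
    proof -
      note tt = le_right[OF t(1)]
      have "cond t r y1" using cond_antimono[OF tt sub_mono[OF t(1) z'(2)] t(2)] .
      then have "rsat A t \<rho> y1" using y1(2) le_trans[OF u(1) t(1)] by blast
      then have "rsat A t \<rho> z" using rsat_sub(1)[OF A tt sub_mono[OF t(1) z(3)]] by blast
      then have "rsat C t \<rho> z" using z'(3)[OF t] tt by simp
      then show ?thesis using rsat_sub(2)[OF C tt sub_mono[OF t(1) z(2)]] by blast
    qed
    then show "frc (\<lambda>u _. rsat C u \<rho> y) u r" using z'(1) unfolding frc_def by blast
  qed
  then show "F.sat C b \<rho>" using IHC[OF d(1,3)] v by simp
qed

text \<open>The witness in \<open>h\<close> may depend on \<open>y\<close>, so no single
  \<open>d\<close> need satisfy all relativisations, and only goals can be reached. Adding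
  \<open>C\<close> at \<open>d\<close> to the condition yields the goal for each \<open>d\<close>;
  collecting over \<open>a\<close> gives one bound for all of them, and at that bound
  \<open>h\<close> provides some \<open>d\<close>.\<close>

lemma pi_exists_step:
  assumes C: "C \<in> set Fs" "PiE C" and w: "le w w" "p \<in> D w" "env w \<rho>" "a \<in> D w"
    and G: "\<And>v r d. le w v \<Longrightarrow> r \<in> D v \<Longrightarrow> d \<in> D v \<Longrightarrow> mem v d a \<Longrightarrow> G (v, r) d"
    and IH: "\<And>v r d. le w v \<Longrightarrow> r \<in> D v \<Longrightarrow> d \<in> D v \<Longrightarrow> pre C v r (\<rho>(x := d)) \<Longrightarrow>
      F.sat C (v, r) (\<rho>(x := d))"
    and h: "\<And>v y. le w v \<Longrightarrow> y \<in> D v \<Longrightarrow>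
      frc (\<lambda>u _. \<exists>d\<in>D u. mem u d a \<and> rsat C u (\<rho>(x := d)) y) v p"
  shows "fJ (\<lambda>b. \<exists>d\<in>fD b. G b d \<and> F.sat C b (\<rho>(x := d))) (w, p)"
proof (rule fJI)
  fix b g
  assume b: "fle (w, p) b" "g \<in> fD b"
    "\<forall>c. fle b c \<longrightarrow> (\<exists>d\<in>fD c. G c d \<and> F.sat C c (\<rho>(x := d))) \<longrightarrow> fgoal c g"
  obtain v r where v: "b = (v, r)" by fastforce
  note f = fleD[OF b(1)[unfolded v]]
  have g: "g \<in> D v" using b(2) v by simp
  have ev: "env v \<rho>" using env_mono[OF f(1) w(3)] .
  have av: "a \<in> D v" using D_mono[OF f(1) w(4)] .
  have "frc (\<lambda>u y. \<forall>d\<in>D u. mem u d a \<longrightarrow> rsat C u (\<rho>(x := d)) y \<longrightarrow> goal u g y) v r"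
  proof (rule uniform_goal[OF f(5) av f(3) g ev C(2)])
    fix u d assume u: "le v u" "d \<in> D u" "mem u d a"
    note uu = le_right[OF u(1)]
    have wu: "le w u" using le_trans[OF f(1) u(1)] .
    have ru: "r \<in> D u" using D_mono[OF u(1) f(3)] .
    obtain r' y1 where r': "r' \<in> D u" "y1 \<in> D u" "fle (u, r) (u, r')" "pre C u r' (\<rho>(x := d))"
      "\<And>t y. le u t \<Longrightarrow> y \<in> D t \<Longrightarrow> sub t y1 y \<Longrightarrow> cond t r' y \<longleftrightarrow> cond t r y \<and> rsat C t (\<rho>(x := d)) y"
      using add_cond[OF C uu ru env_upd[OF env_mono[OF u(1) ev] u(2)]] by blast
    have "F.sat C (u, r') (\<rho>(x := d))" using IH[OF wu r'(1) u(2) r'(4)] .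
    moreover have "G (u, r') d" using G[OF wu r'(1) u(2,3)] .
    moreover have "fle b (u, r')" unfolding v using fle_trans[OF fle_world[OF u(1) f(3)] r'(3)] .
    ultimately have "fgoal (u, r') g" using b(3) u(2) by auto
    then have "frc (\<lambda>u y. \<forall>t. le u t \<longrightarrow> rsat C t (\<rho>(x := d)) y \<longrightarrow> goal t g y) u r"
      by (intro discharge_cond[OF uu r'(2,5) _ mono_bound_goal]) auto
    then show "frc (\<lambda>u y. rsat C u (\<rho>(x := d)) y \<longrightarrow> goal u g y) u r"
      by (rule frc_map) (use le_right in blast)
  qed
  then obtain z where z: "z \<in> D v" "\<And>u d. le v u \<Longrightarrow> cond u r z \<Longrightarrow> d \<in> D u \<Longrightarrow> mem u d a \<Longrightarrow>
      rsat C u (\<rho>(x := d)) z \<Longrightarrow> goal u g z" unfolding frc_def by blast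
  \<comment> \<open>The hypothesis is applied at the very bound \<open>z\<close> that works for all
    \<open>d\<close> at once.\<close>
  have f2: "frc (\<lambda>u _. \<exists>d\<in>D u. mem u d a \<and> rsat C u (\<rho>(x := d)) z) v r"
    using frc_mono[OF fle_shift[OF b(1)[unfolded v] f(5)] h[OF f(1) z(1)]] frc_mono[OF _ h[OF f(1) z(1)]]
      fleI[OF f(5) D_mono[OF f(1,2)] f(3) f(6)] by blast
  then obtain z' where z': "z' \<in> D v" "sub v z z'"
    "\<And>u. le v u \<Longrightarrow> cond u r z' \<Longrightarrow> \<exists>d\<in>D u. mem u d a \<and> rsat C u (\<rho>(x := d)) z"
    using frc_above[OF f(5) f2 mono_bound_const z(1)] by blast
  have "goal u g z'" if u: "le v u" "cond u r z'" for u
  proof -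
    note uu = le_right[OF u(1)] and s = sub_mono[OF u(1) z'(2)]
    have "goal u g z" using z(2)[OF u(1) cond_antimono[OF uu s u(2)]] z'(3)[OF u] by blast
    then show ?thesis using goal_mono_bound[OF uu s] by blast
  qed
  then show "fgoal b g" using z'(1) unfolding v fgoal_pair frc_def by blast
qed

lemma pi_forall_step:
  assumes C: "PiE C" and w: "le w w" "p \<in> D w" "env w \<rho>"
    and G: "\<And>v r d. le w v \<Longrightarrow> r \<in> D v \<Longrightarrow> d \<in> D v \<Longrightarrow> G (v, r) d \<Longrightarrow> frc (\<lambda>u _. gd u d) v r"
    and IH: "\<And>v r d. le w v \<Longrightarrow> r \<in> D v \<Longrightarrow> d \<in> D v \<Longrightarrow> pre C v r (\<rho>(x := d)) \<Longrightarrow>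
      F.sat C (v, r) (\<rho>(x := d))"
    and h: "\<And>v y. le w v \<Longrightarrow> y \<in> D v \<Longrightarrow>
      frc (\<lambda>u _. \<forall>d\<in>D u. gd u d \<longrightarrow> rsat C u (\<rho>(x := d)) y) v p"
    and b: "fle (w, p) b" "d \<in> fD b" "G b d"
  shows "F.sat C b (\<rho>(x := d))"
proof -
  obtain v r where v: "b = (v, r)" by fastforce
  note f = fleD[OF b(1)[unfolded v]]
  have d: "d \<in> D v" using b(2) v by simp
  have "pre C v r (\<rho>(x := d))"
    unfolding pre_def
  proof (intro HOL.allI impI)
    fix u y assume u: "le v u" "y \<in> D u"
    have wu: "le w u" using le_trans[OF f(1) u(1)] .
    have 1: "frc (\<lambda>u _. gd u d) u r"
      using G[OF f(1,3) d] b(3) frc_mono[OF fle_world[OF u(1) f(3)]] v by blast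
    have "fle (u, p) (u, r)" using fle_shift[OF b(1)[unfolded v] u(1)] .
    then have 2: "frc (\<lambda>u _. \<forall>d\<in>D u. gd u d \<longrightarrow> rsat C u (\<rho>(x := d)) y) u r"
      using h[OF wu u(2)] frc_mono by blast
    have "frc (\<lambda>t _. (\<forall>d\<in>D t. gd t d \<longrightarrow> rsat C t (\<rho>(x := d)) y) \<and> d \<in> D t) u r"
      using 2 D_mono[OF le_trans[OF u(1)] d] unfolding frc_def by blast
    with 1 show "frc (\<lambda>u _. rsat C u (\<rho>(x := d)) y) u r"
      by (rule frc_map2_const[OF le_right[OF u(1)]]) blast
  qed
  then show ?thesis using IH[OF f(1,3) d] v by simp
qed

lemma sigma_exists_step:
  assumes E: "E \<in> set Fs" "SigmaE E" and A: "SigmaE A" and w: "le w w" "p \<in> D w" "env w \<rho>"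
    and s: "fJ (\<lambda>b. \<exists>d\<in>fD b. G b d \<and> F.sat A b (\<rho>(x := d))) (w, p)"
    and G: "\<And>v r d. le w v \<Longrightarrow> r \<in> D v \<Longrightarrow> d \<in> D v \<Longrightarrow> G (v, r) d \<Longrightarrow> frc (\<lambda>u _. gd u d) v r"
    and IH: "\<And>v r d. le w v \<Longrightarrow> r \<in> D v \<Longrightarrow> d \<in> D v \<Longrightarrow> F.sat A (v, r) (\<rho>(x := d)) \<Longrightarrow>
      frc (\<lambda>u y. rsat A u (\<rho>(x := d)) y) v r"
    and e: "\<And>v d y. le w v \<Longrightarrow> d \<in> D v \<Longrightarrow> gd v d \<Longrightarrow> rsat A v (\<rho>(x := d)) y \<Longrightarrow> rsat E v \<rho> y"
  shows "frc (\<lambda>v y. rsat E v \<rho> y) w p"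
proof (rule fJ_sigma[OF E w(1,3,2) s])
  fix v r assume v: "fle (w, p) (v, r)" "\<exists>d\<in>fD (v, r). G (v, r) d \<and> F.sat A (v, r) (\<rho>(x := d))"
  note f = fleD[OF v(1)]
  obtain d where d: "d \<in> D v" "G (v, r) d" "F.sat A (v, r) (\<rho>(x := d))" using v(2) by auto
  show "frc (\<lambda>u y. rsat E u \<rho> y) v r"
  proof (rule frc_map2[OF f(5) G[OF f(1,3) d(1,2)] IH[OF f(1,3) d(1,3)] mono_bound_const mono_bound_rsat[OF A]])
    fix u y assume u: "le v u" "gd u d" "rsat A u (\<rho>(x := d)) y"
    show "rsat E u \<rho> y" by (rule e[OF le_trans[OF f(1) u(1)] D_mono[OF u(1) d(1)] u(2,3)])
  qed
qed

text \<open>Simultaneous, because the premise of an implication changes sides. All subformulas must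
  be on the list \<open>Fs\<close>: Pi formulas get added to conditions, and disjunctive or
  existential Sigma formulas are the goals into which \<open>fJ\<close> is eliminated.\<close>

theorem sigma_pi:
  "SigmaE A \<Longrightarrow> subfms A \<subseteq> set Fs \<Longrightarrow> le w w \<Longrightarrow> p \<in> D w \<Longrightarrow> env w \<rho> \<Longrightarrow>
    F.sat A (w, p) \<rho> \<Longrightarrow> frc (\<lambda>v y. rsat A v \<rho> y) w p"
  "PiE A \<Longrightarrow> subfms A \<subseteq> set Fs \<Longrightarrow> le w w \<Longrightarrow> p \<in> D w \<Longrightarrow> env w \<rho> \<Longrightarrow>
    pre A w p \<rho> \<Longrightarrow> F.sat A (w, p) \<rho>"
proof (induction A and A arbitrary: w p \<rho> and w p \<rho> rule: SigmaE_PiE.inducts)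
  case (S_d0 A)
  then show ?case using sat_delta by (simp add: rsat_Delta0E)
next
  case (S_and A B)
  then have "frc (\<lambda>v y. rsat A v \<rho> y) w p" "frc (\<lambda>v y. rsat B v \<rho> y) w p" by simp_all
  then show ?case
    by (rule frc_map2[OF S_and.prems(2) _ _ mono_bound_rsat[OF S_and.hyps(1)] mono_bound_rsat[OF S_and.hyps(2)]])
      simp
next
  case (S_or A B)
  have m: "Or A B \<in> set Fs" "SigmaE (Or A B)" using S_or by (auto intro: SigmaE_PiE.S_or)
  have J: "fJ (\<lambda>b. F.sat A b \<rho> \<or> F.sat B b \<rho>) (w, p)" using S_or.prems(5) by simp
  show ?case
  proof (rule fJ_sigma[OF m S_or.prems(2,4,3) J])
    fix v r assume v: "fle (w, p) (v, r)" "F.sat A (v, r) \<rho> \<or> F.sat B (v, r) \<rho>"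
    note f = fleD[OF v(1)]
    have "frc (\<lambda>v y. rsat A v \<rho> y) v r \<or> frc (\<lambda>v y. rsat B v \<rho> y) v r"
      using v(2) S_or.IH(1)[OF _ f(5,3) env_mono[OF f(1) S_or.prems(4)]]
        S_or.IH(2)[OF _ f(5,3) env_mono[OF f(1) S_or.prems(4)]] S_or.prems(1) by auto
    then show "frc (\<lambda>v y. rsat (Or A B) v \<rho> y) v r"
      using frc_map[of _ v r "\<lambda>v y. rsat (Or A B) v \<rho> y"] by auto
  qed
next
  case (S_ball A x t)
  note w = S_ball.prems(2-4)
  have "frc (\<lambda>v y. \<forall>u. le v u \<longrightarrow> (\<forall>d\<in>D u. mem u d (\<rho> t) \<longrightarrow> rsat A u (\<rho>(x := d)) y)) w p"
  proof (rule forall_step[where G = "\<lambda>c d. fmem c d (\<rho> t)", OF w env_D[OF w(3)] S_ball.hyps])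
    fix v d assume v: "le w v" "d \<in> D v"
    show "fmem (v, p) d (\<rho> t)" if "mem v d (\<rho> t)"
      using fmem_now[OF le_right[OF v(1)] D_mono[OF v(1) w(2)] that] .
    show "frc (\<lambda>u y. rsat A u (\<rho>(x := d)) y) v p" if "F.sat A (v, p) (\<rho>(x := d))"
      by (rule S_ball.IH[OF _ le_right[OF v(1)] D_mono[OF v(1) w(2)] env_upd[OF env_mono[OF v(1) w(3)] v(2)] that])
        (use S_ball.prems(1) in auto)
  next
    fix b d assume "fle (w, p) b" "d \<in> fD b" "fmem b d (\<rho> t)"
    then show "F.sat A b (\<rho>(x := d))" using S_ball.prems(5) unfolding F.sat.simps by blast
  qed
  then show ?case by simp
next
  case (S_eall A x a b)
  note w = S_eall.prems(2-4)
  obtain e where e: "e \<in> D w" "\<And>v f. le w v \<Longrightarrow> f \<in> D v \<Longrightarrow> mem v f e \<longleftrightarrow> is_fun v f (\<rho> a) (\<rho> b)"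
    using function_set[OF w(1) env_D[OF w(3)] env_D[OF w(3)]] by blast
  have "frc (\<lambda>v y. \<forall>u. le v u \<longrightarrow> (\<forall>d\<in>D u. mem u d e \<longrightarrow> rsat A u (\<rho>(x := d)) y)) w p"
  proof (rule forall_step[where G = "\<lambda>c d. F.is_fun c d (\<rho> a) (\<rho> b)", OF w e(1) S_eall.hyps])
    fix v d assume v: "le w v" "d \<in> D v"
    note vv = le_right[OF v(1)] D_mono[OF v(1) w(2)] and ev = env_mono[OF v(1) w(3)]
    show "F.is_fun (v, p) d (\<rho> a) (\<rho> b)" if "mem v d e"
      using F_is_fun_now[OF vv v(2) env_D[OF ev] env_D[OF ev]] e(2)[OF v] that by blast
    show "frc (\<lambda>u y. rsat A u (\<rho>(x := d)) y) v p" if "F.sat A (v, p) (\<rho>(x := d))"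
      by (rule S_eall.IH[OF _ vv env_upd[OF ev v(2)] that]) (use S_eall.prems(1) in auto)
  next
    fix c d assume "fle (w, p) c" "d \<in> fD c" "F.is_fun c d (\<rho> a) (\<rho> b)"
    then show "F.sat A c (\<rho>(x := d))" using S_eall.prems(5) unfolding F.sat.simps by blast
  qed
  then show ?case
  proof (rule frc_map)
    fix v y assume h: "le w v" "\<forall>u. le v u \<longrightarrow> (\<forall>d\<in>D u. mem u d e \<longrightarrow> rsat A u (\<rho>(x := d)) y)"
    show "rsat (EAll x a b A) v \<rho> y"
      unfolding rsat.simps using h(2) e(2)[OF le_trans[OF h(1)]] by blast
  qed
next
  case (S_bex A x t)
  note w = S_bex.prems(2-4)
  have m: "BEx x t A \<in> set Fs" "SigmaE (BEx x t A)" using S_bex by (auto intro: SigmaE_PiE.S_bex)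
  show ?case
  proof (rule sigma_exists_step[OF m S_bex.hyps w S_bex.prems(5)[unfolded F.sat.simps]])
    fix v r d assume v: "le w v" "r \<in> D v" "d \<in> D v"
    show "frc (\<lambda>u _. mem u d (\<rho> t)) v r" if "fmem (v, r) d (\<rho> t)" using that by (simp add: fmem_def)
    show "frc (\<lambda>u y. rsat A u (\<rho>(x := d)) y) v r" if "F.sat A (v, r) (\<rho>(x := d))"
      by (rule S_bex.IH[OF _ le_right[OF v(1)] v(2) env_upd[OF env_mono[OF v(1) w(3)] v(3)] that])
        (use S_bex.prems(1) in auto)
  qed auto
next
  case (S_eex A x a b)
  note w = S_eex.prems(2-4)
  have m: "EEx x a b A \<in> set Fs" "SigmaE (EEx x a b A)" using S_eex by (auto intro: SigmaE_PiE.S_eex)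
  show ?case
  proof (rule sigma_exists_step[OF m S_eex.hyps w S_eex.prems(5)[unfolded F.sat.simps]])
    fix v r d assume v: "le w v" "r \<in> D v" "d \<in> D v"
    note ev = env_mono[OF v(1) w(3)]
    show "frc (\<lambda>u _. is_fun u d (\<rho> a) (\<rho> b)) v r" if "F.is_fun (v, r) d (\<rho> a) (\<rho> b)"
      using that F_is_fun[OF le_right[OF v(1)] v(2,3) env_D[OF ev] env_D[OF ev]] by blast
    show "frc (\<lambda>u y. rsat A u (\<rho>(x := d)) y) v r" if "F.sat A (v, r) (\<rho>(x := d))"
      by (rule S_eex.IH[OF _ le_right[OF v(1)] v(2) env_upd[OF ev v(3)] that])
        (use S_eex.prems(1) in auto)
  qed auto
next
  case (S_ex A x)
  note w = S_ex.prems(2-4)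
  have m: "Ex x A \<in> set Fs" "SigmaE (Ex x A)" using S_ex by (auto intro: SigmaE_PiE.S_ex)
  show ?case
  proof (rule fJ_sigma[OF m w(1,3,2) S_ex.prems(5)[unfolded F.sat.simps]])
    fix v r assume v: "fle (w, p) (v, r)" "\<exists>d\<in>fD (v, r). F.sat A (v, r) (\<rho>(x := d))"
    note f = fleD[OF v(1)]
    obtain d where d: "d \<in> D v" "F.sat A (v, r) (\<rho>(x := d))" using v(2) by auto
    have fr: "frc (\<lambda>u y. rsat A u (\<rho>(x := d)) y) v r"
      by (rule S_ex.IH[OF _ f(5,3) env_upd[OF env_mono[OF f(1) w(3)] d(1)] d(2)]) (use S_ex.prems(1) in auto)
    \<comment> \<open>A bound for \<open>Ex x A\<close> has to contain the witness as well; placing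
      it above some set with \<open>d\<close> in it achieves this.\<close>
    obtain s where s: "s \<in> D v" "mem v d s" using pairing[OF f(5) d(1) d(1)] by blast
    obtain y where y: "y \<in> D v" "sub v s y" "\<And>u. le v u \<Longrightarrow> cond u r y \<Longrightarrow> rsat A u (\<rho>(x := d)) y"
      using frc_above[OF f(5) fr mono_bound_rsat[OF S_ex.hyps] s(1)] by blast
    have dy: "mem v d y" using subD[OF y(2) f(5) d(1) s(2)] .
    have "rsat (Ex x A) u \<rho> y" if "le v u" "cond u r y" for u
      using y(3)[OF that] D_mono[OF that(1) d(1)] mem_mono[OF that(1) dy] by auto
    then show "frc (\<lambda>u y. rsat (Ex x A) u \<rho> y) v r" using y(1) unfolding frc_def by blast
  qed
next
  case (S_neg C)
  note w = S_neg.prems(2-4)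
  show ?case
    unfolding Neg_def
  proof (rule sigma_imp_step[OF _ S_neg.hyps _ w S_neg.prems(5)[unfolded Neg_def]])
    show "C \<in> set Fs" using S_neg.prems(1) by (auto simp: Neg_def)
    show "SigmaE Bot" by (rule SigmaE_PiE.S_d0) simp
    fix r assume r: "r \<in> D w"
    show "F.sat C (w, r) \<rho>" if "pre C w r \<rho>"
      by (rule S_neg.IH[OF _ w(1) r w(3) that]) (use S_neg.prems(1) in \<open>auto simp: Neg_def\<close>)
    show "frc (\<lambda>v y. rsat Bot v \<rho> y) w r" if "F.sat Bot (w, r) \<rho>"
      using that F_Bot[OF w(1) r w(3)] by simp
  qed
next
  case (S_imp C A)
  note w = S_imp.prems(2-4)
  show ?case
  proof (rule sigma_imp_step[OF _ S_imp.hyps w S_imp.prems(5)])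
    show "C \<in> set Fs" using S_imp.prems(1) by auto
    fix r assume r: "r \<in> D w"
    show "F.sat C (w, r) \<rho>" if "pre C w r \<rho>"
      by (rule S_imp.IH(1)[OF _ w(1) r w(3) that]) (use S_imp.prems(1) in auto)
    show "frc (\<lambda>v y. rsat A v \<rho> y) w r" if "F.sat A (w, r) \<rho>"
      by (rule S_imp.IH(2)[OF _ w(1) r w(3) that]) (use S_imp.prems(1) in auto)
  qed
next
  case (P_d0 A)
  then show ?case
    using sat_delta preD[OF P_d0.prems(5,2,3)] by (simp add: rsat_Delta0E)
next
  case (P_and A B)
  note w = P_and.prems(2-4)
  have "pre A w p \<rho>" "pre B w p \<rho>"
    unfolding pre_def by (intro HOL.allI impI, drule (1) preD[OF P_and.prems(5)], erule frc_map, simp)+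
  then show ?case using P_and.IH(1)[OF _ w] P_and.IH(2)[OF _ w] P_and.prems(1) by simp
next
  case (P_or A B)
  note w = P_or.prems(2-4)
  have sub: "A \<in> set Fs" "B \<in> set Fs" "subfms A \<subseteq> set Fs" "subfms B \<subseteq> set Fs" using P_or.prems(1) by auto
  have "fJ (\<lambda>b. F.sat A b \<rho> \<or> F.sat B b \<rho>) (w, p)"
  proof (rule fJI)
    fix b g assume b: "fle (w, p) b" "g \<in> fD b"
      "\<forall>c. fle b c \<longrightarrow> F.sat A c \<rho> \<or> F.sat B c \<rho> \<longrightarrow> fgoal c g"
    obtain v r where v: "b = (v, r)" by fastforce
    note f = fleD[OF b(1)[unfolded v]]
    have ev: "env v \<rho>" using env_mono[OF f(1) w(3)] .
    \<comment> \<open>Which disjunct holds may depend on the bound. So each disjunct is added to the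
      condition in turn, and the goal is obtained from either before the disjunction is used at one
      common bound.\<close>
    have *: "frc (\<lambda>u y. \<forall>t. le u t \<longrightarrow> rsat C t \<rho> y \<longrightarrow> goal t g y) v r"
      if C: "C \<in> set Fs" "PiE C" "\<And>r. r \<in> D v \<Longrightarrow> pre C v r \<rho> \<Longrightarrow> F.sat C (v, r) \<rho>" "C = A \<or> C = B" for C
    proof -
      obtain r' y1 where r': "r' \<in> D v" "y1 \<in> D v" "fle (v, r) (v, r')" "pre C v r' \<rho>"
        "\<And>u y. le v u \<Longrightarrow> y \<in> D u \<Longrightarrow> sub u y1 y \<Longrightarrow> cond u r' y \<longleftrightarrow> cond u r y \<and> rsat C u \<rho> y"
        using add_cond[OF C(1,2) f(5,3) ev] by blast
      have "fgoal (v, r') g" using b(3) r'(3) C(3)[OF r'(1,4)] C(4) v by blast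
      then show ?thesis by (intro discharge_cond[OF f(5) r'(2,5) _ mono_bound_goal]) auto
    qed
    have gA: "frc (\<lambda>u y. \<forall>t. le u t \<longrightarrow> rsat A t \<rho> y \<longrightarrow> goal t g y) v r"
      by (rule *[OF sub(1) P_or.hyps(1)]) (use P_or.IH(1)[OF sub(3) f(5) _ ev] in auto)
    have gB: "frc (\<lambda>u y. \<forall>t. le u t \<longrightarrow> rsat B t \<rho> y \<longrightarrow> goal t g y) v r"
      by (rule *[OF sub(2) P_or.hyps(2)]) (use P_or.IH(2)[OF sub(4) f(5) _ ev] in auto)
    have mb: "mono_bound v (\<lambda>u y. \<forall>t. le u t \<longrightarrow> rsat C t \<rho> y \<longrightarrow> goal t g y)" if "PiE C" for C
      unfolding mono_bound_def
      using rsat_sub(2)[OF that le_right sub_mono] goal_mono_bound[OF le_right sub_mono] by blast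
    have "frc (\<lambda>u y. rsat (Or A B) u \<rho> y \<longrightarrow> goal u g y) v r"
      by (rule frc_map2[OF f(5) gA gB mb[OF P_or.hyps(1)] mb[OF P_or.hyps(2)]]) (use le_right in auto)
    then obtain z where z: "z \<in> D v" "\<And>u. le v u \<Longrightarrow> cond u r z \<Longrightarrow> rsat (Or A B) u \<rho> z \<Longrightarrow> goal u g z"
      unfolding frc_def by blast
    have pv: "pre (Or A B) v r \<rho>" using pre_mono[OF b(1)[unfolded v] P_or.prems(5)] .
    obtain z' where z': "z' \<in> D v" "sub v z z'" "\<And>u. le v u \<Longrightarrow> cond u r z' \<Longrightarrow> rsat (Or A B) u \<rho> z"
      using frc_above[OF f(5) preD[OF pv f(5) z(1)] mono_bound_const z(1)] by blast
    have "goal u g z'" if u: "le v u" "cond u r z'" for u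
    proof -
      note uu = le_right[OF u(1)] and s = sub_mono[OF u(1) z'(2)]
      have "goal u g z" using z(2)[OF u(1) cond_antimono[OF uu s u(2)] z'(3)[OF u]] .
      then show ?thesis using goal_mono_bound[OF uu s] by blast
    qed
    then show "fgoal b g" using z'(1) unfolding v fgoal_pair frc_def by blast
  qed
  then show ?case by simp
next
  case (P_ball A x t)
  note w = P_ball.prems(2-4)
  show ?case
    unfolding F.sat.simps
  proof (intro HOL.allI impI ballI)
    fix b d assume b: "fle (w, p) b" "d \<in> fD b" "fmem b d (\<rho> t)"
    show "F.sat A b (\<rho>(x := d))"
    proof (rule pi_forall_step[where G = "\<lambda>c d. fmem c d (\<rho> t)", OF P_ball.hyps w _ _ _ b])
      fix v r d assume v: "le w v" "r \<in> D v" "d \<in> D v"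
      show "frc (\<lambda>u _. mem u d (\<rho> t)) v r" if "fmem (v, r) d (\<rho> t)" using that by (simp add: fmem_def)
      show "F.sat A (v, r) (\<rho>(x := d))" if "pre A v r (\<rho>(x := d))"
        by (rule P_ball.IH[OF _ le_right[OF v(1)] v(2) env_upd[OF env_mono[OF v(1) w(3)] v(3)] that])
          (use P_ball.prems(1) in auto)
    next
      fix v y assume v: "le w v" "y \<in> D v"
      show "frc (\<lambda>u _. \<forall>d\<in>D u. mem u d (\<rho> t) \<longrightarrow> rsat A u (\<rho>(x := d)) y) v p"
        using preD[OF P_ball.prems(5) v] by (rule frc_map) (use le_right in auto)
    qed
  qed
next
  case (P_eall A x a b)
  note w = P_eall.prems(2-4)
  show ?case
    unfolding F.sat.simps
  proof (intro HOL.allI impI ballI)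
    fix c d assume c: "fle (w, p) c" "d \<in> fD c" "F.is_fun c d (\<rho> a) (\<rho> b)"
    show "F.sat A c (\<rho>(x := d))"
    proof (rule pi_forall_step[where G = "\<lambda>c d. F.is_fun c d (\<rho> a) (\<rho> b)", OF P_eall.hyps w _ _ _ c])
      fix v r d assume v: "le w v" "r \<in> D v" "d \<in> D v"
      note ev = env_mono[OF v(1) w(3)]
      show "frc (\<lambda>u _. is_fun u d (\<rho> a) (\<rho> b)) v r" if "F.is_fun (v, r) d (\<rho> a) (\<rho> b)"
        using that F_is_fun[OF le_right[OF v(1)] v(2,3) env_D[OF ev] env_D[OF ev]] by blast
      show "F.sat A (v, r) (\<rho>(x := d))" if "pre A v r (\<rho>(x := d))"
        by (rule P_eall.IH[OF _ le_right[OF v(1)] v(2) env_upd[OF ev v(3)] that])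
          (use P_eall.prems(1) in auto)
    next
      fix v y assume v: "le w v" "y \<in> D v"
      show "frc (\<lambda>u _. \<forall>d\<in>D u. is_fun u d (\<rho> a) (\<rho> b) \<longrightarrow> rsat A u (\<rho>(x := d)) y) v p"
        using preD[OF P_eall.prems(5) v] by (rule frc_map) (use le_right in auto)
    qed
  qed
next
  case (P_bex A x t)
  note w = P_bex.prems(2-4)
  have m: "A \<in> set Fs" using P_bex.prems(1) by auto
  show ?case
    unfolding F.sat.simps
  proof (rule pi_exists_step[OF m P_bex.hyps w env_D[OF w(3)]])
    fix v r d assume v: "le w v" "r \<in> D v" "d \<in> D v"
    show "fmem (v, r) d (\<rho> t)" if "mem v d (\<rho> t)" using fmem_now[OF le_right[OF v(1)] v(2) that] .
    show "F.sat A (v, r) (\<rho>(x := d))" if "pre A v r (\<rho>(x := d))"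
      by (rule P_bex.IH[OF _ le_right[OF v(1)] v(2) env_upd[OF env_mono[OF v(1) w(3)] v(3)] that])
        (use P_bex.prems(1) in auto)
  next
    fix v y assume v: "le w v" "y \<in> D v"
    show "frc (\<lambda>u _. \<exists>d\<in>D u. mem u d (\<rho> t) \<and> rsat A u (\<rho>(x := d)) y) v p"
      using preD[OF P_bex.prems(5) v] by simp
  qed
next
  case (P_eex A x a b)
  note w = P_eex.prems(2-4)
  have m: "A \<in> set Fs" using P_eex.prems(1) by auto
  obtain e where e: "e \<in> D w" "\<And>v f. le w v \<Longrightarrow> f \<in> D v \<Longrightarrow> mem v f e \<longleftrightarrow> is_fun v f (\<rho> a) (\<rho> b)"
    using function_set[OF w(1) env_D[OF w(3)] env_D[OF w(3)]] by blast
  show ?case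
    unfolding F.sat.simps
  proof (rule pi_exists_step[where G = "\<lambda>c d. F.is_fun c d (\<rho> a) (\<rho> b)", OF m P_eex.hyps w e(1)])
    fix v r d assume v: "le w v" "r \<in> D v" "d \<in> D v"
    note ev = env_mono[OF v(1) w(3)]
    show "F.is_fun (v, r) d (\<rho> a) (\<rho> b)" if "mem v d e"
      using F_is_fun_now[OF le_right[OF v(1)] v(2,3) env_D[OF ev] env_D[OF ev]] e(2)[OF v(1,3)] that by blast
    show "F.sat A (v, r) (\<rho>(x := d))" if "pre A v r (\<rho>(x := d))"
      by (rule P_eex.IH[OF _ le_right[OF v(1)] v(2) env_upd[OF ev v(3)] that])
        (use P_eex.prems(1) in auto)
  next
    fix v y assume v: "le w v" "y \<in> D v"
    show "frc (\<lambda>u _. \<exists>d\<in>D u. mem u d e \<and> rsat A u (\<rho>(x := d)) y) v p"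
      using preD[OF P_eex.prems(5) v] by (rule frc_map) (use e(2) le_trans[OF v(1)] in auto)
  qed
next
  case (P_all A x)
  note w = P_all.prems(2-4)
  show ?case
    unfolding F.sat.simps
  proof (intro HOL.allI impI ballI)
    fix b d assume b: "fle (w, p) b" "d \<in> fD b"
    obtain v r where v: "b = (v, r)" by fastforce
    note f = fleD[OF b(1)[unfolded v]]
    have d: "d \<in> D v" using b(2) v by simp
    have pv: "pre (All x A) v r \<rho>" using pre_mono[OF b(1)[unfolded v] P_all.prems(5)] .
    have "pre A v r (\<rho>(x := d))"
      unfolding pre_def
    proof (intro HOL.allI impI)
      fix u y assume u: "le v u" "y \<in> D u"
      \<comment> \<open>\<open>All x A\<close> relativised to a set can be instantiated only at its
        elements, so \<open>d\<close> is adjoined to \<open>y\<close> first and the result is passed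
        down to \<open>y\<close>.\<close>
      obtain z where z: "z \<in> D u" "sub u y z" "mem u d z"
        using adjoin[OF le_right[OF u(1)] u(2) D_mono[OF u(1) d]] by blast
      show "frc (\<lambda>u _. rsat A u (\<rho>(x := d)) y) u r"
        using preD[OF pv u(1) z(1)]
      proof (rule frc_map)
        fix t assume t: "le u t" "rsat (All x A) t \<rho> z"
        have "rsat A t (\<rho>(x := d)) z"
          using t(2) le_right[OF t(1)] D_mono[OF le_trans[OF u(1) t(1)] d] mem_mono[OF t(1) z(3)] by simp
        then show "rsat A t (\<rho>(x := d)) y"
          using rsat_sub(2)[OF P_all.hyps le_right[OF t(1)] sub_mono[OF t(1) z(2)]] by blast
      qed
    qed
    moreover have "subfms A \<subseteq> set Fs" using P_all.prems(1) by auto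
    ultimately show "F.sat A b (\<rho>(x := d))"
      using P_all.IH[OF _ f(5,3) env_upd[OF env_mono[OF f(1) w(3)] d]] unfolding v by blast
  qed
next
  case (P_neg A)
  note w = P_neg.prems(2-4)
  show ?case
    unfolding Neg_def
  proof (rule pi_imp_step[OF P_neg.hyps _ w P_neg.prems(5)[unfolded Neg_def]])
    show "PiE Bot" by (rule SigmaE_PiE.P_d0) simp
    fix v r assume v: "le w v" "r \<in> D v"
    note vv = le_right[OF v(1)] and ev = env_mono[OF v(1) w(3)]
    show "frc (\<lambda>v y. rsat A v \<rho> y) v r" if "F.sat A (v, r) \<rho>"
      by (rule P_neg.IH[OF _ vv v(2) ev that]) (use P_neg.prems(1) in \<open>auto simp: Neg_def\<close>)
    show "F.sat Bot (v, r) \<rho>" if "pre Bot v r \<rho>"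
      using preD[OF that vv v(2)] F_Bot[OF vv v(2) ev] by simp
  qed
next
  case (P_imp A C)
  note w = P_imp.prems(2-4)
  show ?case
  proof (rule pi_imp_step[OF P_imp.hyps w P_imp.prems(5)])
    fix v r assume v: "le w v" "r \<in> D v"
    note vv = le_right[OF v(1)] and ev = env_mono[OF v(1) w(3)]
    show "frc (\<lambda>v y. rsat A v \<rho> y) v r" if "F.sat A (v, r) \<rho>"
      by (rule P_imp.IH(1)[OF _ vv v(2) ev that]) (use P_imp.prems(1) in auto)
    show "F.sat C (v, r) \<rho>" if "pre C v r \<rho>"
      by (rule P_imp.IH(2)[OF _ vv v(2) ev that]) (use P_imp.prems(1) in auto)
  qed
qed

end

section \<open>Definability of forcing and the remaining axioms\<close>

lemma Delta0E_subst [simp]: "Delta0E (subst A x y) = Delta0E A"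
  by (induction A) auto

section \<open>Definability of forcing in the ground model\<close>

context forcing begin

text \<open>The condition is passed as the value of a variable \<open>P\<close>. Every sufficiently
  fresh \<open>P\<close> must be possible, because implications and quantifiers move on to another
  variable for a stronger condition.\<close>

definition dfn :: "var set \<Rightarrow> ('w \<times> 'd \<Rightarrow> (var \<Rightarrow> 'd) \<Rightarrow> bool) \<Rightarrow> bool" where
  "dfn V X \<longleftrightarrow> finite V \<and> (\<forall>a \<rho> \<sigma>. (\<forall>x\<in>V. \<rho> x = \<sigma> x) \<longrightarrow> X a \<rho> = X a \<sigma>) \<and>
    (\<forall>P. P \<ge> q + 3 \<longrightarrow> P \<notin> V \<longrightarrow>
      (\<exists>F. \<forall>w \<rho>. le w w \<longrightarrow> env w \<rho> \<longrightarrow> (sat F w \<rho> \<longleftrightarrow> X (w, \<rho> P) \<rho>)))"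

lemma dfnI:
  assumes "finite V" "\<And>a \<rho> \<sigma>. (\<And>x. x \<in> V \<Longrightarrow> \<rho> x = \<sigma> x) \<Longrightarrow> X a \<rho> = X a \<sigma>"
    "\<And>P. P \<ge> q + 3 \<Longrightarrow> P \<notin> V \<Longrightarrow>
      \<exists>F. \<forall>w \<rho>. le w w \<longrightarrow> env w \<rho> \<longrightarrow> (sat F w \<rho> \<longleftrightarrow> X (w, \<rho> P) \<rho>)"
  shows "dfn V X"
  using assms unfolding dfn_def by blast

lemma dfn_finite: "dfn V X \<Longrightarrow> finite V"
  by (simp add: dfn_def)

lemma dfn_coincidence: "dfn V X \<Longrightarrow> (\<And>x. x \<in> V \<Longrightarrow> \<rho> x = \<sigma> x) \<Longrightarrow> X a \<rho> = X a \<sigma>"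
  unfolding dfn_def by blast

lemma dfn_fm:
  assumes "dfn V X" "P \<ge> q + 3" "P \<notin> V"
  obtains F where "\<And>w \<rho>. le w w \<Longrightarrow> env w \<rho> \<Longrightarrow> sat F w \<rho> \<longleftrightarrow> X (w, \<rho> P) \<rho>"
  using assms unfolding dfn_def by blast

lemma dfn_mono: "dfn V X \<Longrightarrow> V \<subseteq> V' \<Longrightarrow> finite V' \<Longrightarrow> dfn V' X"
  unfolding dfn_def by (meson subsetD)

lemma dfn_cong:
  assumes "dfn V X" "\<And>a \<rho> \<sigma>. (\<And>x. x \<in> V \<Longrightarrow> \<rho> x = \<sigma> x) \<Longrightarrow> X' a \<rho> = X' a \<sigma>"
    "\<And>w p \<rho>. le w w \<Longrightarrow> p \<in> D w \<Longrightarrow> env w \<rho> \<Longrightarrow> X (w, p) \<rho> = X' (w, p) \<rho>"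
  shows "dfn V X'"
proof (rule dfnI[OF dfn_finite[OF assms(1)] assms(2)])
  fix P assume "P \<ge> q + 3" "P \<notin> V"
  then obtain F where "\<And>w \<rho>. le w w \<Longrightarrow> env w \<rho> \<Longrightarrow> sat F w \<rho> \<longleftrightarrow> X (w, \<rho> P) \<rho>"
    using dfn_fm[OF assms(1)] by blast
  then show "\<exists>F. \<forall>w \<rho>. le w w \<longrightarrow> env w \<rho> \<longrightarrow> (sat F w \<rho> \<longleftrightarrow> X' (w, \<rho> P) \<rho>)"
    using assms(3) env_D by blast
qed

lemma fresh_param: "finite V \<Longrightarrow> \<exists>z. z \<ge> q + 3 \<and> z \<notin> V"
  using fresh_above[of "q + 3" Bot] finite_list[of V] by blast

lemma sat_cond_def_fm':
  "P \<ge> q + 3 \<Longrightarrow> Y \<ge> q + 3 \<Longrightarrow> le w v \<Longrightarrow> env w \<rho> \<Longrightarrow>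
    sat (cond_def_fm P Y) v \<rho> = cond v (\<rho> P) (\<rho> Y)"
  using sat_cond_def_fm le_right env_mono by blast

lemma dfn_delta:
  assumes "Delta0E A"
  shows "dfn (vars A) (\<lambda>a \<rho>. frc (\<lambda>v _. sat A v \<rho>) (fst a) (snd a))"
proof (rule dfnI)
  fix a :: "'w \<times> 'd" and \<rho> \<sigma> :: "var \<Rightarrow> 'd" assume "\<And>x. x \<in> vars A \<Longrightarrow> \<rho> x = \<sigma> x"
  then have "sat A v \<rho> = sat A v \<sigma>" for v using FV_subset_vars by (intro sat_coincidence) blast
  then show "frc (\<lambda>v _. sat A v \<rho>) (fst a) (snd a) = frc (\<lambda>v _. sat A v \<sigma>) (fst a) (snd a)" by simp
next
  fix P assume P: "P \<ge> q + 3" "P \<notin> vars A"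
  obtain Y where Y: "Y \<ge> q + 3" "Y \<notin> insert P (vars A)" using fresh_param[of "insert P (vars A)"] by auto
  have "sat (Ex Y (Imp (cond_def_fm P Y) A)) w \<rho> \<longleftrightarrow> frc (\<lambda>v _. sat A v \<rho>) w (\<rho> P)"
    if w: "le w w" "env w \<rho>" for w \<rho>
  proof -
    have "sat (cond_def_fm P Y) v (\<rho>(Y := y)) = cond v (\<rho> P) y" if "le w v" "y \<in> D w" for v y
      using sat_cond_def_fm'[OF P(1) Y(1) that(1) env_upd[OF w(2) that(2)]] Y(2) by simp
    moreover have "sat A v (\<rho>(Y := y)) = sat A v \<rho>" for v y
      using Y(2) FV_subset_vars by (intro sat_coincidence) auto
    ultimately show ?thesis unfolding sat.simps frc_def by auto
  qed
  then show "\<exists>F. \<forall>w \<rho>. le w w \<longrightarrow> env w \<rho> \<longrightarrow>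
      (sat F w \<rho> \<longleftrightarrow> frc (\<lambda>v _. sat A v \<rho>) (fst (w, \<rho> P)) (snd (w, \<rho> P)))"
    unfolding fst_conv snd_conv by blast
qed simp

lemma dfn_goal:
  assumes G: "G \<ge> q + 3"
  shows "dfn {G} (\<lambda>a \<rho>. fgoal a (\<rho> G))"
proof (rule dfnI)
  fix P assume P: "P \<ge> q + 3" "P \<notin> {G}"
  obtain Y where Y: "Y \<ge> q + 3" "Y \<notin> {P, G}" using fresh_param[of "{P, G}"] by auto
  have "sat (Ex Y (Imp (cond_def_fm P Y) (goal_def_fm G Y))) w \<rho> \<longleftrightarrow> fgoal (w, \<rho> P) (\<rho> G)"
    if w: "le w w" "env w \<rho>" for w \<rho>
  proof -
    have "sat (cond_def_fm P Y) v (\<rho>(Y := y)) = cond v (\<rho> P) y" if "le w v" "y \<in> D w" for v y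
      using sat_cond_def_fm'[OF P(1) Y(1) that(1) env_upd[OF w(2) that(2)]] Y(2) by simp
    moreover have "sat (goal_def_fm G Y) v (\<rho>(Y := y)) = goal v (\<rho> G) y" if "le w v" "y \<in> D w" for v y
      using sat_goal_def_fm[OF G Y(1) env_mono[OF that(1) env_upd[OF w(2) that(2)]]] Y(2) by simp
    ultimately show ?thesis unfolding sat.simps fgoal_pair frc_def by auto
  qed
  then show "\<exists>F. \<forall>w \<rho>. le w w \<longrightarrow> env w \<rho> \<longrightarrow> (sat F w \<rho> \<longleftrightarrow> fgoal (w, \<rho> P) (\<rho> G))" by blast
qed auto

lemma dfn_conj:
  assumes "dfn V X" "dfn V Y"
  shows "dfn V (\<lambda>a \<rho>. X a \<rho> \<and> Y a \<rho>)"
proof (rule dfnI[OF dfn_finite[OF assms(1)]])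
  show "(X a \<rho> \<and> Y a \<rho>) = (X a \<sigma> \<and> Y a \<sigma>)" if "\<And>x. x \<in> V \<Longrightarrow> \<rho> x = \<sigma> x" for a \<rho> \<sigma>
    using dfn_coincidence[OF assms(1) that] dfn_coincidence[OF assms(2) that] by simp
  fix P assume P: "P \<ge> q + 3" "P \<notin> V"
  obtain F1 where F1: "\<And>w \<rho>. le w w \<Longrightarrow> env w \<rho> \<Longrightarrow> sat F1 w \<rho> \<longleftrightarrow> X (w, \<rho> P) \<rho>"
    using dfn_fm[OF assms(1) P] by blast
  obtain F2 where F2: "\<And>w \<rho>. le w w \<Longrightarrow> env w \<rho> \<Longrightarrow> sat F2 w \<rho> \<longleftrightarrow> Y (w, \<rho> P) \<rho>"
    using dfn_fm[OF assms(2) P] by blast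
  show "\<exists>F. \<forall>w \<rho>. le w w \<longrightarrow> env w \<rho> \<longrightarrow> (sat F w \<rho> \<longleftrightarrow> X (w, \<rho> P) \<rho> \<and> Y (w, \<rho> P) \<rho>)"
    using F1 F2 by (intro exI[of _ "And F1 F2"]) simp
qed

lemma dfn_disj:
  assumes "dfn V X" "dfn V Y"
  shows "dfn V (\<lambda>a \<rho>. X a \<rho> \<or> Y a \<rho>)"
proof (rule dfnI[OF dfn_finite[OF assms(1)]])
  show "(X a \<rho> \<or> Y a \<rho>) = (X a \<sigma> \<or> Y a \<sigma>)" if "\<And>x. x \<in> V \<Longrightarrow> \<rho> x = \<sigma> x" for a \<rho> \<sigma>
    using dfn_coincidence[OF assms(1) that] dfn_coincidence[OF assms(2) that] by simp
  fix P assume P: "P \<ge> q + 3" "P \<notin> V"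
  obtain F1 where F1: "\<And>w \<rho>. le w w \<Longrightarrow> env w \<rho> \<Longrightarrow> sat F1 w \<rho> \<longleftrightarrow> X (w, \<rho> P) \<rho>"
    using dfn_fm[OF assms(1) P] by blast
  obtain F2 where F2: "\<And>w \<rho>. le w w \<Longrightarrow> env w \<rho> \<Longrightarrow> sat F2 w \<rho> \<longleftrightarrow> Y (w, \<rho> P) \<rho>"
    using dfn_fm[OF assms(2) P] by blast
  show "\<exists>F. \<forall>w \<rho>. le w w \<longrightarrow> env w \<rho> \<longrightarrow> (sat F w \<rho> \<longleftrightarrow> X (w, \<rho> P) \<rho> \<or> Y (w, \<rho> P) \<rho>)"
    using F1 F2 by (intro exI[of _ "Or F1 F2"]) simp
qed

lemma dfn_exists:
  assumes "dfn V X" "x \<in> V"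
  shows "dfn V (\<lambda>a \<rho>. \<exists>d\<in>fD a. X a (\<rho>(x := d)))"
proof (rule dfnI[OF dfn_finite[OF assms(1)]])
  show "(\<exists>d\<in>fD a. X a (\<rho>(x := d))) = (\<exists>d\<in>fD a. X a (\<sigma>(x := d)))"
    if "\<And>x. x \<in> V \<Longrightarrow> \<rho> x = \<sigma> x" for a \<rho> \<sigma>
  proof -
    have "X a (\<rho>(x := d)) = X a (\<sigma>(x := d))" for d
      by (rule dfn_coincidence[OF assms(1)]) (use that in auto)
    then show ?thesis by simp
  qed
  fix P assume P: "P \<ge> q + 3" "P \<notin> V"
  obtain F where F: "\<And>w \<rho>. le w w \<Longrightarrow> env w \<rho> \<Longrightarrow> sat F w \<rho> \<longleftrightarrow> X (w, \<rho> P) \<rho>"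
    using dfn_fm[OF assms(1) P] by blast
  have "P \<noteq> x" using P assms(2) by auto
  then have "sat (Ex x F) w \<rho> \<longleftrightarrow> (\<exists>d\<in>fD (w, \<rho> P). X (w, \<rho> P) (\<rho>(x := d)))"
    if "le w w" "env w \<rho>" for w \<rho>
    using F[OF that(1) env_upd[OF that(2)]] by auto
  then show "\<exists>F. \<forall>w \<rho>. le w w \<longrightarrow> env w \<rho> \<longrightarrow>
      (sat F w \<rho> \<longleftrightarrow> (\<exists>d\<in>fD (w, \<rho> P). X (w, \<rho> P) (\<rho>(x := d))))" by blast
qed

text \<open>Later worlds are reached by the Kripke clauses for implication and universal
  quantification, stronger conditions by quantifying over \<open>Q\<close> and stating entailment
  under every bound \<open>Y\<close>.\<close>

lemma sat_extensions:
  assumes P: "P \<ge> q + 3" and Q: "Q \<ge> q + 3" "Q \<noteq> P" and Y: "Y \<ge> q + 3" "Y \<noteq> P" "Y \<noteq> Q"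
    and w: "le w w" "env w \<rho>"
    and B: "\<And>u r. le w u \<Longrightarrow> r \<in> D u \<Longrightarrow> sat B u (\<rho>(Q := r)) \<longleftrightarrow> (\<forall>t. le u t \<longrightarrow> Z (t, r))"
  shows "sat (All Q (Imp (All Y (Imp (cond_def_fm Q Y) (cond_def_fm P Y))) B)) w \<rho> \<longleftrightarrow>
    (\<forall>b. fle (w, \<rho> P) b \<longrightarrow> Z b)"
proof -
  have L: "sat (All Y (Imp (cond_def_fm Q Y) (cond_def_fm P Y))) u (\<rho>(Q := r)) \<longleftrightarrow> fle (w, \<rho> P) (u, r)"
    if u: "le w u" "r \<in> D u" for u r
  proof -
    have eu: "env u (\<rho>(Q := r))" using env_upd[OF env_mono[OF u(1) w(2)] u(2)] .
    have "sat (cond_def_fm Q Y) s (\<rho>(Q := r, Y := y)) = cond s r y"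
      "sat (cond_def_fm P Y) s (\<rho>(Q := r, Y := y)) = cond s (\<rho> P) y"
      if "le u t" "y \<in> D t" "le t s" for t y s
      using sat_cond_def_fm'[OF Q(1) Y(1) that(3) env_upd[OF env_mono[OF that(1) eu] that(2)]]
        sat_cond_def_fm'[OF P Y(1) that(3) env_upd[OF env_mono[OF that(1) eu] that(2)]] Q Y by simp_all
    then have "sat (All Y (Imp (cond_def_fm Q Y) (cond_def_fm P Y))) u (\<rho>(Q := r)) \<longleftrightarrow>
      (\<forall>t. le u t \<longrightarrow> (\<forall>y\<in>D t. \<forall>s. le t s \<longrightarrow> cond s r y \<longrightarrow> cond s (\<rho> P) y))"
      unfolding sat.simps by blast
    also have "\<dots> \<longleftrightarrow> fle (w, \<rho> P) (u, r)"
      unfolding fle.simps using u env_D[OF w(2)] le_right le_trans D_mono by meson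
    finally show ?thesis .
  qed
  show ?thesis
  proof
    assume s: "sat (All Q (Imp (All Y (Imp (cond_def_fm Q Y) (cond_def_fm P Y))) B)) w \<rho>"
    show "\<forall>b. fle (w, \<rho> P) b \<longrightarrow> Z b"
    proof (intro HOL.allI impI)
      fix b assume b: "fle (w, \<rho> P) b"
      obtain v r where v: "b = (v, r)" by fastforce
      note f = fleD[OF b[unfolded v]]
      have "sat (Imp (All Y (Imp (cond_def_fm Q Y) (cond_def_fm P Y))) B) v (\<rho>(Q := r))"
        using s f(1,3) unfolding sat.simps(7) by blast
      then have "sat B v (\<rho>(Q := r))"
        using L[OF f(1,3)] b f(5) unfolding v sat.simps(6) by blast
      then show "Z b" using B[OF f(1,3)] f(5) v by blast
    qed
  next
    assume s: "\<forall>b. fle (w, \<rho> P) b \<longrightarrow> Z b"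
    have "sat B u (\<rho>(Q := r))"
      if "le w v" "r \<in> D v" "le v u" "sat (All Y (Imp (cond_def_fm Q Y) (cond_def_fm P Y))) u (\<rho>(Q := r))" for v r u
    proof -
      have u: "le w u" "r \<in> D u" using that le_trans D_mono by blast+
      have f: "fle (w, \<rho> P) (u, r)" using L[OF u] that(4) by blast
      have "Z (t, r)" if "le u t" for t
        using s fle_trans[OF f fle_world[OF that u(2)]] by blast
      then show ?thesis using B[OF u] by blast
    qed
    then show "sat (All Q (Imp (All Y (Imp (cond_def_fm Q Y) (cond_def_fm P Y))) B)) w \<rho>"
      unfolding sat.simps(6)[of _ B] sat.simps(7)[of Q] by blast
  qed
qed

lemma dfn_imp:
  assumes "dfn V X" "dfn V X'"
  shows "dfn V (\<lambda>a \<rho>. \<forall>b. fle a b \<longrightarrow> X b \<rho> \<longrightarrow> X' b \<rho>)"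
proof (rule dfnI[OF dfn_finite[OF assms(1)]])
  show "(\<forall>b. fle a b \<longrightarrow> X b \<rho> \<longrightarrow> X' b \<rho>) = (\<forall>b. fle a b \<longrightarrow> X b \<sigma> \<longrightarrow> X' b \<sigma>)"
    if "\<And>x. x \<in> V \<Longrightarrow> \<rho> x = \<sigma> x" for a \<rho> \<sigma>
    using dfn_coincidence[OF assms(1) that] dfn_coincidence[OF assms(2) that] by simp
  fix P assume P: "P \<ge> q + 3" "P \<notin> V"
  obtain Q where Q: "Q \<ge> q + 3" "Q \<notin> insert P V"
    using fresh_param[of "insert P V"] dfn_finite[OF assms(1)] by auto
  obtain Y where Y: "Y \<ge> q + 3" "Y \<notin> {P, Q}" using fresh_param[of "{P, Q}"] by auto
  have QV: "Q \<notin> V" using Q(2) by simp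
  obtain F1 where F1: "\<And>w \<rho>. le w w \<Longrightarrow> env w \<rho> \<Longrightarrow> sat F1 w \<rho> \<longleftrightarrow> X (w, \<rho> Q) \<rho>"
    using dfn_fm[OF assms(1) Q(1) QV] by blast
  obtain F2 where F2: "\<And>w \<rho>. le w w \<Longrightarrow> env w \<rho> \<Longrightarrow> sat F2 w \<rho> \<longleftrightarrow> X' (w, \<rho> Q) \<rho>"
    using dfn_fm[OF assms(2) Q(1) QV] by blast
  have "sat (All Q (Imp (All Y (Imp (cond_def_fm Q Y) (cond_def_fm P Y))) (Imp F1 F2))) w \<rho> \<longleftrightarrow>
      (\<forall>b. fle (w, \<rho> P) b \<longrightarrow> X b \<rho> \<longrightarrow> X' b \<rho>)" if w: "le w w" "env w \<rho>" for w \<rho>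
  proof (rule sat_extensions[where Z = "\<lambda>b. X b \<rho> \<longrightarrow> X' b \<rho>", OF P(1) Q(1) _ Y(1) _ _ w])
    show "Q \<noteq> P" "Y \<noteq> P" "Y \<noteq> Q" using Q Y by auto
    fix u r assume u: "le w u" "r \<in> D u"
    have "sat F1 t (\<rho>(Q := r)) = X (t, r) \<rho>" "sat F2 t (\<rho>(Q := r)) = X' (t, r) \<rho>" if t: "le u t" for t
    proof -
      have e: "env t (\<rho>(Q := r))"
        using env_upd[OF env_mono[OF le_trans[OF u(1) t] w(2)] D_mono[OF t u(2)]] .
      have "X (t, r) (\<rho>(Q := r)) = X (t, r) \<rho>"
        by (rule dfn_coincidence[OF assms(1)]) (use QV in auto)
      moreover have "X' (t, r) (\<rho>(Q := r)) = X' (t, r) \<rho>"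
        by (rule dfn_coincidence[OF assms(2)]) (use QV in auto)
      ultimately show "sat F1 t (\<rho>(Q := r)) = X (t, r) \<rho>" "sat F2 t (\<rho>(Q := r)) = X' (t, r) \<rho>"
        using F1[OF le_right[OF t] e] F2[OF le_right[OF t] e] by simp_all
    qed
    then show "sat (Imp F1 F2) u (\<rho>(Q := r)) \<longleftrightarrow> (\<forall>t. le u t \<longrightarrow> X (t, r) \<rho> \<longrightarrow> X' (t, r) \<rho>)"
      unfolding sat.simps by blast
  qed
  then show "\<exists>F. \<forall>w \<rho>. le w w \<longrightarrow> env w \<rho> \<longrightarrow>
      (sat F w \<rho> \<longleftrightarrow> (\<forall>b. fle (w, \<rho> P) b \<longrightarrow> X b \<rho> \<longrightarrow> X' b \<rho>))" by blast
qed

lemma dfn_all: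
  assumes "dfn V X" "x \<in> V"
  shows "dfn V (\<lambda>a \<rho>. \<forall>b. fle a b \<longrightarrow> (\<forall>d\<in>fD b. X b (\<rho>(x := d))))"
proof (rule dfnI[OF dfn_finite[OF assms(1)]])
  show "(\<forall>b. fle a b \<longrightarrow> (\<forall>d\<in>fD b. X b (\<rho>(x := d)))) = (\<forall>b. fle a b \<longrightarrow> (\<forall>d\<in>fD b. X b (\<sigma>(x := d))))"
    if "\<And>x. x \<in> V \<Longrightarrow> \<rho> x = \<sigma> x" for a \<rho> \<sigma>
  proof -
    have "X b (\<rho>(x := d)) = X b (\<sigma>(x := d))" for b d
      by (rule dfn_coincidence[OF assms(1)]) (use that in auto)
    then show ?thesis by simp
  qed
  fix P assume P: "P \<ge> q + 3" "P \<notin> V"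
  obtain Q where Q: "Q \<ge> q + 3" "Q \<notin> insert P V"
    using fresh_param[of "insert P V"] dfn_finite[OF assms(1)] by auto
  obtain Y where Y: "Y \<ge> q + 3" "Y \<notin> {P, Q}" using fresh_param[of "{P, Q}"] by auto
  have QV: "Q \<notin> V" and Qx: "Q \<noteq> x" using Q(2) assms(2) by auto
  obtain F where F: "\<And>w \<rho>. le w w \<Longrightarrow> env w \<rho> \<Longrightarrow> sat F w \<rho> \<longleftrightarrow> X (w, \<rho> Q) \<rho>"
    using dfn_fm[OF assms(1) Q(1) QV] by blast
  have "sat (All Q (Imp (All Y (Imp (cond_def_fm Q Y) (cond_def_fm P Y))) (All x F))) w \<rho> \<longleftrightarrow>
      (\<forall>b. fle (w, \<rho> P) b \<longrightarrow> (\<forall>d\<in>fD b. X b (\<rho>(x := d))))" if w: "le w w" "env w \<rho>" for w \<rho>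
  proof (rule sat_extensions[where Z = "\<lambda>b. \<forall>d\<in>fD b. X b (\<rho>(x := d))", OF P(1) Q(1) _ Y(1) _ _ w])
    show "Q \<noteq> P" "Y \<noteq> P" "Y \<noteq> Q" using Q Y by auto
    fix u r assume u: "le w u" "r \<in> D u"
    have "sat F t (\<rho>(Q := r, x := d)) = X (t, r) (\<rho>(x := d))" if t: "le u t" "d \<in> D t" for t d
    proof -
      have e: "env t (\<rho>(Q := r, x := d))"
        using env_upd[OF env_upd[OF env_mono[OF le_trans[OF u(1) t(1)] w(2)] D_mono[OF t(1) u(2)]] t(2)] .
      have "X (t, r) (\<rho>(Q := r, x := d)) = X (t, r) (\<rho>(x := d))"
        by (rule dfn_coincidence[OF assms(1)]) (use QV in auto)
      then show ?thesis using F[OF le_right[OF t(1)] e] Qx by simp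
    qed
    then show "sat (All x F) u (\<rho>(Q := r)) \<longleftrightarrow> (\<forall>t. le u t \<longrightarrow> (\<forall>d\<in>fD (t, r). X (t, r) (\<rho>(x := d))))"
      unfolding sat.simps fD_simp by blast
  qed
  then show "\<exists>F. \<forall>w \<rho>. le w w \<longrightarrow> env w \<rho> \<longrightarrow>
      (sat F w \<rho> \<longleftrightarrow> (\<forall>b. fle (w, \<rho> P) b \<longrightarrow> (\<forall>d\<in>fD b. X b (\<rho>(x := d)))))" by blast
qed

text \<open>Unfolded, \<open>fJ\<close> is a nest of implications below one universal quantifier
  over the goal \<open>G\<close>. \<open>dfn_imp\<close> introduces one step to an extension more
  than the definition has, which transitivity absorbs.\<close>

lemma dfn_J:
  assumes "dfn V X"
  shows "\<exists>V'. dfn V' (\<lambda>a \<rho>. fJ (\<lambda>b. X b \<rho>) a)"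
proof -
  obtain G where G: "G \<ge> q + 3" "G \<notin> V" using fresh_param[OF dfn_finite[OF assms]] by blast
  let ?V = "insert G V"
  have fin: "finite ?V" using dfn_finite[OF assms] by simp
  have X: "dfn ?V X" by (rule dfn_mono[OF assms]) (use fin in auto)
  have g: "dfn ?V (\<lambda>a \<rho>. fgoal a (\<rho> G))" by (rule dfn_mono[OF dfn_goal[OF G(1)]]) (use fin in auto)
  have d: "dfn ?V (\<lambda>a \<rho>. \<forall>b. fle a b \<longrightarrow> (\<forall>g\<in>fD b. (\<lambda>b \<rho>. \<forall>c. fle b c \<longrightarrow>
      (\<forall>e. fle c e \<longrightarrow> X e \<rho> \<longrightarrow> fgoal e (\<rho> G)) \<longrightarrow> fgoal c (\<rho> G)) b (\<rho>(G := g))))"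
    by (rule dfn_all[OF dfn_imp[OF dfn_imp[OF X g] g]]) simp
  have XG: "X e (\<rho>(G := g)) = X e \<rho>" for e \<rho> g
    by (rule dfn_coincidence[OF assms]) (use G(2) in auto)
  have "(\<forall>b. fle a b \<longrightarrow> (\<forall>g\<in>fD b. (\<lambda>b \<rho>. \<forall>c. fle b c \<longrightarrow>
      (\<forall>e. fle c e \<longrightarrow> X e \<rho> \<longrightarrow> fgoal e (\<rho> G)) \<longrightarrow> fgoal c (\<rho> G)) b (\<rho>(G := g)))) \<longleftrightarrow> fJ (\<lambda>b. X b \<rho>) a" for a \<rho>
    unfolding fJ_def XG fun_upd_same using fle_right fle_trans F.D_mono by meson
  then show ?thesis using d by auto
qed

lemma dfn_union: "dfn V X \<Longrightarrow> dfn V' X' \<Longrightarrow> dfn (V \<union> V') X \<and> dfn (V \<union> V') X'"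
  by (auto intro: dfn_mono dest: dfn_finite)

lemma dfn_unfold:
  assumes "dfn V (F.sat B)" "prv {} (Iff A B)"
  shows "\<exists>V. dfn V (F.sat A)"
proof -
  have "dfn (V \<union> vars A) (F.sat B)" by (rule dfn_mono[OF assms(1)]) (use dfn_finite[OF assms(1)] in auto)
  then have "dfn (V \<union> vars A) (F.sat A)"
  proof (rule dfn_cong)
    show "F.sat A a \<rho> = F.sat A a \<sigma>" if "\<And>x. x \<in> V \<union> vars A \<Longrightarrow> \<rho> x = \<sigma> x" for a \<rho> \<sigma>
      by (rule F.sat_coincidence) (use that FV_subset_vars in blast)
    show "F.sat B (w, p) \<rho> = F.sat A (w, p) \<rho>" if "le w w" "p \<in> D w" "env w \<rho>" for w p \<rho>
      using F.soundness[OF assms(2)] fle_refl[OF that(1,2)] that(3)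
      unfolding F.valid_def F.sat_Iff by (metis F_env empty_iff)
  qed
  then show ?thesis by blast
qed

theorem forcing_definable: "\<exists>V. dfn V (F.sat A)"
proof (induction A rule: measure_induct_rule[of weight])
  case (less A)
  have delta: "\<exists>V. dfn V (F.sat A)" if "Delta0E A"
  proof -
    have "dfn (vars A) (F.sat A)"
    proof (rule dfn_cong[OF dfn_delta[OF that]])
      show "F.sat A a \<rho> = F.sat A a \<sigma>" if "\<And>x. x \<in> vars A \<Longrightarrow> \<rho> x = \<sigma> x" for a \<rho> \<sigma>
        by (rule F.sat_coincidence) (use that FV_subset_vars in blast)
    qed (simp add: sat_delta[OF that])
    then show ?thesis by blast
  qed
  show ?case
  proof (cases A)
    case (And B C)
    obtain V V' where "dfn V (F.sat B)" "dfn V' (F.sat C)" using less[of B] less[of C] And by auto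
    then have "dfn (V \<union> V') (F.sat B)" "dfn (V \<union> V') (F.sat C)" using dfn_union by blast+
    from dfn_conj[OF this] show ?thesis unfolding And F.sat.simps[abs_def] by blast
  next
    case (Or B C)
    obtain V V' where "dfn V (F.sat B)" "dfn V' (F.sat C)" using less[of B] less[of C] Or by auto
    then have "dfn (V \<union> V') (F.sat B)" "dfn (V \<union> V') (F.sat C)" using dfn_union by blast+
    from dfn_J[OF dfn_disj[OF this]] show ?thesis unfolding Or F.sat.simps[abs_def] .
  next
    case (Imp B C)
    obtain V V' where "dfn V (F.sat B)" "dfn V' (F.sat C)" using less[of B] less[of C] Imp by auto
    then have "dfn (V \<union> V') (F.sat B)" "dfn (V \<union> V') (F.sat C)" using dfn_union by blast+
    from dfn_imp[OF this] show ?thesis unfolding Imp F.sat.simps[abs_def] by blast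
  next
    case (All x B)
    obtain V where V: "dfn V (F.sat B)" using less[of B] All by auto
    have "dfn (insert x V) (F.sat B)" by (rule dfn_mono[OF V]) (use dfn_finite[OF V] in auto)
    from dfn_all[OF this] show ?thesis unfolding All F.sat.simps[abs_def] by blast
  next
    case (Ex x B)
    obtain V where V: "dfn V (F.sat B)" using less[of B] Ex by auto
    have "dfn (insert x V) (F.sat B)" by (rule dfn_mono[OF V]) (use dfn_finite[OF V] in auto)
    from dfn_J[OF dfn_exists[OF this]] show ?thesis unfolding Ex F.sat.simps[abs_def] by simp
  next
    case (BAll x t B)
    obtain z where z: "z \<notin> insert t (vars B)" using fresh_var[of "insert t (vars B)"] by auto
    have "weight (All z (Imp (Mem z t) (subst B x z))) < weight A" using BAll by simp
    from less[OF this] obtain V where V: "dfn V (F.sat (All z (Imp (Mem z t) (subst B x z))))" by (rule HOL.exE)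
    show ?thesis unfolding BAll by (rule dfn_unfold[OF V prv_BAll_unfold]) (use z in auto)
  next
    case (BEx x t B)
    obtain z where z: "z \<notin> insert t (vars B)" using fresh_var[of "insert t (vars B)"] by auto
    have "weight (Ex z (And (Mem z t) (subst B x z))) < weight A" using BEx by simp
    from less[OF this] obtain V where V: "dfn V (F.sat (Ex z (And (Mem z t) (subst B x z))))" by (rule HOL.exE)
    show ?thesis unfolding BEx by (rule dfn_unfold[OF V prv_BEx_unfold]) (use z in auto)
  next
    case (EAll x a b B)
    obtain z where z: "z \<notin> {a, b} \<union> vars B" using fresh_var[of "{a, b} \<union> vars B"] by auto
    have "weight (All z (Imp (fun_fm z a b) (subst B x z))) < weight A" using EAll weight_fun_fm[of z a b] by simp
    from less[OF this] obtain V where V: "dfn V (F.sat (All z (Imp (fun_fm z a b) (subst B x z))))" by (rule HOL.exE)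
    show ?thesis unfolding EAll by (rule dfn_unfold[OF V prv_EAll_unfold]) (use z in auto)
  next
    case (EEx x a b B)
    obtain z where z: "z \<notin> {a, b} \<union> vars B" using fresh_var[of "{a, b} \<union> vars B"] by auto
    have "weight (Ex z (And (fun_fm z a b) (subst B x z))) < weight A" using EEx weight_fun_fm[of z a b] by simp
    from less[OF this] obtain V where V: "dfn V (F.sat (Ex z (And (fun_fm z a b) (subst B x z))))" by (rule HOL.exE)
    show ?thesis unfolding EEx by (rule dfn_unfold[OF V prv_EEx_unfold]) (use z in auto)
  qed (rule delta, simp)+
qed

text \<open>The schema of the ground model is applied to the formula defining that \<open>A\<close>
  is forced, along real membership; progressiveness is given for forced membership, so the two have
  to be reconciled.\<close>

lemma F_set_induction:
  assumes y: "y \<noteq> x" "y \<notin> FV A" "free_for y x A"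
  shows "F.valid (Imp (All x (Imp (BAll y x (subst A x y)) A)) (All x A))"
proof -
  obtain V where V: "dfn V (F.sat A)" using forcing_definable by blast
  have fin: "finite (insert x V \<union> vars A)" using dfn_finite[OF V] by simp
  obtain P where P: "P \<ge> q + 3" "P \<notin> insert x V \<union> vars A" using fresh_param[OF fin] by blast
  have PV: "P \<notin> V" using P(2) by simp
  obtain B where B: "\<And>w \<rho>. le w w \<Longrightarrow> env w \<rho> \<Longrightarrow> sat B w \<rho> \<longleftrightarrow> F.sat A (w, \<rho> P) \<rho>"
    using dfn_fm[OF V P(1) PV] by blast
  have main: "F.sat A (v, p) (\<rho>(x := d))"
    if w: "le w w" "p \<in> D w" "env w \<rho>"
      and H: "F.sat (All x (Imp (BAll y x (subst A x y)) A)) (w, p) \<rho>" and v: "le w v" "d \<in> D v" for w p \<rho> v d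
  proof -
    \<comment> \<open>The condition stays fixed during the induction; stronger ones inherit the
      result by monotonicity.\<close>
    let ?\<rho> = "\<rho>(P := p)"
    have e: "env v ?\<rho>" if "le w v" for v using env_mono[OF that env_upd[OF w(3,2)]] .
    have BF: "sat B v (?\<rho>(x := d)) \<longleftrightarrow> F.sat A (v, p) (\<rho>(x := d))" if "le w v" "d \<in> D v" for v d
    proof -
      have "F.sat A (v, p) (?\<rho>(x := d)) = F.sat A (v, p) (\<rho>(x := d))"
        by (rule F.sat_coincidence) (use P(2) FV_subset_vars in auto)
      then show ?thesis
        using B[OF le_right[OF that(1)] env_upd[OF e[OF that(1)] that(2)]] P(2) by simp
    qed
    have "sat B v (?\<rho>(x := d))"
    proof (rule set_induction[OF w(1) e[OF w(1)] _ v])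
      fix v d assume v: "le w v" "d \<in> D v"
        and IH: "\<And>u e. le v u \<Longrightarrow> e \<in> D u \<Longrightarrow> mem u e d \<Longrightarrow> sat B u (?\<rho>(x := e))"
      note vv = le_right[OF v(1)] and pv = D_mono[OF v(1) w(2)]
      have "F.sat (BAll y x (subst A x y)) (v, p) (\<rho>(x := d))"
        unfolding F.sat.simps
      proof (intro HOL.allI impI ballI)
        fix b e assume b: "fle (v, p) b" "e \<in> fD b" "fmem b e ((\<rho>(x := d)) x)"
        obtain u r where u: "b = (u, r)" by fastforce
        note f = fleD[OF b(1)[unfolded u]]
        have eu: "e \<in> D u" using b(2) u by simp
        have env_u: "env u (\<rho>(x := e))" using env_upd[OF env_mono[OF le_trans[OF v(1) f(1)] w(3)] eu] .
        obtain z where z: "z \<in> D u" "\<And>t. le u t \<Longrightarrow> cond t r z \<Longrightarrow> mem t e d"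
          using b(3) u unfolding fmem_def frc_def by auto
        have "F.sat A (u, r) (\<rho>(x := e))"
        \<comment> \<open>Forced membership is real membership only where the relativised condition
          holds, and it suffices to argue there.\<close>
        proof (rule F_sat_local[OF f(5,3) env_u z(1)])
          fix t assume t: "le u t" "cond t r z"
          have vt: "le v t" using le_trans[OF f(1) t(1)] .
          have "sat B t (?\<rho>(x := e))" using IH[OF vt D_mono[OF t(1) eu] z(2)[OF t]] .
          then have "F.sat A (t, p) (\<rho>(x := e))" using BF[OF le_trans[OF v(1) vt] D_mono[OF t(1) eu]] by blast
          then show "F.sat A (t, r) (\<rho>(x := e))"
            using F.sat_mono[OF fle_shift[OF b(1)[unfolded u] t(1)]]
              F.sat_mono[OF fleI[of t t p r]] fleD(6)[OF b(1)[unfolded u] le_trans[OF t(1)]]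
              le_right[OF t(1)] D_mono[OF vt pv] D_mono[OF t(1) f(3)] by blast
        qed
        moreover have "F.sat (subst A x y) b (\<rho>(x := d, y := e)) = F.sat A b (\<rho>(x := e))"
          using y FV_subset_vars by (auto simp: F.sat_subst[OF y(3)] intro!: F.sat_coincidence)
        ultimately show "F.sat (subst A x y) b (\<rho>(x := d, y := e))" using u by simp
      qed
      then have "F.sat A (v, p) (\<rho>(x := d))"
        using H[unfolded F.sat.simps(6,7)] fle_world[OF v(1) w(2)] v(2) fle_refl[OF vv pv] fD_simp by blast
      then show "sat B v (?\<rho>(x := d))" using BF[OF v] by blast
    qed
    then show ?thesis using BF[OF v] by blast
  qed
  show ?thesis
    unfolding F.valid_def F.sat.simps(6)[of _ "All x A"]
  proof (intro HOL.allI impI)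
    fix a \<rho> b assume a: "fle a a" "F.env a \<rho>" "fle a b"
      "F.sat (All x (Imp (BAll y x (subst A x y)) A)) b \<rho>"
    obtain w p where b: "b = (w, p)" by fastforce
    have w: "le w w" "p \<in> D w" using fle_right[OF a(3)] b fleD by blast+
    have ew: "env w \<rho>" using F.env_mono[OF a(3,2)] b by simp
    show "F.sat (All x A) b \<rho>"
      unfolding F.sat.simps
    proof (intro HOL.allI impI ballI)
      fix c d assume c: "fle b c" "d \<in> fD c"
      obtain v r where v: "c = (v, r)" by fastforce
      note f = fleD[OF c(1)[unfolded v b]]
      have "F.sat A (v, p) (\<rho>(x := d))"
        using main[OF w ew a(4)[unfolded b] f(1)] c(2) v by simp
      moreover have "fle (v, p) (v, r)" by (rule fleI[OF f(5) D_mono[OF f(1,2)] f(3)]) (rule f(6))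
      ultimately show "F.sat A c (\<rho>(x := d))" using F.sat_mono v by blast
    qed
  qed
qed

section \<open>The other axioms and the descent to the ground model\<close>

lemma F_validI:
  assumes "\<And>w p \<rho>. le w w \<Longrightarrow> p \<in> D w \<Longrightarrow> env w \<rho> \<Longrightarrow> F.sat A (w, p) \<rho>"
  shows "F.valid A"
  unfolding F.valid_def
proof (intro HOL.allI impI)
  fix a \<rho> assume "fle a a" "F.env a \<rho>"
  then show "F.sat A a \<rho>" using assms fleD by (cases a) simp
qed

lemma F_valid_ImpI:
  assumes "\<And>w p \<rho>. le w w \<Longrightarrow> p \<in> D w \<Longrightarrow> env w \<rho> \<Longrightarrow> F.sat A (w, p) \<rho> \<Longrightarrow> F.sat B (w, p) \<rho>"
  shows "F.valid (Imp A B)"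
proof (rule F_validI)
  fix w p \<rho> assume w: "le w w" "p \<in> D w" "env w \<rho>"
  show "F.sat (Imp A B) (w, p) \<rho>"
    unfolding F.sat.simps
  proof (intro HOL.allI impI)
    fix b assume b: "fle (w, p) b" "F.sat A b \<rho>"
    obtain v r where v: "b = (v, r)" by fastforce
    note f = fleD[OF b(1)[unfolded v]]
    show "F.sat B b \<rho>" unfolding v
      by (rule assms[OF f(5,3) env_mono[OF f(1) w(3)] b(2)[unfolded v]])
  qed
qed

lemma F_exI:
  assumes "Delta0E A" "le w w" "p \<in> D w" "env w \<rho>" "d \<in> D w"
    "frc (\<lambda>v _. sat A v (\<rho>(z := d))) w p"
  shows "F.sat (Ex z A) (w, p) \<rho>"
proof -
  have s: "F.sat A (w, p) (\<rho>(z := d))"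
    using sat_delta[OF assms(1-3) env_upd[OF assms(4,5)]] assms(6) by simp
  have "fJ (\<lambda>b. \<exists>d\<in>fD b. F.sat A b (\<rho>(z := d))) (w, p)"
  proof (rule F.J_unit[OF fle_refl[OF assms(2,3)]])
    fix b assume b: "fle (w, p) b"
    have "d \<in> fD b" using F.D_mono[OF b] assms(5) by simp
    then show "\<exists>d\<in>fD b. F.sat A b (\<rho>(z := d))" using F.sat_mono[OF b s] by blast
  qed
  then show ?thesis by simp
qed

lemma F_valid_delta:
  assumes "Delta0E A" "valid A"
  shows "F.valid A"
proof (rule F_validI)
  fix w p \<rho> assume w: "le w w" "p \<in> D w" "env w \<rho>"
  have "sat A v \<rho>" if "le w v" for v
    using assms(2) le_right[OF that] env_mono[OF that w(3)] unfolding valid_def by blast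
  then show "F.sat A (w, p) \<rho>" unfolding sat_delta[OF assms(1) w] by (rule frc_true[OF w(2)])
qed

text \<open>A witness from the ground model remains one, by absoluteness of the matrix. Pairing,
  union, infinity, separation and exponentiation all have this form.\<close>

lemma F_valid_Ex_delta:
  assumes "Delta0E A" "valid (Ex z A)"
  shows "F.valid (Ex z A)"
proof (rule F_validI)
  fix w p \<rho> assume w: "le w w" "p \<in> D w" "env w \<rho>"
  obtain d where d: "d \<in> D w" "sat A w (\<rho>(z := d))"
    using assms(2) w unfolding valid_def by auto
  have "frc (\<lambda>v _. sat A v (\<rho>(z := d))) w p"
    by (rule frc_true[OF w(2)]) (rule sat_mono[OF _ d(2)])
  then show "F.sat (Ex z A) (w, p) \<rho>" by (rule F_exI[OF assms(1) w d(1)])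
qed

text \<open>The premise is a Sigma formula; once it is relativised to the bound \<open>c\<close>,
  that same \<open>c\<close> is the collecting set.\<close>

lemma F_valid_collection:
  assumes "Delta0E A" "distinct [x, y, a, z]" "z \<notin> FV A" "subfms (BAll x a (Ex y A)) \<subseteq> set Fs"
  shows "F.valid (Imp (BAll x a (Ex y A)) (Ex z (BAll x a (BEx y z A))))"
proof (rule F_valid_ImpI)
  fix w p \<rho> assume w: "le w w" "p \<in> D w" "env w \<rho>" and s: "F.sat (BAll x a (Ex y A)) (w, p) \<rho>"
  have "SigmaE (BAll x a (Ex y A))" using assms(1) by (intro S_ball S_ex S_d0)
  from sigma_pi(1)[OF this assms(4) w s]
  obtain c where c: "c \<in> D w" "\<And>v. le w v \<Longrightarrow> cond v p c \<Longrightarrow> rsat (BAll x a (Ex y A)) v \<rho> c"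
    unfolding frc_def by blast
  have "sat (BAll x a (BEx y z A)) v (\<rho>(z := c))" if v: "le w v" "cond v p c" for v
  proof -
    have "sat A u (\<rho>(z := c, x := d, y := e)) = sat A u (\<rho>(x := d, y := e))" for u d e
      by (rule sat_coincidence) (use assms(3) in auto)
    then show ?thesis
      using c(2)[OF v] assms(2) by (auto simp: rsat_Delta0E[OF assms(1)])
  qed
  then have f: "frc (\<lambda>v _. sat (BAll x a (BEx y z A)) v (\<rho>(z := c))) w p"
    using c(1) unfolding frc_def by blast
  show "F.sat (Ex z (BAll x a (BEx y z A))) (w, p) \<rho>"
    by (rule F_exI[OF _ w c(1) f]) (use assms(1) in simp)
qed

text \<open>The bound supplied by \<open>sigma_pi\<close> is the reflecting set, and absoluteness
  applies because \<open>rel z A\<close> is Delta_0.\<close>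

lemma F_valid_reflection:
  assumes "SigmaE A" "z \<notin> vars A" "subfms A \<subseteq> set Fs"
  shows "F.valid (Imp A (Ex z (rel z A)))"
proof (rule F_valid_ImpI)
  fix w p \<rho> assume w: "le w w" "p \<in> D w" "env w \<rho>" and s: "F.sat A (w, p) \<rho>"
  obtain c where c: "c \<in> D w" "\<And>v. le w v \<Longrightarrow> cond v p c \<Longrightarrow> rsat A v \<rho> c"
    using sigma_pi(1)[OF assms(1,3) w s] unfolding frc_def by blast
  then have "frc (\<lambda>v _. sat (rel z A) v (\<rho>(z := c))) w p"
    unfolding frc_def using rsat_eq_sat_rel[OF assms(2)] by blast
  then show "F.sat (Ex z (rel z A)) (w, p) \<rho>"
    by (rule F_exI[OF Delta0E_rel w c(1)])
qed

lemma F_valid_IKPE: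
  assumes "B \<in> IKPE" "subfms B \<subseteq> set Fs"
  shows "F.valid B"
  using assms(1)
proof cases
  case (ext A x a b y)
  then have "Delta0E B" by simp
  then show ?thesis using IKPE_valid[OF assms(1)] by (rule F_valid_delta)
next
  case (pair z x y)
  show ?thesis using IKPE_valid[OF assms(1)] unfolding pair(1)
    by (rule F_valid_Ex_delta[rotated]) (simp add: pair)
next
  case (union x y u z)
  show ?thesis using IKPE_valid[OF assms(1)] unfolding union(1)
    by (rule F_valid_Ex_delta[rotated]) (simp add: union)
next
  case (infinity z u v w)
  show ?thesis using IKPE_valid[OF assms(1)] unfolding infinity(1)
    by (rule F_valid_Ex_delta[rotated]) (simp add: infinity)
next
  case (separation A x a z)
  show ?thesis using IKPE_valid[OF assms(1)] unfolding separation(1)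
    by (rule F_valid_Ex_delta[rotated]) (simp add: separation)
next
  case (collection A x y a z)
  then show ?thesis using F_valid_collection assms(2) by simp
next
  case (set_induction y x A)
  then show ?thesis using F_set_induction by simp
next
  case (exponentiation z x a b)
  show ?thesis using IKPE_valid[OF assms(1)] unfolding exponentiation(1)
    by (rule F_valid_Ex_delta[rotated]) (simp add: exponentiation)
qed

lemma F_valid_axiom:
  assumes "B \<in> IKPE \<union> SigmaE_Refl" "subfms B \<subseteq> set Fs"
  shows "F.valid B"
proof (cases "B \<in> IKPE")
  case True then show ?thesis using F_valid_IKPE assms(2) by blast
next
  case False
  then obtain A z where "B = Imp A (Ex z (rel z A))" "SigmaE A" "z \<notin> vars A"
    using assms(1) by (auto simp: SigmaE_Refl_def)
  then show ?thesis using F_valid_reflection assms(2) by simp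
qed

text \<open>At the empty condition the premise \<open>cond\<close> holds outright, so a forced Sigma
  formula is true relativised to some set, and hence true.\<close>

lemma sigma_descent:
  assumes "SigmaE A" "subfms A \<subseteq> set Fs" "F.valid A" "le w w" "env w \<rho>"
  shows "sat A w \<rho>"
proof -
  obtain p where p: "p \<in> D w" "\<And>v y. le w v \<Longrightarrow> cond v p y"
    using cond_top[OF assms(4) env_D[OF assms(5)]] by blast
  have "F.sat A (w, p) \<rho>"
    using assms(3) fle_refl[OF assms(4) p(1)] assms(5) unfolding F.valid_def by (metis F_env)
  then obtain y where "rsat A w \<rho> y"
    using sigma_pi(1)[OF assms(1,2,4) p(1) assms(5)] p(2) assms(4) unfolding frc_def by blast
  then show ?thesis by (rule rsat_sat(1)[OF assms(1)])
qed

end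

theorem theorem4p29:
  assumes "SigmaE A" and "FV A = {}"
    and "prv (IKPE \<union> SigmaE_Refl) A"
  shows "prv IKPE A"
proof (rule ccontr)
  assume "\<not> prv IKPE A"
  then obtain w where w: "cle IKPE w w" "\<not> C.sat IKPE A w (canv w)"
    using completeness[OF _ assms(2)] by blast
  obtain T where T: "T \<subseteq> IKPE \<union> SigmaE_Refl" "finite T" "prv T A"
    using prv_finite[OF assms(3)] by blast
  \<comment> \<open>\<open>A\<close> is included for the final descent, \<open>inh_fm 1 0\<close>
    for coding Delta_0 statements, and \<open>T\<close> for collection and reflection.\<close>
  have "finite (\<Union>(subfms ` ({A, inh_fm 1 0} \<union> T)))" using T(2) by auto
  from finite_list[OF this] obtain Fs where Fs: "set Fs = \<Union>(subfms ` ({A, inh_fm 1 0} \<union> T))"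
    by (rule HOL.exE)
  have "finite (\<Union>(vars ` set Fs))" by simp
  then obtain N where N: "\<forall>x\<in>\<Union>(vars ` set Fs). x < N"
    by (auto simp: finite_nat_set_iff_bounded)
  interpret forcing "cle IKPE" fst cmem ceq Fs N
  proof
    show "C.valid IKPE B" if "B \<in> IKPE" for B using C_valid_prv[OF prv.ax[OF that]] .
    show "vars F \<subseteq> {..<N}" if "F \<in> set Fs" for F using N that by auto
    show "inh_fm 1 0 \<in> set Fs" unfolding Fs using subfms_refl by blast
  qed
  have v: "F.valid A"
    by (rule F.soundness[OF T(3)], rule F_valid_axiom) (use T(1) Fs in auto)
  have "C.sat IKPE A w (canv w)"
    by (rule sigma_descent[OF assms(1) _ v w(1) env_canv[OF w(1)]]) (use Fs in auto)
  then show False using w(2) by blast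
qed

end
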